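(* Let $R$ be a commutative ring and let $(\mathcal{C},\pi,\xi)$ be a symmetric monoidal $\Pi$-category over $R$ which is $\otimes$-cocomplete. Let $k\ge 0$. 1. Let $a$ be a commutative monoid in $\mathcal{C}$ and let $x\to a$ be a map in $\mathcal{C}$ such that the canonical map of monoids $Sx\to a$ is an epimorphism in $\mathcal{C}$. Then the map $\mathrm{can}^*:\underline{\mathrm{D}}_k(a)\to\underline{\mathcal{C}}(S^{\le k}x,a)$, given by precomposition (in $\underline{\mathcal C}$) with the canonical map $\mathrm{can}: S^{\le k}x\to Sx\to a$, is injective. 2. For all $x\in\mathcal{C}$, restriction along $S^{\le k}x\to Sx$ gives an isomorphism of $R$-supermodules $\underline{\mathrm{D}}_k(Sx)\cong\underline{\mathcal{C}}(S^{\le k}x,Sx)$.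
   Context: A symmetric monoidal $\Pi$-category over $R$ is an $R$-linear symmetric monoidal category $\mathcal{C}$ (symmetry $\sigma$, unit $1$) with an object $\pi$ such that $\sigma_{\pi,\pi}=-\mathrm{id}_{\pi\otimes\pi}$ and an isomorphism $\xi:\pi\otimes\pi\to 1$. Write $\pi^0=1$, $\pi^1=\pi$ (exponents in $\mathbb{Z}/2$). Its associated symmetric monoidal supercategory $\underline{\mathcal{C}}$ has the same objects; $\underline{\mathcal{C}}(x,y)$ is the $R$-supermodule with even part $\mathcal{C}(x,y)$ and odd part $\mathcal{C}(\pi\otimes x,y)$. The composite of homogeneous $f\in\underline{\mathcal C}(x,y)$, $g\in\underline{\mathcal C}(y,z)$ is $\pi^{|g|+|f|}\otimes x\cong\pi^{|g|}\otimes\pi^{|f|}\otimes x\xrightarrow{\mathrm{id}\otimes f}\pi^{|g|}\otimes y\xrightarrow{g}z$ (using $\xi^{-1}$ if both are odd). The tensor product of homogeneous $f\in\underline{\mathcal C}(x,y)$, $f'\in\underline{\mathcal C}(x',y')$ is $\pi^{|f|+|f'|}\otimes x\otimes x'\cong\pi^{|f|}\otimes x\otimes\pi^{|f'|}\otimes x'\xrightarrow{f\otimes f'}y\otimes y'$ (using $\xi^{-1}$ if both odd, and $\sigma$). $\otimes$-cocomplete: $\mathcal{C}$ has all small colimits and $\otimes$ preserves them in each variable. Then the free commutative monoid on $x$ is $Sx=\bigsqcup_{n\ge0}S^nx$ with $S^nx=(x^{\otimes n})_{S_n}$ the coequaliser of the permutation action, and $S^{\le k}x=\bigsqcup_{n=0}^kS^nx$.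 Differential operators: let $a$ be a commutative monoid in $\mathcal{C}$ with multiplication $\mu$. For $m\ge1$ and $f\in\underline{\mathcal{C}}(a^{\otimes m},a)$ define $T(f)\in\underline{\mathcal{C}}(a^{\otimes(m+1)},a)$ by $$T(f)=f\circ(\mathrm{id}_{a^{\otimes(m-1)}}\otimes\mu)\circ(\sigma_{a,a^{\otimes(m-1)}}\otimes\mathrm{id}_a)-\mu\circ(\mathrm{id}_a\otimes f)$$ (compositions and tensor products in $\underline{\mathcal{C}}$). $\underline{\mathrm{D}}_k(a)\subset\underline{\mathcal{C}}(a,a)$ is the sub-supermodule of those $\Delta$ with $T^{k+1}(\Delta)=0$ (differential operators of order $\le k$). *)

theory Defs
  imports "HOL-Library.Z2" "HOL-Combinatorics.Transposition" "HOL-Algebra.Module"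
begin

section \<open>Categories and colimits\<close>

record ('o, 'm) category =
  Ob :: "'o set"
  Hom :: "'o \<Rightarrow> 'o \<Rightarrow> 'm set"
  ident :: "'o \<Rightarrow> 'm" ("\<i>\<d>\<index>")
  compose :: "'m \<Rightarrow> 'm \<Rightarrow> 'm" (infixr "\<cdot>\<index>" 55)

locale category =
  fixes C (structure)
  assumes Hom_Ob: "f \<in> Hom C x y \<Longrightarrow> x \<in> Ob C \<and> y \<in> Ob C"
    and Hom_disjoint: "\<lbrakk>f \<in> Hom C x y; f \<in> Hom C x' y'\<rbrakk> \<Longrightarrow> x = x' \<and> y = y'"
    and ident_Hom: "x \<in> Ob C \<Longrightarrow> \<i>\<d> x \<in> Hom C x x"
    and comp_Hom: "\<lbrakk>f \<in> Hom C x y; g \<in> Hom C y z\<rbrakk> \<Longrightarrow> g \<cdot> f \<in> Hom C x z"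
    and comp_ident: "f \<in> Hom C x y \<Longrightarrow> f \<cdot> \<i>\<d> x = f"
    and ident_comp: "f \<in> Hom C x y \<Longrightarrow> \<i>\<d> y \<cdot> f = f"
    and comp_assoc: "\<lbrakk>f \<in> Hom C w x; g \<in> Hom C x y; h \<in> Hom C y z\<rbrakk>
                      \<Longrightarrow> (h \<cdot> g) \<cdot> f = h \<cdot> (g \<cdot> f)"

definition inverse_arrows :: "('o, 'm, 'z) category_scheme \<Rightarrow> 'm \<Rightarrow> 'm \<Rightarrow> bool" where
  "inverse_arrows C f g \<longleftrightarrow>
     (\<exists>x y. f \<in> Hom C x y \<and> g \<in> Hom C y x \<and> g \<cdot>\<^bsub>C\<^esub> f = \<i>\<d>\<^bsub>C\<^esub> x \<and> f \<cdot>\<^bsub>C\<^esub> g = \<i>\<d>\<^bsub>C\<^esub> y)"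

definition iso_arrow :: "('o, 'm, 'z) category_scheme \<Rightarrow> 'm \<Rightarrow> bool" where
  "iso_arrow C f \<longleftrightarrow> (\<exists>g. inverse_arrows C f g)"

definition inv_arrow :: "('o, 'm, 'z) category_scheme \<Rightarrow> 'm \<Rightarrow> 'm" ("\<i>\<n>\<v>\<index>") where
  "inv_arrow C f = (THE g. inverse_arrows C f g)"

definition epi_arrow :: "('o, 'm, 'z) category_scheme \<Rightarrow> 'm \<Rightarrow> bool" where
  "epi_arrow C f \<longleftrightarrow>
     (\<exists>x y. f \<in> Hom C x y \<and>
       (\<forall>z. \<forall>g \<in> Hom C y z. \<forall>h \<in> Hom C y z. g \<cdot>\<^bsub>C\<^esub> f = h \<cdot>\<^bsub>C\<^esub> f \<longrightarrow> g = h))"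

definition is_functor ::
  "('i, 'j, 'u) category_scheme \<Rightarrow> ('o, 'm, 'z) category_scheme \<Rightarrow> ('i \<Rightarrow> 'o) \<Rightarrow> ('j \<Rightarrow> 'm) \<Rightarrow> bool"
where
  "is_functor J C Fo Fm \<longleftrightarrow>
     (\<forall>i \<in> Ob J. Fo i \<in> Ob C) \<and>
     (\<forall>i j. \<forall>u \<in> Hom J i j. Fm u \<in> Hom C (Fo i) (Fo j)) \<and>
     (\<forall>i \<in> Ob J. Fm (\<i>\<d>\<^bsub>J\<^esub> i) = \<i>\<d>\<^bsub>C\<^esub> (Fo i)) \<and>
     (\<forall>i j l. \<forall>u \<in> Hom J i j. \<forall>v \<in> Hom J j l. Fm (v \<cdot>\<^bsub>J\<^esub> u) = Fm v \<cdot>\<^bsub>C\<^esub> Fm u)"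

definition is_cocone ::
  "('i, 'j, 'u) category_scheme \<Rightarrow> ('o, 'm, 'z) category_scheme \<Rightarrow> ('i \<Rightarrow> 'o) \<Rightarrow> ('j \<Rightarrow> 'm)
    \<Rightarrow> 'o \<Rightarrow> ('i \<Rightarrow> 'm) \<Rightarrow> bool"
where
  "is_cocone J C Fo Fm c \<iota> \<longleftrightarrow>
     c \<in> Ob C \<and> (\<forall>i \<in> Ob J. \<iota> i \<in> Hom C (Fo i) c) \<and>
     (\<forall>i j. \<forall>u \<in> Hom J i j. \<iota> j \<cdot>\<^bsub>C\<^esub> Fm u = \<iota> i)"

definition is_colimit ::
  "('i, 'j, 'u) category_scheme \<Rightarrow> ('o, 'm, 'z) category_scheme \<Rightarrow> ('i \<Rightarrow> 'o) \<Rightarrow> ('j \<Rightarrow> 'm)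
    \<Rightarrow> 'o \<Rightarrow> ('i \<Rightarrow> 'm) \<Rightarrow> bool"
where
  "is_colimit J C Fo Fm c \<iota> \<longleftrightarrow>
     is_cocone J C Fo Fm c \<iota> \<and>
     (\<forall>d \<kappa>. is_cocone J C Fo Fm d \<kappa> \<longrightarrow>
       (\<exists>!h. h \<in> Hom C c d \<and> (\<forall>i \<in> Ob J. h \<cdot>\<^bsub>C\<^esub> \<iota> i = \<kappa> i)))"

definition is_coproduct ::
  "('o, 'm, 'z) category_scheme \<Rightarrow> 'i set \<Rightarrow> ('i \<Rightarrow> 'o) \<Rightarrow> 'o \<Rightarrow> ('i \<Rightarrow> 'm) \<Rightarrow> bool"
where
  "is_coproduct C I A c \<iota> \<longleftrightarrow>
     c \<in> Ob C \<and> (\<forall>i \<in> I. \<iota> i \<in> Hom C (A i) c) \<and>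
     (\<forall>d \<kappa>. d \<in> Ob C \<and> (\<forall>i \<in> I. \<kappa> i \<in> Hom C (A i) d) \<longrightarrow>
       (\<exists>!h. h \<in> Hom C c d \<and> (\<forall>i \<in> I. h \<cdot>\<^bsub>C\<^esub> \<iota> i = \<kappa> i)))"

definition cotuple ::
  "('o, 'm, 'z) category_scheme \<Rightarrow> 'i set \<Rightarrow> 'o \<Rightarrow> ('i \<Rightarrow> 'm) \<Rightarrow> 'o \<Rightarrow> ('i \<Rightarrow> 'm) \<Rightarrow> 'm"
where
  "cotuple C I c \<iota> d \<kappa> = (THE h. h \<in> Hom C c d \<and> (\<forall>i \<in> I. h \<cdot>\<^bsub>C\<^esub> \<iota> i = \<kappa> i))"

text \<open>Coequaliser of a family \<open>F\<close> of parallel arrows with common codomain \<open>y\<close>.\<close>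

definition is_coequaliser ::
  "('o, 'm, 'z) category_scheme \<Rightarrow> 'm set \<Rightarrow> 'o \<Rightarrow> 'o \<Rightarrow> 'm \<Rightarrow> bool"
where
  "is_coequaliser C F y c q \<longleftrightarrow>
     q \<in> Hom C y c \<and> (\<forall>f \<in> F. \<forall>g \<in> F. q \<cdot>\<^bsub>C\<^esub> f = q \<cdot>\<^bsub>C\<^esub> g) \<and>
     (\<forall>d. \<forall>r \<in> Hom C y d. (\<forall>f \<in> F. \<forall>g \<in> F. r \<cdot>\<^bsub>C\<^esub> f = r \<cdot>\<^bsub>C\<^esub> g) \<longrightarrow>
       (\<exists>!h. h \<in> Hom C c d \<and> h \<cdot>\<^bsub>C\<^esub> q = r))"

section \<open>Linear symmetric monoidal categories\<close>

text \<open>Each set of morphisms carries an \<open>R\<close>-module structure \<open>\<H>\<close>; the fields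
  \<^const>\<open>mult\<close> and \<^const>\<open>one\<close> that the type of modules inherits from rings are irrelevant.\<close>

record ('r, 'o, 'm) linear_category = "('o, 'm) category" +
  hom_module :: "'o \<Rightarrow> 'o \<Rightarrow> ('r, 'm) module" ("\<H>\<index>")

locale linear_category = cring R + category C
  for R :: "('r, 'k) ring_scheme" and C :: "('r, 'o, 'm, 'z) linear_category_scheme" (structure) +
  assumes hom_module: "\<lbrakk>x \<in> Ob C; y \<in> Ob C\<rbrakk> \<Longrightarrow> module R (\<H> x y)"
    and carrier_hom_module: "\<lbrakk>x \<in> Ob C; y \<in> Ob C\<rbrakk> \<Longrightarrow> carrier (\<H> x y) = Hom C x y"
    and comp_add_right: "\<lbrakk>f \<in> Hom C x y; f' \<in> Hom C x y; g \<in> Hom C y z\<rbrakk>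
          \<Longrightarrow> g \<cdot> (f \<oplus>\<^bsub>\<H> x y\<^esub> f') = (g \<cdot> f) \<oplus>\<^bsub>\<H> x z\<^esub> (g \<cdot> f')"
    and comp_add_left: "\<lbrakk>f \<in> Hom C x y; g \<in> Hom C y z; g' \<in> Hom C y z\<rbrakk>
          \<Longrightarrow> (g \<oplus>\<^bsub>\<H> y z\<^esub> g') \<cdot> f = (g \<cdot> f) \<oplus>\<^bsub>\<H> x z\<^esub> (g' \<cdot> f)"
    and comp_smult_right: "\<lbrakk>r \<in> carrier R; f \<in> Hom C x y; g \<in> Hom C y z\<rbrakk>
          \<Longrightarrow> g \<cdot> (r \<odot>\<^bsub>\<H> x y\<^esub> f) = r \<odot>\<^bsub>\<H> x z\<^esub> (g \<cdot> f)"
    and comp_smult_left: "\<lbrakk>r \<in> carrier R; f \<in> Hom C x y; g \<in> Hom C y z\<rbrakk>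
          \<Longrightarrow> (r \<odot>\<^bsub>\<H> y z\<^esub> g) \<cdot> f = r \<odot>\<^bsub>\<H> x z\<^esub> (g \<cdot> f)"

record ('r, 'o, 'm) sm_category = "('r, 'o, 'm) linear_category" +
  tens_ob :: "'o \<Rightarrow> 'o \<Rightarrow> 'o" (infixr "\<otimes>\<^sub>o\<index>" 70)
  tens_ar :: "'m \<Rightarrow> 'm \<Rightarrow> 'm" (infixr "\<otimes>\<^sub>a\<index>" 70)
  unit_ob :: 'o ("\<I>\<index>")
  associator :: "'o \<Rightarrow> 'o \<Rightarrow> 'o \<Rightarrow> 'm" ("\<alpha>\<index>")
  lunitor :: "'o \<Rightarrow> 'm" ("\<l>\<index>")
  runitor :: "'o \<Rightarrow> 'm" ("\<r>\<index>")
  symmetry :: "'o \<Rightarrow> 'o \<Rightarrow> 'm" ("\<sigma>\<index>")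

locale sm_category = linear_category R C
  for R :: "('r, 'k) ring_scheme" and C :: "('r, 'o, 'm, 'z) sm_category_scheme" (structure) +
  assumes tens_Ob: "\<lbrakk>x \<in> Ob C; y \<in> Ob C\<rbrakk> \<Longrightarrow> x \<otimes>\<^sub>o y \<in> Ob C"
    and unit_Ob: "\<I> \<in> Ob C"
    and tens_Hom: "\<lbrakk>f \<in> Hom C x y; f' \<in> Hom C x' y'\<rbrakk>
          \<Longrightarrow> f \<otimes>\<^sub>a f' \<in> Hom C (x \<otimes>\<^sub>o x') (y \<otimes>\<^sub>o y')"
    and tens_ident: "\<lbrakk>x \<in> Ob C; y \<in> Ob C\<rbrakk> \<Longrightarrow> \<i>\<d> x \<otimes>\<^sub>a \<i>\<d> y = \<i>\<d> (x \<otimes>\<^sub>o y)"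
    and tens_comp: "\<lbrakk>f \<in> Hom C x y; g \<in> Hom C y z; f' \<in> Hom C x' y'; g' \<in> Hom C y' z'\<rbrakk>
          \<Longrightarrow> (g \<cdot> f) \<otimes>\<^sub>a (g' \<cdot> f') = (g \<otimes>\<^sub>a g') \<cdot> (f \<otimes>\<^sub>a f')"
    and tens_add_left: "\<lbrakk>f \<in> Hom C x y; g \<in> Hom C x y; h \<in> Hom C x' y'\<rbrakk>
          \<Longrightarrow> (f \<oplus>\<^bsub>\<H> x y\<^esub> g) \<otimes>\<^sub>a h
              = (f \<otimes>\<^sub>a h) \<oplus>\<^bsub>\<H> (x \<otimes>\<^sub>o x') (y \<otimes>\<^sub>o y')\<^esub> (g \<otimes>\<^sub>a h)"
    and tens_add_right: "\<lbrakk>h \<in> Hom C x y; f \<in> Hom C x' y'; g \<in> Hom C x' y'\<rbrakk>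
          \<Longrightarrow> h \<otimes>\<^sub>a (f \<oplus>\<^bsub>\<H> x' y'\<^esub> g)
              = (h \<otimes>\<^sub>a f) \<oplus>\<^bsub>\<H> (x \<otimes>\<^sub>o x') (y \<otimes>\<^sub>o y')\<^esub> (h \<otimes>\<^sub>a g)"
    and tens_smult_left: "\<lbrakk>r \<in> carrier R; f \<in> Hom C x y; g \<in> Hom C x' y'\<rbrakk>
          \<Longrightarrow> (r \<odot>\<^bsub>\<H> x y\<^esub> f) \<otimes>\<^sub>a g
              = r \<odot>\<^bsub>\<H> (x \<otimes>\<^sub>o x') (y \<otimes>\<^sub>o y')\<^esub> (f \<otimes>\<^sub>a g)"
    and tens_smult_right: "\<lbrakk>r \<in> carrier R; f \<in> Hom C x y; g \<in> Hom C x' y'\<rbrakk>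
          \<Longrightarrow> f \<otimes>\<^sub>a (r \<odot>\<^bsub>\<H> x' y'\<^esub> g)
              = r \<odot>\<^bsub>\<H> (x \<otimes>\<^sub>o x') (y \<otimes>\<^sub>o y')\<^esub> (f \<otimes>\<^sub>a g)"
    and associator_Hom: "\<lbrakk>x \<in> Ob C; y \<in> Ob C; z \<in> Ob C\<rbrakk>
          \<Longrightarrow> \<alpha> x y z \<in> Hom C ((x \<otimes>\<^sub>o y) \<otimes>\<^sub>o z) (x \<otimes>\<^sub>o (y \<otimes>\<^sub>o z))"
    and associator_iso: "\<lbrakk>x \<in> Ob C; y \<in> Ob C; z \<in> Ob C\<rbrakk> \<Longrightarrow> iso_arrow C (\<alpha> x y z)"
    and associator_nat: "\<lbrakk>f \<in> Hom C x x'; g \<in> Hom C y y'; h \<in> Hom C z z'\<rbrakk>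
          \<Longrightarrow> \<alpha> x' y' z' \<cdot> ((f \<otimes>\<^sub>a g) \<otimes>\<^sub>a h) = (f \<otimes>\<^sub>a (g \<otimes>\<^sub>a h)) \<cdot> \<alpha> x y z"
    and lunitor_Hom: "x \<in> Ob C \<Longrightarrow> \<l> x \<in> Hom C (\<I> \<otimes>\<^sub>o x) x"
    and lunitor_iso: "x \<in> Ob C \<Longrightarrow> iso_arrow C (\<l> x)"
    and lunitor_nat: "f \<in> Hom C x y \<Longrightarrow> \<l> y \<cdot> (\<i>\<d> \<I> \<otimes>\<^sub>a f) = f \<cdot> \<l> x"
    and runitor_Hom: "x \<in> Ob C \<Longrightarrow> \<r> x \<in> Hom C (x \<otimes>\<^sub>o \<I>) x"
    and runitor_iso: "x \<in> Ob C \<Longrightarrow> iso_arrow C (\<r> x)"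
    and runitor_nat: "f \<in> Hom C x y \<Longrightarrow> \<r> y \<cdot> (f \<otimes>\<^sub>a \<i>\<d> \<I>) = f \<cdot> \<r> x"
    and pentagon: "\<lbrakk>w \<in> Ob C; x \<in> Ob C; y \<in> Ob C; z \<in> Ob C\<rbrakk>
          \<Longrightarrow> (\<i>\<d> w \<otimes>\<^sub>a \<alpha> x y z) \<cdot> \<alpha> w (x \<otimes>\<^sub>o y) z \<cdot> (\<alpha> w x y \<otimes>\<^sub>a \<i>\<d> z)
              = \<alpha> w x (y \<otimes>\<^sub>o z) \<cdot> \<alpha> (w \<otimes>\<^sub>o x) y z"
    and triangle: "\<lbrakk>x \<in> Ob C; y \<in> Ob C\<rbrakk>
          \<Longrightarrow> (\<i>\<d> x \<otimes>\<^sub>a \<l> y) \<cdot> \<alpha> x \<I> y = \<r> x \<otimes>\<^sub>a \<i>\<d> y"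
    and symmetry_Hom: "\<lbrakk>x \<in> Ob C; y \<in> Ob C\<rbrakk> \<Longrightarrow> \<sigma> x y \<in> Hom C (x \<otimes>\<^sub>o y) (y \<otimes>\<^sub>o x)"
    and symmetry_nat: "\<lbrakk>f \<in> Hom C x x'; g \<in> Hom C y y'\<rbrakk>
          \<Longrightarrow> \<sigma> x' y' \<cdot> (f \<otimes>\<^sub>a g) = (g \<otimes>\<^sub>a f) \<cdot> \<sigma> x y"
    and symmetry_sq: "\<lbrakk>x \<in> Ob C; y \<in> Ob C\<rbrakk> \<Longrightarrow> \<sigma> y x \<cdot> \<sigma> x y = \<i>\<d> (x \<otimes>\<^sub>o y)"
    and hexagon: "\<lbrakk>x \<in> Ob C; y \<in> Ob C; z \<in> Ob C\<rbrakk>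
          \<Longrightarrow> \<alpha> y z x \<cdot> \<sigma> x (y \<otimes>\<^sub>o z) \<cdot> \<alpha> x y z
              = (\<i>\<d> y \<otimes>\<^sub>a \<sigma> x z) \<cdot> \<alpha> y x z \<cdot> (\<sigma> x y \<otimes>\<^sub>a \<i>\<d> z)"

text \<open>Smallness is measured by the type \<open>'s\<close>: the index categories are those whose objects and
  arrows can be taken from \<open>'s\<close>.\<close>

definition tensor_cocomplete ::
  "'s itself \<Rightarrow> ('r, 'o, 'm, 'z) sm_category_scheme \<Rightarrow> bool"
where
  "tensor_cocomplete s C \<longleftrightarrow>
     (\<forall>(J :: ('s, 's) category) Fo Fm. category J \<and> is_functor J C Fo Fm \<longrightarrow>
       (\<exists>c \<iota>. is_colimit J C Fo Fm c \<iota>)) \<and>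
     (\<forall>(J :: ('s, 's) category) Fo Fm c \<iota>. \<forall>y \<in> Ob C.
       category J \<and> is_functor J C Fo Fm \<and> is_colimit J C Fo Fm c \<iota> \<longrightarrow>
         is_colimit J C (\<lambda>i. y \<otimes>\<^sub>o\<^bsub>C\<^esub> Fo i) (\<lambda>u. \<i>\<d>\<^bsub>C\<^esub> y \<otimes>\<^sub>a\<^bsub>C\<^esub> Fm u)
           (y \<otimes>\<^sub>o\<^bsub>C\<^esub> c) (\<lambda>i. \<i>\<d>\<^bsub>C\<^esub> y \<otimes>\<^sub>a\<^bsub>C\<^esub> \<iota> i) \<and>
         is_colimit J C (\<lambda>i. Fo i \<otimes>\<^sub>o\<^bsub>C\<^esub> y) (\<lambda>u. Fm u \<otimes>\<^sub>a\<^bsub>C\<^esub> \<i>\<d>\<^bsub>C\<^esub> y)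
           (c \<otimes>\<^sub>o\<^bsub>C\<^esub> y) (\<lambda>i. \<iota> i \<otimes>\<^sub>a\<^bsub>C\<^esub> \<i>\<d>\<^bsub>C\<^esub> y))"

section \<open>Commutative monoids and symmetric powers\<close>

record ('o, 'm) monoid_object =
  und :: 'o
  mul :: 'm
  uni :: 'm

record ('o, 'm) symmetric_algebra = "('o, 'm) monoid_object" +
  spow :: "nat \<Rightarrow> 'o"
  quo :: "nat \<Rightarrow> 'm"
  inc :: "nat \<Rightarrow> 'm"

context
  fixes C :: "('r, 'o, 'm, 'z) sm_category_scheme" (structure)
begin

definition commutative_monoid :: "('o, 'm, 'y) monoid_object_scheme \<Rightarrow> bool" where
  "commutative_monoid A \<longleftrightarrow>
     (let a = und A; \<mu> = mul A; \<eta> = uni A in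
        a \<in> Ob C \<and> \<mu> \<in> Hom C (a \<otimes>\<^sub>o a) a \<and> \<eta> \<in> Hom C \<I> a \<and>
        \<mu> \<cdot> (\<mu> \<otimes>\<^sub>a \<i>\<d> a) = \<mu> \<cdot> (\<i>\<d> a \<otimes>\<^sub>a \<mu>) \<cdot> \<alpha> a a a \<and>
        \<mu> \<cdot> (\<eta> \<otimes>\<^sub>a \<i>\<d> a) = \<l> a \<and> \<mu> \<cdot> (\<i>\<d> a \<otimes>\<^sub>a \<eta>) = \<r> a \<and>
        \<mu> \<cdot> \<sigma> a a = \<mu>)"

definition monoid_map ::
  "('o, 'm, 'y) monoid_object_scheme \<Rightarrow> ('o, 'm, 'w) monoid_object_scheme \<Rightarrow> 'm \<Rightarrow> bool"
where
  "monoid_map A B g \<longleftrightarrow>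
     g \<in> Hom C (und A) (und B) \<and> g \<cdot> mul A = mul B \<cdot> (g \<otimes>\<^sub>a g) \<and>
     g \<cdot> uni A = uni B"

text \<open>The powers are bracketed to the left, with the first power equal to \<open>x\<close> itself rather
  than to \<open>\<I> \<otimes>\<^sub>o x\<close>.\<close>

fun tpow :: "'o \<Rightarrow> nat \<Rightarrow> 'o" where
  "tpow x 0 = \<I>"
| "tpow x (Suc 0) = x"
| "tpow x (Suc (Suc n)) = tpow x (Suc n) \<otimes>\<^sub>o x"

definition snoc :: "'o \<Rightarrow> nat \<Rightarrow> 'm" where
  "snoc x n = (if n = 0 then \<l> x else \<i>\<d> (tpow x (Suc n)))"
  \<comment> \<open>\<open>tpow x n \<otimes>\<^sub>o x \<rightarrow> tpow x (Suc n)\<close>\<close>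

primrec tcat :: "'o \<Rightarrow> nat \<Rightarrow> nat \<Rightarrow> 'm" where
  "tcat x m 0 = \<r> (tpow x m)"
| "tcat x m (Suc n) =
     snoc x (m + n) \<cdot> (tcat x m n \<otimes>\<^sub>a \<i>\<d> x) \<cdot> \<i>\<n>\<v> (\<alpha> (tpow x m) (tpow x n) x)
       \<cdot> (\<i>\<d> (tpow x m) \<otimes>\<^sub>a \<i>\<n>\<v> (snoc x n))"
  \<comment> \<open>\<open>tpow x m \<otimes>\<^sub>o tpow x n \<rightarrow> tpow x (m + n)\<close>\<close>

text \<open>Interchange of the factors number \<open>i\<close> and \<open>Suc i\<close> (counted from 0) of \<open>tpow x n\<close>.\<close>

definition adjacent_swap :: "'o \<Rightarrow> nat \<Rightarrow> nat \<Rightarrow> 'm" where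
  "adjacent_swap x n i =
     (let j = n - i - 2; t = tcat x (i + 2) j \<cdot> (tcat x i 2 \<otimes>\<^sub>a \<i>\<d> (tpow x j)) in
        t \<cdot> ((\<i>\<d> (tpow x i) \<otimes>\<^sub>a \<sigma> x x) \<otimes>\<^sub>a \<i>\<d> (tpow x j)) \<cdot> \<i>\<n>\<v> t)"

text \<open>\<open>perm_action x n p f\<close>: the permutation \<open>p\<close> of \<open>{..<n}\<close> acts on \<open>tpow x n\<close> by \<open>f\<close>. Adjacent
  transpositions generate the symmetric group, so every such \<open>p\<close> is reached, and \<open>f\<close> depends
  only on \<open>p\<close> by the coherence theorem.\<close>

inductive perm_action :: "'o \<Rightarrow> nat \<Rightarrow> (nat \<Rightarrow> nat) \<Rightarrow> 'm \<Rightarrow> bool" for x n where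
  perm_action_id: "perm_action x n id (\<i>\<d> (tpow x n))"
| perm_action_transpose: "\<lbrakk>perm_action x n p f; Suc i < n\<rbrakk>
    \<Longrightarrow> perm_action x n (p \<circ> transpose i (Suc i)) (f \<cdot> adjacent_swap x n i)"

text \<open>The free commutative monoid on \<open>x\<close>, for an arbitrary choice of the coequalisers
  \<open>quo S n : tpow x n \<rightarrow> spow S n\<close> and of the coproduct \<open>und S\<close> of the \<open>spow S n\<close> with inclusions
  \<open>inc S n\<close>. The multiplication is the one induced by concatenation of tensor powers: if
  \<open>\<otimes>\<close> preserves colimits, then the last condition determines it uniquely, and the monoid laws
  are a consequence.\<close>

definition is_symmetric_algebra :: "'o \<Rightarrow> ('o, 'm, 'y) symmetric_algebra_scheme \<Rightarrow> bool" where
  "is_symmetric_algebra x S \<longleftrightarrow>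
     (\<forall>n. is_coequaliser C {f. \<exists>p. perm_action x n p f} (tpow x n) (spow S n) (quo S n)) \<and>
     is_coproduct C UNIV (spow S) (und S) (inc S) \<and>
     commutative_monoid S \<and>
     uni S = inc S 0 \<cdot> quo S 0 \<and>
     (\<forall>m n. mul S \<cdot> ((inc S m \<cdot> quo S m) \<otimes>\<^sub>a (inc S n \<cdot> quo S n))
              = inc S (m + n) \<cdot> quo S (m + n) \<cdot> tcat x m n)"

definition generator :: "('o, 'm, 'y) symmetric_algebra_scheme \<Rightarrow> 'm" where
  "generator S = inc S 1 \<cdot> quo S 1"
  \<comment> \<open>\<open>x = tpow x 1 \<rightarrow> und S\<close>\<close>

text \<open>The truncation \<open>b = \<Squnion>\<^bsub>n \<le> k\<^esub> spow S n\<close> with inclusions \<open>j n\<close>, and its canonical map to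
  \<open>und S\<close>.\<close>

definition is_truncation ::
  "('o, 'm, 'y) symmetric_algebra_scheme \<Rightarrow> nat \<Rightarrow> 'o \<Rightarrow> (nat \<Rightarrow> 'm) \<Rightarrow> bool"
where
  "is_truncation S k b j \<longleftrightarrow> is_coproduct C {..k} (spow S) b j"

definition truncation_map ::
  "('o, 'm, 'y) symmetric_algebra_scheme \<Rightarrow> nat \<Rightarrow> 'o \<Rightarrow> (nat \<Rightarrow> 'm) \<Rightarrow> 'm"
where
  "truncation_map S k b j = cotuple C {..k} b j (und S) (inc S)"

end

section \<open>Supermodules\<close>

record ('r, 'm) supermodule = "('r, 'm) module" +
  part :: "bit \<Rightarrow> 'm set"

locale supermodule = module R M
  for R :: "('r, 'k) ring_scheme" and M :: "('r, 'm, 'z) supermodule_scheme" +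
  assumes part_submodule: "submodule (part M p) R M"
    and part_decomposition: "v \<in> carrier M \<Longrightarrow>
          \<exists>!w. fst w \<in> part M 0 \<and> snd w \<in> part M 1 \<and> v = fst w \<oplus>\<^bsub>M\<^esub> snd w"

definition supermodule_iso ::
  "('r, 'k) ring_scheme \<Rightarrow> ('r, 'm, 'y) supermodule_scheme \<Rightarrow> ('r, 'n, 'z) supermodule_scheme
    \<Rightarrow> ('m \<Rightarrow> 'n) \<Rightarrow> bool"
where
  "supermodule_iso R M N h \<longleftrightarrow>
     supermodule R M \<and> supermodule R N \<and> bij_betw h (carrier M) (carrier N) \<and>
     (\<forall>v \<in> carrier M. \<forall>w \<in> carrier M. h (v \<oplus>\<^bsub>M\<^esub> w) = h v \<oplus>\<^bsub>N\<^esub> h w) \<and>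
     (\<forall>r \<in> carrier R. \<forall>v \<in> carrier M. h (r \<odot>\<^bsub>M\<^esub> v) = r \<odot>\<^bsub>N\<^esub> h v) \<and>
     (\<forall>p. \<forall>v \<in> part M p. h v \<in> part N p)"

section \<open>\<open>\<Pi>\<close>-categories and their supercategories\<close>

record ('r, 'o, 'm) pi_category = "('r, 'o, 'm) sm_category" +
  pi_ob :: 'o ("\<pi>\<index>")
  xi :: 'm ("\<xi>\<index>")

locale pi_category = sm_category R C
  for R :: "('r, 'k) ring_scheme" and C :: "('r, 'o, 'm, 'z) pi_category_scheme" (structure) +
  assumes pi_Ob: "\<pi> \<in> Ob C"
    and symmetry_pi: "\<sigma> \<pi> \<pi> = \<ominus>\<^bsub>\<H> (\<pi> \<otimes>\<^sub>o \<pi>) (\<pi> \<otimes>\<^sub>o \<pi>)\<^esub> \<i>\<d> (\<pi> \<otimes>\<^sub>o \<pi>)"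
    and xi_Hom: "\<xi> \<in> Hom C (\<pi> \<otimes>\<^sub>o \<pi>) \<I>"
    and xi_iso: "iso_arrow C \<xi>"

context
  fixes C :: "('r, 'o, 'm, 'z) pi_category_scheme" (structure)
begin

text \<open>\<open>pten p x\<close> is \<open>\<pi>\<^sup>p \<otimes>\<^sub>o x\<close>, with \<open>\<I> \<otimes>\<^sub>o x\<close> identified with \<open>x\<close>.\<close>

definition pten :: "bit \<Rightarrow> 'o \<Rightarrow> 'o" where
  "pten p x = (if p = 0 then x else \<pi> \<otimes>\<^sub>o x)"

definition pten_ar :: "bit \<Rightarrow> 'm \<Rightarrow> 'm" where
  "pten_ar p f = (if p = 0 then f else \<i>\<d> \<pi> \<otimes>\<^sub>a f)"

text \<open>A morphism of the supercategory is the family \<open>f\<close> of its even part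
  \<open>f 0 \<in> Hom C x y\<close> and its odd part \<open>f 1 \<in> Hom C (\<pi> \<otimes>\<^sub>o x) y\<close>.\<close>

definition super_hom :: "'o \<Rightarrow> 'o \<Rightarrow> ('r, bit \<Rightarrow> 'm) supermodule" where
  "super_hom x y =
     \<lparr>carrier = {f. \<forall>p. f p \<in> Hom C (pten p x) y},
      mult = undefined, one = undefined,
      zero = (\<lambda>p. \<zero>\<^bsub>\<H> (pten p x) y\<^esub>),
      add = (\<lambda>f g p. f p \<oplus>\<^bsub>\<H> (pten p x) y\<^esub> g p),
      smult = (\<lambda>r f p. r \<odot>\<^bsub>\<H> (pten p x) y\<^esub> f p),
      part = (\<lambda>p. {f. (\<forall>q. f q \<in> Hom C (pten q x) y) \<and>
                      (\<forall>q. q \<noteq> p \<longrightarrow> f q = \<zero>\<^bsub>\<H> (pten q x) y\<^esub>)})\<rparr>"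

definition even_ar :: "'o \<Rightarrow> 'o \<Rightarrow> 'm \<Rightarrow> bit \<Rightarrow> 'm" where
  "even_ar x y f = (\<lambda>p. if p = 0 then f else \<zero>\<^bsub>\<H> (pten p x) y\<^esub>)"

definition comp_split :: "bit \<Rightarrow> bit \<Rightarrow> 'o \<Rightarrow> 'm" where
  "comp_split q p x =
     (if q = 1 \<and> p = 1 then \<alpha> \<pi> \<pi> x \<cdot> (\<i>\<n>\<v> \<xi> \<otimes>\<^sub>a \<i>\<d> x) \<cdot> \<i>\<n>\<v> (\<l> x)
      else \<i>\<d> (pten (q + p) x))"
  \<comment> \<open>\<open>pten (q + p) x \<rightarrow> pten q (pten p x)\<close>\<close>

definition hom_comp :: "'o \<Rightarrow> bit \<Rightarrow> 'm \<Rightarrow> bit \<Rightarrow> 'm \<Rightarrow> 'm" where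
  "hom_comp x q g p f = g \<cdot> pten_ar q f \<cdot> comp_split q p x"

text \<open>Composition of \<open>f \<in> super_hom x y\<close> and \<open>g \<in> super_hom y z\<close>: the component of parity \<open>r\<close>
  is the sum of the composites of the homogeneous components of parities \<open>q\<close> (of \<open>g\<close>) and
  \<open>r - q = r + q\<close> (of \<open>f\<close>), for \<open>q = 0, 1\<close>.\<close>

definition super_comp :: "'o \<Rightarrow> 'o \<Rightarrow> (bit \<Rightarrow> 'm) \<Rightarrow> (bit \<Rightarrow> 'm) \<Rightarrow> bit \<Rightarrow> 'm" where
  "super_comp x z g f =
     (\<lambda>r. hom_comp x 0 (g 0) r (f r)
          \<oplus>\<^bsub>\<H> (pten r x) z\<^esub> hom_comp x 1 (g 1) (r + 1) (f (r + 1)))"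

definition pass_left :: "bit \<Rightarrow> 'o \<Rightarrow> 'o \<Rightarrow> 'm" where
  "pass_left p x x' =
     (if p = 0 then \<i>\<d> (x \<otimes>\<^sub>o x')
      else \<alpha> x \<pi> x' \<cdot> (\<sigma> \<pi> x \<otimes>\<^sub>a \<i>\<d> x') \<cdot> \<i>\<n>\<v> (\<alpha> \<pi> x x'))"
  \<comment> \<open>\<open>pten p (x \<otimes>\<^sub>o x') \<rightarrow> x \<otimes>\<^sub>o pten p x'\<close>\<close>

definition pten_assoc :: "bit \<Rightarrow> 'o \<Rightarrow> 'o \<Rightarrow> 'm" where
  "pten_assoc p x w = (if p = 0 then \<i>\<d> (x \<otimes>\<^sub>o w) else \<i>\<n>\<v> (\<alpha> \<pi> x w))"
  \<comment> \<open>\<open>pten p (x \<otimes>\<^sub>o w) \<rightarrow> pten p x \<otimes>\<^sub>o w\<close>\<close>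

definition tens_split :: "bit \<Rightarrow> bit \<Rightarrow> 'o \<Rightarrow> 'o \<Rightarrow> 'm" where
  "tens_split p p' x x' =
     pten_assoc p x (pten p' x') \<cdot> pten_ar p (pass_left p' x x') \<cdot> comp_split p p' (x \<otimes>\<^sub>o x')"
  \<comment> \<open>\<open>pten (p + p') (x \<otimes>\<^sub>o x') \<rightarrow> pten p x \<otimes>\<^sub>o pten p' x'\<close>\<close>

definition hom_tens :: "'o \<Rightarrow> 'o \<Rightarrow> bit \<Rightarrow> 'm \<Rightarrow> bit \<Rightarrow> 'm \<Rightarrow> 'm" where
  "hom_tens x x' p f p' f' = (f \<otimes>\<^sub>a f') \<cdot> tens_split p p' x x'"

text \<open>Tensor product of \<open>f \<in> super_hom x y\<close> and \<open>f' \<in> super_hom x' y'\<close>, again summed over the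
  homogeneous components.\<close>

definition super_tens ::
  "'o \<Rightarrow> 'o \<Rightarrow> 'o \<Rightarrow> 'o \<Rightarrow> (bit \<Rightarrow> 'm) \<Rightarrow> (bit \<Rightarrow> 'm) \<Rightarrow> bit \<Rightarrow> 'm"
where
  "super_tens x y x' y' f f' =
     (\<lambda>r. hom_tens x x' 0 (f 0) r (f' r)
          \<oplus>\<^bsub>\<H> (pten r (x \<otimes>\<^sub>o x')) (y \<otimes>\<^sub>o y')\<^esub> hom_tens x x' 1 (f 1) (r + 1) (f' (r + 1)))"

section \<open>Differential operators\<close>

text \<open>The operator \<open>T\<close> on \<open>super_hom (tpow a (Suc n)) a\<close>. The structural maps preceding \<open>f\<close>
  are even and are composed in \<open>C\<close>: the first is
  \<open>(id \<otimes> \<mu>) \<cdot> (\<sigma> \<otimes> id) : a \<otimes> a\<^sup>n \<otimes> a \<rightarrow> a\<^sup>n \<otimes> a\<close>, with the associativity constraints written out,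
  and \<open>inv (tcat a 1 (Suc n))\<close> rebrackets \<open>tpow a (n + 2)\<close> as \<open>a \<otimes>\<^sub>o tpow a (n + 1)\<close>.\<close>

definition T_shift :: "('o, 'm, 'y) monoid_object_scheme \<Rightarrow> nat \<Rightarrow> 'm" where
  "T_shift A n =
     (let a = und A; b = tpow C a n in
        snoc C a n \<cdot> (\<i>\<d> b \<otimes>\<^sub>a mul A) \<cdot> \<alpha> b a a \<cdot> (\<sigma> a b \<otimes>\<^sub>a \<i>\<d> a)
          \<cdot> (\<i>\<n>\<v> (tcat C a 1 n) \<otimes>\<^sub>a \<i>\<d> a))"

definition T :: "('o, 'm, 'y) monoid_object_scheme \<Rightarrow> nat \<Rightarrow> (bit \<Rightarrow> 'm) \<Rightarrow> bit \<Rightarrow> 'm" where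
  "T A n f =
     (let a = und A; b = tpow C a (Suc n); c = tpow C a (Suc (Suc n)) in
        super_comp c a f (even_ar c b (T_shift A n))
        \<ominus>\<^bsub>super_hom c a\<^esub>
        super_comp c a (even_ar (a \<otimes>\<^sub>o a) a (mul A))
          (super_comp c (a \<otimes>\<^sub>o a)
            (super_tens a a b a (even_ar a a (\<i>\<d> a)) f)
            (even_ar c (a \<otimes>\<^sub>o b) (\<i>\<n>\<v> (tcat C a 1 (Suc n))))))"

primrec T_power :: "('o, 'm, 'y) monoid_object_scheme \<Rightarrow> nat \<Rightarrow> (bit \<Rightarrow> 'm) \<Rightarrow> bit \<Rightarrow> 'm" where
  "T_power A 0 \<Delta> = \<Delta>"
| "T_power A (Suc m) \<Delta> = T A m (T_power A m \<Delta>)"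

definition diff_ops ::
  "nat \<Rightarrow> ('o, 'm, 'y) monoid_object_scheme \<Rightarrow> ('r, bit \<Rightarrow> 'm) supermodule"
where
  "diff_ops k A =
     (let a = und A; M = super_hom a a;
          K = {\<Delta>. T_power A (Suc k) \<Delta> = \<zero>\<^bsub>super_hom (tpow C a (k + 2)) a\<^esub>} in
        M\<lparr>carrier := carrier M \<inter> K, part := (\<lambda>p. part M p \<inter> K)\<rparr>)"

definition precomp :: "'o \<Rightarrow> 'o \<Rightarrow> 'o \<Rightarrow> 'm \<Rightarrow> (bit \<Rightarrow> 'm) \<Rightarrow> bit \<Rightarrow> 'm" where
  "precomp b s a h \<Delta> = super_comp b a \<Delta> (even_ar b s h)"
  \<comment> \<open>for \<open>h \<in> Hom C b s\<close> and \<open>\<Delta> \<in> super_hom s a\<close>\<close>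

end

end

theory Submission
  imports Defs
begin

text \<open>Let \<open>a\<close> be generated by \<open>x\<close>. If \<open>\<Delta>\<close> has order \<open>\<le> k\<close> and vanishes on words in \<open>x\<close> of length
  \<open>\<le> k\<close>, then the commutator \<open>[\<Delta>, y]\<close> with a generator \<open>y\<close> has order \<open>\<le> k - 1\<close> and vanishes on
  words of length \<open>\<le> k - 1\<close>, so it is zero by induction; hence \<open>\<Delta>\<close> commutes with all generators and
  vanishes. This is injectivity.

  For surjectivity one corrects by induction on the degree, which leaves the case of values given by
  \<open>\<psi>\<close> in degree \<open>k\<close> and \<open>0\<close> below. There
  \<open>\<Delta> (x\<^sub>1 \<dots> x\<^sub>n) = \<Sum>\<^bsub>|I| = k\<^esub> \<psi> (x\<^sub>I) x\<^bsub>I\<^sup>c\<^esub>\<close> works. It is built by recursion on \<open>n\<close>, and its commutators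
  with generators are operators of the same kind with some factors of \<open>\<psi>\<close> filled in.

  The induction leads out of the arrows \<open>a \<rightarrow> a\<close>: one needs operators \<open>w \<otimes> a \<rightarrow> a\<close> depending on a
  parameter object \<open>w\<close>. Odd arrows are the operators with parameter \<open>\<pi>\<close>, so the sign of \<open>\<sigma>\<^bsub>\<pi>,\<pi>\<^esub>\<close> and the
  isomorphism \<open>\<xi>\<close> never enter. Equations between composites of structural arrows are tested on
  tensor products of labelled variables, where coherence becomes rewriting.\<close>

section \<open>Arrows with source and target\<close>

text \<open>The order of an operator is defined by commutators with all of \<open>a\<close>, while
  the argument controls only generators. Two facts bridge the gap. An arrow out of w \<otimes> a is
  determined by its restrictions to words, since tensoring preserves epimorphisms and the colimits
  that define Sx. And the order itself may be tested with the commutator variable restricted to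
  words. For existence, commutators with words are reduced to generators by the Leibniz rule
  [\<Delta>, v y] = y [\<Delta>, v] + [\<Delta>, y] v, which presupposes that [\<Delta>, y] is
  already known to have smaller order. Therefore a whole family is built at once: for a product c of
  generators, \<Delta>_c sends a word to the sum, over all subsets I of its letters, of \<psi>(c
  x_I) times the remaining letters. No size is imposed on I; the degree in which \<psi> lives
  selects it. The recursion on words then reads [\<Delta>_c, y] = \<Delta>_(cy), so each commutator
  raises the degree of c by one, and as soon as this degree exceeds k the operator is zero. The
  operator sought is the member with c = 1.\<close>

context category
begin

text \<open>Hom-sets are disjoint, so an arrow determines its source and target. With these as
  functions, typing conditions become equations that the simplifier can discharge.\<close>

definition arr where
  "arr f \<longleftrightarrow> (\<exists>x y. f \<in> Hom C x y)"

definition src where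
  "src f = (THE x. \<exists>y. f \<in> Hom C x y)"

definition tgt where
  "tgt f = (THE y. \<exists>x. f \<in> Hom C x y)"

lemma hom_iff: "f \<in> Hom C x y \<longleftrightarrow> arr f \<and> src f = x \<and> tgt f = y"
proof
  assume f: "f \<in> Hom C x y"
  have "src f = x" "tgt f = y"
    unfolding src_def tgt_def using f Hom_disjoint by (blast intro: the_equality)+
  then show "arr f \<and> src f = x \<and> tgt f = y"
    using f arr_def by blast
next
  assume a: "arr f \<and> src f = x \<and> tgt f = y"
  then obtain x' y' where f: "f \<in> Hom C x' y'"
    using arr_def by blast
  have "src f = x'" "tgt f = y'"
    unfolding src_def tgt_def using f Hom_disjoint by (blast intro: the_equality)+
  then show "f \<in> Hom C x y"
    using f a by blast
qed

lemma arr_hom: "arr f \<Longrightarrow> f \<in> Hom C (src f) (tgt f)"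
  by (simp add: hom_iff)

lemma src_Ob [simp]: "arr f \<Longrightarrow> src f \<in> Ob C"
  using Hom_Ob arr_hom by blast

lemma tgt_Ob [simp]: "arr f \<Longrightarrow> tgt f \<in> Ob C"
  using Hom_Ob arr_hom by blast

lemma ident_arr [simp]:
  assumes "x \<in> Ob C"
  shows "arr (\<i>\<d> x)" "src (\<i>\<d> x) = x" "tgt (\<i>\<d> x) = x"
  using ident_Hom[OF assms] by (simp_all add: hom_iff)

lemma comp_arr [simp]:
  assumes "arr f" "arr g" "src g = tgt f"
  shows "arr (g \<cdot> f)" "src (g \<cdot> f) = src f" "tgt (g \<cdot> f) = tgt g"
  using comp_Hom[of f "src f" "tgt f" g "tgt g"] assms by (simp_all add: hom_iff)

lemma comp_id [simp]: "arr f \<Longrightarrow> x = src f \<Longrightarrow> f \<cdot> \<i>\<d> x = f"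
  using comp_ident by (simp add: hom_iff)

lemma id_comp [simp]: "arr f \<Longrightarrow> x = tgt f \<Longrightarrow> \<i>\<d> x \<cdot> f = f"
  using ident_comp by (simp add: hom_iff)

lemma compA:
  "\<lbrakk>arr f; arr g; arr h; src g = tgt f; src h = tgt g\<rbrakk> \<Longrightarrow> (h \<cdot> g) \<cdot> f = h \<cdot> g \<cdot> f"
  using comp_assoc by (simp add: hom_iff)

lemma inverse_arrows_unique:
  assumes "inverse_arrows C f g" "inverse_arrows C f h"
  shows "g = h"
proof -
  obtain x y where *: "f \<in> Hom C x y" "g \<in> Hom C y x" "g \<cdot> f = \<i>\<d> x" "f \<cdot> g = \<i>\<d> y"
    using assms(1) by (auto simp: inverse_arrows_def)
  obtain x' y' where h: "f \<in> Hom C x' y'" "h \<in> Hom C y' x'" "h \<cdot> f = \<i>\<d> x'" "f \<cdot> h = \<i>\<d> y'"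
    using assms(2) by (auto simp: inverse_arrows_def)
  have "g = (h \<cdot> f) \<cdot> g"
    using * h by (simp add: hom_iff)
  also have "\<dots> = h \<cdot> (f \<cdot> g)"
    using * h by (subst compA) (simp_all add: hom_iff)
  also have "\<dots> = h"
    using * h by (simp add: hom_iff)
  finally show ?thesis .
qed

lemma inverse_arrows_inv: "iso_arrow C f \<Longrightarrow> inverse_arrows C f (\<i>\<n>\<v> f)"
  unfolding iso_arrow_def inv_arrow_def by (metis inverse_arrows_unique theI')

lemma inv_arr [simp]:
  assumes "iso_arrow C f"
  shows "arr (\<i>\<n>\<v> f)" "src (\<i>\<n>\<v> f) = tgt f" "tgt (\<i>\<n>\<v> f) = src f"
    "\<i>\<n>\<v> f \<cdot> f = \<i>\<d> (src f)" "f \<cdot> \<i>\<n>\<v> f = \<i>\<d> (tgt f)"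
  using inverse_arrows_inv[OF assms] by (auto simp: inverse_arrows_def hom_iff)

lemma iso_arr: "iso_arrow C f \<Longrightarrow> arr f"
  by (auto simp: iso_arrow_def inverse_arrows_def hom_iff)

lemma isoI:
  assumes "arr f" "arr g" "src g = tgt f" "tgt g = src f" "g \<cdot> f = \<i>\<d> (src f)" "f \<cdot> g = \<i>\<d> (tgt f)"
  shows "iso_arrow C f" "\<i>\<n>\<v> f = g"
proof -
  have i: "inverse_arrows C f g"
    unfolding inverse_arrows_def using assms by (auto simp: hom_iff)
  then show "iso_arrow C f"
    by (auto simp: iso_arrow_def)
  then show "\<i>\<n>\<v> f = g"
    using inverse_arrows_unique inverse_arrows_inv i by blast
qed

lemma inv_comp_cancel [simp]:
  "\<lbrakk>iso_arrow C f; arr g; tgt g = src f\<rbrakk> \<Longrightarrow> \<i>\<n>\<v> f \<cdot> f \<cdot> g = g"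
  using compA[of g f "\<i>\<n>\<v> f"] by (simp add: iso_arr)

lemma comp_inv_cancel [simp]:
  "\<lbrakk>iso_arrow C f; arr g; tgt g = tgt f\<rbrakk> \<Longrightarrow> f \<cdot> \<i>\<n>\<v> f \<cdot> g = g"
  using compA[of g "\<i>\<n>\<v> f" f] by (simp add: iso_arr)

lemma iso_comp [simp]:
  assumes "iso_arrow C f" "iso_arrow C g" "src g = tgt f"
  shows "iso_arrow C (g \<cdot> f)" "\<i>\<n>\<v> (g \<cdot> f) = \<i>\<n>\<v> f \<cdot> \<i>\<n>\<v> g"
  using isoI[of "g \<cdot> f" "\<i>\<n>\<v> f \<cdot> \<i>\<n>\<v> g"] assms by (simp_all add: iso_arr compA)

lemma iso_inv [simp]:
  assumes "iso_arrow C f"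
  shows "iso_arrow C (\<i>\<n>\<v> f)" "\<i>\<n>\<v> (\<i>\<n>\<v> f) = f"
  using isoI[of "\<i>\<n>\<v> f" f] assms by (simp_all add: iso_arr)

lemma iso_id [simp]:
  assumes "x \<in> Ob C"
  shows "iso_arrow C (\<i>\<d> x)" "\<i>\<n>\<v> (\<i>\<d> x) = \<i>\<d> x"
  using isoI[of "\<i>\<d> x" "\<i>\<d> x"] assms by simp_all

lemma iso_cancel_right:
  assumes "f \<cdot> i = g \<cdot> i" "iso_arrow C i" "arr f" "arr g" "src f = tgt i" "src g = tgt i"
  shows "f = g"
proof -
  have "(f \<cdot> i) \<cdot> \<i>\<n>\<v> i = (g \<cdot> i) \<cdot> \<i>\<n>\<v> i"
    using assms by simp
  then show ?thesis
    using assms(2-) by (simp add: compA iso_arr)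
qed

lemma iso_cancel_left:
  assumes "i \<cdot> f = i \<cdot> g" "iso_arrow C i" "arr f" "arr g" "tgt f = src i" "tgt g = src i"
  shows "f = g"
proof -
  have "\<i>\<n>\<v> i \<cdot> (i \<cdot> f) = \<i>\<n>\<v> i \<cdot> (i \<cdot> g)"
    using assms by simp
  then show ?thesis
    using assms(2-) by (simp add: iso_arr)
qed

end

section \<open>Coherence\<close>

context sm_category
begin

lemma tens_Ob' [simp]: "x \<in> Ob C \<Longrightarrow> y \<in> Ob C \<Longrightarrow> x \<otimes>\<^sub>o y \<in> Ob C"
  by (rule tens_Ob)

lemma unit_Ob' [simp]: "\<I> \<in> Ob C"
  by (rule unit_Ob)

lemma tens_arr [simp]:
  assumes "arr f" "arr g"
  shows "arr (f \<otimes>\<^sub>a g)" "src (f \<otimes>\<^sub>a g) = src f \<otimes>\<^sub>o src g" "tgt (f \<otimes>\<^sub>a g) = tgt f \<otimes>\<^sub>o tgt g"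
  using tens_Hom[OF arr_hom[OF assms(1)] arr_hom[OF assms(2)]] by (simp_all add: hom_iff)

lemma tens_id [simp]: "x \<in> Ob C \<Longrightarrow> y \<in> Ob C \<Longrightarrow> \<i>\<d> x \<otimes>\<^sub>a \<i>\<d> y = \<i>\<d> (x \<otimes>\<^sub>o y)"
  by (rule tens_ident)

abbreviation lwhisker (infixr "\<triangleright>" 70) where "x \<triangleright> f \<equiv> \<i>\<d> x \<otimes>\<^sub>a f"
abbreviation rwhisker (infixr "\<triangleleft>" 70) where "f \<triangleleft> x \<equiv> f \<otimes>\<^sub>a \<i>\<d> x"

lemma interchange:
  "\<lbrakk>arr f; arr g; arr f'; arr g'; src g = tgt f; src g' = tgt f'\<rbrakk>
    \<Longrightarrow> (g \<otimes>\<^sub>a g') \<cdot> (f \<otimes>\<^sub>a f') = (g \<cdot> f) \<otimes>\<^sub>a (g' \<cdot> f')"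
  using tens_comp by (simp add: hom_iff)

lemma interchange':
  "\<lbrakk>arr f; arr g; arr f'; arr g'; src g = tgt f; src g' = tgt f'; arr h; tgt h = src f \<otimes>\<^sub>o src f'\<rbrakk>
    \<Longrightarrow> (g \<otimes>\<^sub>a g') \<cdot> (f \<otimes>\<^sub>a f') \<cdot> h = ((g \<cdot> f) \<otimes>\<^sub>a (g' \<cdot> f')) \<cdot> h"
  by (simp add: compA[symmetric] interchange)

lemma iso_tens [simp]:
  assumes "iso_arrow C f" "iso_arrow C g"
  shows "iso_arrow C (f \<otimes>\<^sub>a g)" "\<i>\<n>\<v> (f \<otimes>\<^sub>a g) = \<i>\<n>\<v> f \<otimes>\<^sub>a \<i>\<n>\<v> g"
  using isoI[of "f \<otimes>\<^sub>a g" "\<i>\<n>\<v> f \<otimes>\<^sub>a \<i>\<n>\<v> g"] assms by (simp_all add: iso_arr interchange)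

lemma assoc_arr [simp]:
  assumes "x \<in> Ob C" "y \<in> Ob C" "z \<in> Ob C"
  shows "arr (\<alpha> x y z)" "src (\<alpha> x y z) = (x \<otimes>\<^sub>o y) \<otimes>\<^sub>o z" "tgt (\<alpha> x y z) = x \<otimes>\<^sub>o (y \<otimes>\<^sub>o z)"
    "iso_arrow C (\<alpha> x y z)"
  using associator_Hom[OF assms] associator_iso[OF assms] by (simp_all add: hom_iff)

lemma lunit_arr [simp]:
  assumes "x \<in> Ob C"
  shows "arr (\<l> x)" "src (\<l> x) = \<I> \<otimes>\<^sub>o x" "tgt (\<l> x) = x" "iso_arrow C (\<l> x)"
  using lunitor_Hom[OF assms] lunitor_iso[OF assms] by (simp_all add: hom_iff)

lemma runit_arr [simp]:
  assumes "x \<in> Ob C"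
  shows "arr (\<r> x)" "src (\<r> x) = x \<otimes>\<^sub>o \<I>" "tgt (\<r> x) = x" "iso_arrow C (\<r> x)"
  using runitor_Hom[OF assms] runitor_iso[OF assms] by (simp_all add: hom_iff)

lemma sym_arr [simp]:
  assumes "x \<in> Ob C" "y \<in> Ob C"
  shows "arr (\<sigma> x y)" "src (\<sigma> x y) = x \<otimes>\<^sub>o y" "tgt (\<sigma> x y) = y \<otimes>\<^sub>o x"
  using symmetry_Hom[OF assms] by (simp_all add: hom_iff)

lemma sym_sq [simp]: "\<lbrakk>x \<in> Ob C; y \<in> Ob C\<rbrakk> \<Longrightarrow> \<sigma> y x \<cdot> \<sigma> x y = \<i>\<d> (x \<otimes>\<^sub>o y)"
  by (rule symmetry_sq)

lemma sym_iso [simp]: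
  assumes "x \<in> Ob C" "y \<in> Ob C"
  shows "iso_arrow C (\<sigma> x y)" "\<i>\<n>\<v> (\<sigma> x y) = \<sigma> y x"
  using isoI[of "\<sigma> x y" "\<sigma> y x"] assms by simp_all

lemma sym_nat: "\<lbrakk>arr f; arr g\<rbrakk> \<Longrightarrow> \<sigma> (tgt f) (tgt g) \<cdot> (f \<otimes>\<^sub>a g) = (g \<otimes>\<^sub>a f) \<cdot> \<sigma> (src f) (src g)"
  using symmetry_nat by (simp add: hom_iff)

lemma assoc_nat:
  "\<lbrakk>arr f; arr g; arr h\<rbrakk> \<Longrightarrow> \<alpha> (tgt f) (tgt g) (tgt h) \<cdot> ((f \<otimes>\<^sub>a g) \<otimes>\<^sub>a h)
     = (f \<otimes>\<^sub>a (g \<otimes>\<^sub>a h)) \<cdot> \<alpha> (src f) (src g) (src h)"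
  using associator_nat by (simp add: hom_iff)

lemma assoc_inv_nat:
  assumes "arr f" "arr g" "arr h"
  shows "\<i>\<n>\<v> (\<alpha> (tgt f) (tgt g) (tgt h)) \<cdot> (f \<otimes>\<^sub>a (g \<otimes>\<^sub>a h))
     = ((f \<otimes>\<^sub>a g) \<otimes>\<^sub>a h) \<cdot> \<i>\<n>\<v> (\<alpha> (src f) (src g) (src h))"
proof (rule iso_cancel_right[where i = "\<alpha> (src f) (src g) (src h)"])
  show "(\<i>\<n>\<v> (\<alpha> (tgt f) (tgt g) (tgt h)) \<cdot> (f \<otimes>\<^sub>a (g \<otimes>\<^sub>a h))) \<cdot> \<alpha> (src f) (src g) (src h)
    = (((f \<otimes>\<^sub>a g) \<otimes>\<^sub>a h) \<cdot> \<i>\<n>\<v> (\<alpha> (src f) (src g) (src h))) \<cdot> \<alpha> (src f) (src g) (src h)"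
    using assms by (simp add: compA flip: assoc_nat)
qed (use assms in simp_all)

section \<open>Kelly's consequences of pentagon, triangle and hexagon for the unit\<close>

lemma tens_unit_right_cancel:
  assumes "f \<triangleleft> \<I> = g \<triangleleft> \<I>" "arr f" "arr g" "src f = src g" "tgt f = tgt g"
  shows "f = g"
proof -
  have "f \<cdot> \<r> (src f) = \<r> (tgt f) \<cdot> (f \<triangleleft> \<I>)" "g \<cdot> \<r> (src g) = \<r> (tgt g) \<cdot> (g \<triangleleft> \<I>)"
    using assms runitor_nat[of f "src f" "tgt f"] runitor_nat[of g "src g" "tgt g"]
    by (simp_all add: hom_iff)
  then have "f \<cdot> \<r> (src f) = g \<cdot> \<r> (src f)"
    using assms by simp
  then show ?thesis
    by (rule iso_cancel_right) (use assms in simp_all)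
qed

lemma tens_unit_left_cancel:
  assumes "\<I> \<triangleright> f = \<I> \<triangleright> g" "arr f" "arr g" "src f = src g" "tgt f = tgt g"
  shows "f = g"
proof -
  have "f \<cdot> \<l> (src f) = \<l> (tgt f) \<cdot> (\<I> \<triangleright> f)" "g \<cdot> \<l> (src g) = \<l> (tgt g) \<cdot> (\<I> \<triangleright> g)"
    using assms lunitor_nat[of f "src f" "tgt f"] lunitor_nat[of g "src g" "tgt g"]
    by (simp_all add: hom_iff)
  then have "f \<cdot> \<l> (src f) = g \<cdot> \<l> (src f)"
    using assms by simp
  then show ?thesis
    by (rule iso_cancel_right) (use assms in simp_all)
qed

text \<open>Tensoring with the unit is faithful, so it suffices to compare both sides after
  tensoring with \<open>\<I>\<close> on the left. There the pentagon for \<I>, \<I>, x, y and two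
  triangles apply; \<open>?e\<close> is the invertible part of the pentagon to be cancelled.\<close>

lemma lunit_tens:
  assumes [simp]: "x \<in> Ob C" "y \<in> Ob C"
  shows "\<l> (x \<otimes>\<^sub>o y) \<cdot> \<alpha> \<I> x y = \<l> x \<triangleleft> y"
proof (rule tens_unit_left_cancel)
  let ?e = "\<alpha> \<I> (\<I> \<otimes>\<^sub>o x) y \<cdot> (\<alpha> \<I> \<I> x \<triangleleft> y)"
  have "(\<I> \<triangleright> (\<l> (x \<otimes>\<^sub>o y) \<cdot> \<alpha> \<I> x y)) \<cdot> ?e
      = (\<I> \<triangleright> \<l> (x \<otimes>\<^sub>o y)) \<cdot> ((\<I> \<triangleright> \<alpha> \<I> x y) \<cdot> ?e)"
    by (simp add: interchange')
  also have "\<dots> = (\<I> \<triangleright> \<l> (x \<otimes>\<^sub>o y)) \<cdot> \<alpha> \<I> \<I> (x \<otimes>\<^sub>o y) \<cdot> \<alpha> (\<I> \<otimes>\<^sub>o \<I>) x y"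
    using pentagon[of \<I> \<I> x y] by simp
  also have "\<dots> = ((\<I> \<triangleright> \<l> (x \<otimes>\<^sub>o y)) \<cdot> \<alpha> \<I> \<I> (x \<otimes>\<^sub>o y)) \<cdot> \<alpha> (\<I> \<otimes>\<^sub>o \<I>) x y"
    by (simp add: compA)
  also have "\<dots> = (\<r> \<I> \<otimes>\<^sub>a (\<i>\<d> x \<triangleleft> y)) \<cdot> \<alpha> (\<I> \<otimes>\<^sub>o \<I>) x y"
    using triangle[of \<I> "x \<otimes>\<^sub>o y"] by simp
  also have "\<dots> = \<alpha> \<I> x y \<cdot> ((\<r> \<I> \<triangleleft> x) \<triangleleft> y)"
    using assoc_nat[of "\<r> \<I>" "\<i>\<d> x" "\<i>\<d> y"] by simp
  also have "\<dots> = \<alpha> \<I> x y \<cdot> (((\<I> \<triangleright> \<l> x) \<triangleleft> y) \<cdot> (\<alpha> \<I> \<I> x \<triangleleft> y))"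
    using triangle[of \<I> x] by (simp add: interchange)
  also have "\<dots> = (\<alpha> \<I> x y \<cdot> ((\<I> \<triangleright> \<l> x) \<triangleleft> y)) \<cdot> (\<alpha> \<I> \<I> x \<triangleleft> y)"
    by (simp add: compA)
  also have "\<dots> = (\<I> \<triangleright> (\<l> x \<triangleleft> y)) \<cdot> ?e"
    using assoc_nat[of "\<i>\<d> \<I>" "\<l> x" "\<i>\<d> y"] by (simp add: compA)
  finally show "\<I> \<triangleright> (\<l> (x \<otimes>\<^sub>o y) \<cdot> \<alpha> \<I> x y) = \<I> \<triangleright> (\<l> x \<triangleleft> y)"
    by (rule iso_cancel_right) simp_all
qed simp_all

lemma runit_tens:
  assumes [simp]: "x \<in> Ob C" "y \<in> Ob C"
  shows "\<r> (x \<otimes>\<^sub>o y) = (x \<triangleright> \<r> y) \<cdot> \<alpha> x y \<I>"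
proof (rule tens_unit_right_cancel)
  have "\<alpha> x y \<I> \<cdot> (\<r> (x \<otimes>\<^sub>o y) \<triangleleft> \<I>)
      = \<alpha> x y \<I> \<cdot> ((\<i>\<d> x \<triangleleft> y) \<otimes>\<^sub>a \<l> \<I>) \<cdot> \<alpha> (x \<otimes>\<^sub>o y) \<I> \<I>"
    using triangle[of "x \<otimes>\<^sub>o y" \<I>] by simp
  also have "\<dots> = (\<alpha> x y \<I> \<cdot> ((\<i>\<d> x \<triangleleft> y) \<otimes>\<^sub>a \<l> \<I>)) \<cdot> \<alpha> (x \<otimes>\<^sub>o y) \<I> \<I>"
    by (simp add: compA)
  also have "\<dots> = ((x \<triangleright> (y \<triangleright> \<l> \<I>)) \<cdot> \<alpha> x y (\<I> \<otimes>\<^sub>o \<I>)) \<cdot> \<alpha> (x \<otimes>\<^sub>o y) \<I> \<I>"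
    using assoc_nat[of "\<i>\<d> x" "\<i>\<d> y" "\<l> \<I>"] by simp
  also have "\<dots> = (x \<triangleright> (y \<triangleright> \<l> \<I>)) \<cdot> (x \<triangleright> \<alpha> y \<I> \<I>) \<cdot> \<alpha> x (y \<otimes>\<^sub>o \<I>) \<I> \<cdot> (\<alpha> x y \<I> \<triangleleft> \<I>)"
    using pentagon[of x y \<I> \<I>] by (simp add: compA)
  also have "\<dots> = (x \<triangleright> (\<r> y \<triangleleft> \<I>)) \<cdot> \<alpha> x (y \<otimes>\<^sub>o \<I>) \<I> \<cdot> (\<alpha> x y \<I> \<triangleleft> \<I>)"
    using triangle[of y \<I>] by (simp add: interchange')
  also have "\<dots> = ((x \<triangleright> (\<r> y \<triangleleft> \<I>)) \<cdot> \<alpha> x (y \<otimes>\<^sub>o \<I>) \<I>) \<cdot> (\<alpha> x y \<I> \<triangleleft> \<I>)"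
    by (simp add: compA)
  also have "\<dots> = \<alpha> x y \<I> \<cdot> (((x \<triangleright> \<r> y) \<cdot> \<alpha> x y \<I>) \<triangleleft> \<I>)"
    using assoc_nat[of "\<i>\<d> x" "\<r> y" "\<i>\<d> \<I>", symmetric] by (simp add: compA interchange)
  finally show "\<r> (x \<otimes>\<^sub>o y) \<triangleleft> \<I> = ((x \<triangleright> \<r> y) \<cdot> \<alpha> x y \<I>) \<triangleleft> \<I>"
    by (rule iso_cancel_left) simp_all
qed simp_all

lemma lunit_unit: "\<l> \<I> = \<r> \<I>"
proof (rule tens_unit_right_cancel)
  have "\<l> \<I> \<cdot> (\<I> \<triangleright> \<l> \<I>) = \<l> \<I> \<cdot> \<l> (\<I> \<otimes>\<^sub>o \<I>)"
    using lunitor_nat[of "\<l> \<I>" "\<I> \<otimes>\<^sub>o \<I>" \<I>] by (simp add: hom_iff)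
  then have "\<I> \<triangleright> \<l> \<I> = \<l> (\<I> \<otimes>\<^sub>o \<I>)"
    by (rule iso_cancel_left) simp_all
  then show "\<l> \<I> \<triangleleft> \<I> = \<r> \<I> \<triangleleft> \<I>"
    using lunit_tens[of \<I> \<I>] triangle[of \<I> \<I>] by simp
qed simp_all

text \<open>The hexagon for x, \<I>, \<I> is followed by the two left unitors. Each side acquires
  the invertible left factor \<open>\<l> x \<cdot> \<sigma> x \<I>\<close>, and cancelling it leaves
  the claim tensored with the unit.\<close>

lemma lunit_sym:
  assumes [simp]: "x \<in> Ob C"
  shows "\<l> x \<cdot> \<sigma> x \<I> = \<r> x"
proof (rule tens_unit_right_cancel[symmetric])
  have 1: "\<l> x \<cdot> (\<I> \<triangleright> \<l> x) \<cdot> (\<alpha> \<I> \<I> x \<cdot> \<sigma> x (\<I> \<otimes>\<^sub>o \<I>) \<cdot> \<alpha> x \<I> \<I>)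
        = (\<l> x \<cdot> \<sigma> x \<I>) \<cdot> (\<r> x \<triangleleft> \<I>)"
  proof -
    have "(\<I> \<triangleright> \<l> x) \<cdot> (\<alpha> \<I> \<I> x \<cdot> \<sigma> x (\<I> \<otimes>\<^sub>o \<I>) \<cdot> \<alpha> x \<I> \<I>)
      = ((\<I> \<triangleright> \<l> x) \<cdot> \<alpha> \<I> \<I> x) \<cdot> \<sigma> x (\<I> \<otimes>\<^sub>o \<I>) \<cdot> \<alpha> x \<I> \<I>"
      by (simp add: compA)
    also have "\<dots> = (\<l> \<I> \<triangleleft> x) \<cdot> \<sigma> x (\<I> \<otimes>\<^sub>o \<I>) \<cdot> \<alpha> x \<I> \<I>"
      using triangle[of \<I> x] by (simp add: lunit_unit)
    also have "\<dots> = ((\<l> \<I> \<triangleleft> x) \<cdot> \<sigma> x (\<I> \<otimes>\<^sub>o \<I>)) \<cdot> \<alpha> x \<I> \<I>"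
      by (simp add: compA)
    also have "\<dots> = \<sigma> x \<I> \<cdot> (x \<triangleright> \<l> \<I>) \<cdot> \<alpha> x \<I> \<I>"
      using sym_nat[of "\<i>\<d> x" "\<l> \<I>", symmetric] by (simp add: compA)
    also have "\<dots> = \<sigma> x \<I> \<cdot> (\<r> x \<triangleleft> \<I>)"
      using triangle[of x \<I>] by simp
    finally show ?thesis
      by (simp add: compA)
  qed
  have "\<l> x \<cdot> (\<I> \<triangleright> \<l> x) \<cdot> (\<I> \<triangleright> \<sigma> x \<I>) = \<l> x \<cdot> (\<I> \<triangleright> (\<l> x \<cdot> \<sigma> x \<I>))"
    by (simp add: interchange)
  also have "\<dots> = (\<l> x \<cdot> \<sigma> x \<I>) \<cdot> \<l> (x \<otimes>\<^sub>o \<I>)"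
    using lunitor_nat[of "\<l> x \<cdot> \<sigma> x \<I>" "x \<otimes>\<^sub>o \<I>" x] by (simp add: hom_iff)
  finally have 3: "\<l> x \<cdot> (\<I> \<triangleright> \<l> x) \<cdot> (\<I> \<triangleright> \<sigma> x \<I>) = (\<l> x \<cdot> \<sigma> x \<I>) \<cdot> \<l> (x \<otimes>\<^sub>o \<I>)" .
  have "\<l> x \<cdot> (\<I> \<triangleright> \<l> x) \<cdot> ((\<I> \<triangleright> \<sigma> x \<I>) \<cdot> \<alpha> \<I> x \<I> \<cdot> (\<sigma> x \<I> \<triangleleft> \<I>))
      = (\<l> x \<cdot> (\<I> \<triangleright> \<l> x) \<cdot> (\<I> \<triangleright> \<sigma> x \<I>)) \<cdot> \<alpha> \<I> x \<I> \<cdot> (\<sigma> x \<I> \<triangleleft> \<I>)"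
    by (simp add: compA)
  also have "\<dots> = (\<l> x \<cdot> \<sigma> x \<I>) \<cdot> (\<l> (x \<otimes>\<^sub>o \<I>) \<cdot> \<alpha> \<I> x \<I>) \<cdot> (\<sigma> x \<I> \<triangleleft> \<I>)"
    unfolding 3 by (simp add: compA)
  also have "\<dots> = (\<l> x \<cdot> \<sigma> x \<I>) \<cdot> ((\<l> x \<cdot> \<sigma> x \<I>) \<triangleleft> \<I>)"
    by (simp add: lunit_tens interchange)
  finally have 2: "\<l> x \<cdot> (\<I> \<triangleright> \<l> x) \<cdot> ((\<I> \<triangleright> \<sigma> x \<I>) \<cdot> \<alpha> \<I> x \<I> \<cdot> (\<sigma> x \<I> \<triangleleft> \<I>))
      = (\<l> x \<cdot> \<sigma> x \<I>) \<cdot> ((\<l> x \<cdot> \<sigma> x \<I>) \<triangleleft> \<I>)" .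
  have "(\<l> x \<cdot> \<sigma> x \<I>) \<cdot> (\<r> x \<triangleleft> \<I>) = (\<l> x \<cdot> \<sigma> x \<I>) \<cdot> ((\<l> x \<cdot> \<sigma> x \<I>) \<triangleleft> \<I>)"
    using 1 2 hexagon[of x \<I> \<I>] by simp
  then show "\<r> x \<triangleleft> \<I> = (\<l> x \<cdot> \<sigma> x \<I>) \<triangleleft> \<I>"
    by (rule iso_cancel_left) simp_all
qed simp_all

lemma runit_sym:
  assumes [simp]: "x \<in> Ob C"
  shows "\<r> x \<cdot> \<sigma> \<I> x = \<l> x"
  using lunit_sym[OF assms, symmetric] by (simp add: compA)

lemma hexagon_inv:
  assumes [simp]: "x \<in> Ob C" "y \<in> Ob C" "z \<in> Ob C"
  shows "\<i>\<n>\<v> (\<alpha> z x y) \<cdot> \<sigma> (x \<otimes>\<^sub>o y) z \<cdot> \<i>\<n>\<v> (\<alpha> x y z)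
       = (\<sigma> x z \<triangleleft> y) \<cdot> \<i>\<n>\<v> (\<alpha> x z y) \<cdot> (x \<triangleright> \<sigma> y z)"
  using arg_cong[OF hexagon[of z x y], of "\<lambda>f. \<i>\<n>\<v> f"] by (simp add: compA)

end

section \<open>Formal tensors of labelled variables\<close>

text \<open>The head of a list will be the last tensor factor. In lists merged from single variables
  it carries the greatest label, so the order of the factors depends on the labels alone and not on
  how a term was put together.\<close>

fun merge :: "(nat \<times> 'o) list \<Rightarrow> (nat \<times> 'o) list \<Rightarrow> (nat \<times> 'o) list" where
  "merge u [] = u"
| "merge [] (n # v) = n # v"
| "merge (m # u) (n # v) =
     (if fst n < fst m then m # merge u (n # v) else n # merge (m # u) v)"

definition labels :: "(nat \<times> 'o) list \<Rightarrow> nat set" where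
  "labels u = fst ` set u"

lemma labels_simps [simp]: "labels [] = {}" "labels (m # u) = insert (fst m) (labels u)"
  by (simp_all add: labels_def)

lemma merge_Nil [simp]: "merge [] v = v"
  by (cases v) simp_all

lemma set_merge [simp]: "set (merge u v) = set u \<union> set v"
  by (induction u v rule: merge.induct) auto

lemma labels_merge [simp]: "labels (merge u v) = labels u \<union> labels v"
  by (simp add: labels_def image_Un)

lemma merge_comm: "labels u \<inter> labels v = {} \<Longrightarrow> merge u v = merge v u"
  by (induction u v rule: merge.induct) auto

lemma merge_Cons_right:
  assumes "\<And>m u'. u = m # u' \<Longrightarrow> fst m < fst n"
  shows "merge u (n # v) = n # merge u v"
  using assms by (cases u) (auto dest: order.strict_trans)

text \<open>The greatest of the three head labels comes first on either side; removing it leaves a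
  smaller instance.\<close>

lemma merge_assoc:
  "labels u \<inter> labels v = {} \<Longrightarrow> labels u \<inter> labels w = {} \<Longrightarrow> labels v \<inter> labels w = {}
    \<Longrightarrow> merge (merge u v) w = merge u (merge v w)"
proof (induction "length u + length v + length w" arbitrary: u v w rule: less_induct)
  case less
  show ?case
  proof (cases "u = [] \<or> v = [] \<or> w = []")
    case False
    then obtain m u' n v' l w' where [simp]: "u = m # u'" "v = n # v'" "w = l # w'"
      by (metis neq_Nil_conv)
    show ?thesis
      using less.hyps[of u' v w] less.hyps[of u v' w] less.hyps[of u v w'] less.prems
      by (auto simp: not_less)
  qed auto
qed

section \<open>Canonical shuffles and their coherence\<close>

context sm_category
begin

primrec vtens :: "(nat \<times> 'o) list \<Rightarrow> 'o" where
  "vtens [] = \<I>"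
| "vtens (m # u) = vtens u \<otimes>\<^sub>o snd m"

definition vars_ok :: "(nat \<times> 'o) list \<Rightarrow> bool" where
  "vars_ok u \<longleftrightarrow> snd ` set u \<subseteq> Ob C"

lemma vars_ok_simps [simp]:
  "vars_ok []" "vars_ok (m # u) \<longleftrightarrow> snd m \<in> Ob C \<and> vars_ok u" "vars_ok (merge u v) \<longleftrightarrow> vars_ok u \<and> vars_ok v"
  by (auto simp: vars_ok_def)

lemma vtens_Ob [simp]: "vars_ok u \<Longrightarrow> vtens u \<in> Ob C"
  by (induction u) simp_all

text \<open>The canonical arrow \<open>vtens u \<otimes> vtens v \<rightarrow> vtens (merge u v)\<close>. The variable with the greatest label is
  peeled off the second argument, after exchanging the arguments if necessary, so that
  commutativity is built into the definition.\<close>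

function shuf where
  "shuf u [] = \<r> (vtens u)"
| "shuf [] (n # v) = \<r> (vtens (n # v)) \<cdot> \<sigma> \<I> (vtens (n # v))"
| "shuf (m # u) (n # v) =
     (if fst n < fst m
      then (shuf (n # v) u \<triangleleft> (snd m)) \<cdot> \<i>\<n>\<v> (\<alpha> (vtens (n # v)) (vtens u) (snd m))
             \<cdot> \<sigma> (vtens (m # u)) (vtens (n # v))
      else (shuf (m # u) v \<triangleleft> (snd n)) \<cdot> \<i>\<n>\<v> (\<alpha> (vtens (m # u)) (vtens v) (snd n)))"
  by pat_completeness auto
termination by (relation "measure (\<lambda>(u, v). length u + length v)") auto

declare shuf.simps(3) [simp del]

lemma shuf_Nil: "vars_ok v \<Longrightarrow> shuf [] v = \<l> (vtens v)"
  by (cases v) (simp_all add: lunit_unit runit_sym)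

lemma shuf_iso:
  "vars_ok u \<Longrightarrow> vars_ok v \<Longrightarrow> labels u \<inter> labels v = {}
    \<Longrightarrow> iso_arrow C (shuf u v) \<and> src (shuf u v) = vtens u \<otimes>\<^sub>o vtens v \<and> tgt (shuf u v) = vtens (merge u v)"
proof (induction u v rule: shuf.induct)
  case (3 m u n v)
  show ?case
  proof (cases "fst n < fst m")
    case True
    have "labels (n # v) \<inter> labels u = {}"
      using 3 by auto
    with 3 True show ?thesis
      using merge_comm[of u "n # v"] by (auto simp: shuf.simps(3) iso_arr)
  next
    case False
    with 3 show ?thesis
      by (auto simp: shuf.simps(3) iso_arr)
  qed
qed simp_all

lemma shuf_arr [simp]:
  assumes "vars_ok u" "vars_ok v" "labels u \<inter> labels v = {}"
  shows "iso_arrow C (shuf u v)" "arr (shuf u v)" "src (shuf u v) = vtens u \<otimes>\<^sub>o vtens v"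
    "tgt (shuf u v) = vtens (merge u v)"
  using shuf_iso[OF assms] by (simp_all add: iso_arr)

text \<open>Disjoint labels make the comparison of heads strict. So of the two shuffles one is
  defined by peeling and the other as its composite with the symmetry, and the symmetry squares to
  the identity.\<close>

lemma shuf_comm:
  assumes [simp]: "vars_ok u" "vars_ok v" and d: "labels u \<inter> labels v = {}"
  shows "shuf v u \<cdot> \<sigma> (vtens u) (vtens v) = shuf u v"
proof -
  have d': "labels v \<inter> labels u = {}"
    using d by auto
  show ?thesis
  proof (cases u)
    case Nil
    then show ?thesis
      by (cases v) (simp_all add: shuf_Nil runit_sym lunit_unit)
  next
    case u: (Cons m u')
    show ?thesis
    proof (cases v)
      case Nil
      then show ?thesis
        by (simp add: shuf_Nil lunit_sym)
    next
      case v: (Cons n v')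
      have *: "labels u' \<inter> labels v = {}" "labels v' \<inter> labels u = {}" "labels v \<inter> labels u' = {}" "labels u \<inter> labels v' = {}"
        using d u v by auto
      have k: "snd m \<in> Ob C" "vars_ok u'" "snd n \<in> Ob C" "vars_ok v'"
        using assms u v by auto
      consider "fst n < fst m" | "fst m < fst n"
        using d u v by fastforce
      then show ?thesis
      proof cases
        case 1
        then have "shuf u v = shuf v u \<cdot> \<sigma> (vtens u) (vtens v)"
          using * k unfolding u v by (subst (1 2) shuf.simps) (simp add: compA)
        then show ?thesis by simp
      next
        case 2
        then have "shuf v u = shuf u v \<cdot> \<sigma> (vtens v) (vtens u)"
          using * k unfolding u v by (subst (1 2) shuf.simps) (simp add: compA)
        then show ?thesis
          using d by (simp add: compA)
      qed
    qed
  qed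
qed

lemma shuf_Cons:
  assumes "\<And>m u'. u = m # u' \<Longrightarrow> fst m < fst n" "vars_ok u" "vars_ok v" "snd n \<in> Ob C"
    "labels u \<inter> labels (n # v) = {}"
  shows "shuf u (n # v) = (shuf u v \<triangleleft> (snd n)) \<cdot> \<i>\<n>\<v> (\<alpha> (vtens u) (vtens v) (snd n))"
proof (cases u)
  case Nil
  have "shuf [] (n # v) = \<l> (vtens v \<otimes>\<^sub>o snd n)"
    using shuf_Nil[of "n # v"] assms by simp
  also have "\<dots> = (\<l> (vtens v \<otimes>\<^sub>o snd n) \<cdot> \<alpha> \<I> (vtens v) (snd n)) \<cdot> \<i>\<n>\<v> (\<alpha> \<I> (vtens v) (snd n))"
    using assms by (simp add: compA)
  finally show ?thesis
    using assms Nil by (simp add: lunit_tens shuf_Nil)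
next
  case (Cons m u')
  then show ?thesis
    using assms(1)[OF Cons] by (simp add: shuf.simps(3))
qed

definition shuf_assoc where
  "shuf_assoc u v w \<longleftrightarrow> shuf (merge u v) w \<cdot> (shuf u v \<triangleleft> (vtens w))
      = shuf u (merge v w) \<cdot> ((vtens u) \<triangleright> shuf v w) \<cdot> \<alpha> (vtens u) (vtens v) (vtens w)"

text \<open>The variable \<open>l\<close> is peeled off every shuffle in which it occurs. What
  remains is the instance for \<open>w\<close>, tensored with \<open>snd l\<close>, together with
  naturality of the associator and one pentagon.\<close>

lemma shuf_assoc_last:
  assumes a: "shuf_assoc u v w"
    and [simp]: "vars_ok u" "vars_ok v" "vars_ok w" "snd l \<in> Ob C"
    and d: "labels u \<inter> labels v = {}" "labels u \<inter> labels (l # w) = {}" "labels v \<inter> labels (l # w) = {}"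
    and u: "\<And>m u'. u = m # u' \<Longrightarrow> fst m < fst l"
    and v: "\<And>n v'. v = n # v' \<Longrightarrow> fst n < fst l"
  shows "shuf_assoc u v (l # w)"
proof -
  have d': "labels u \<inter> labels w = {}" "labels v \<inter> labels w = {}" "(labels u \<union> labels v) \<inter> labels w = {}"
    "labels u \<inter> (labels v \<union> labels w) = {}"
    "(labels u \<union> labels v) \<inter> labels (l # w) = {}" "labels u \<inter> labels (l # merge v w) = {}"
    "fst l \<notin> labels u" "fst l \<notin> labels v"
    using d by auto
  note [simp] = d d'
  have uv: "fst m < fst l" if "merge u v = m # r" for m r
    using that u v by (cases u; cases v) (auto split: if_splits)
  let ?x = "vtens u" and ?y = "vtens v" and ?z = "vtens w" and ?l = "snd l"
  let ?A = "(shuf (merge u v) w \<triangleleft> ?l)"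
  have "shuf (merge u v) (l # w) \<cdot> (shuf u v \<triangleleft> (?z \<otimes>\<^sub>o ?l))
      = ?A \<cdot> \<i>\<n>\<v> (\<alpha> (vtens (merge u v)) ?z ?l) \<cdot> (shuf u v \<otimes>\<^sub>a (\<i>\<d> ?z \<triangleleft> ?l))"
    by (subst shuf_Cons[OF uv]) (simp_all add: compA)
  also have "\<dots> = ?A \<cdot> ((shuf u v \<triangleleft> ?z) \<triangleleft> ?l) \<cdot> \<i>\<n>\<v> (\<alpha> (?x \<otimes>\<^sub>o ?y) ?z ?l)"
    using assoc_inv_nat[of "shuf u v" "\<i>\<d> ?z" "\<i>\<d> ?l"] by (simp del: tens_id)
  also have "\<dots> = ((shuf (merge u v) w \<cdot> (shuf u v \<triangleleft> ?z)) \<triangleleft> ?l) \<cdot> \<i>\<n>\<v> (\<alpha> (?x \<otimes>\<^sub>o ?y) ?z ?l)"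
    by (simp add: interchange')
  also have "\<dots> = ((shuf u (merge v w) \<cdot> (?x \<triangleright> shuf v w) \<cdot> \<alpha> ?x ?y ?z) \<triangleleft> ?l) \<cdot> \<i>\<n>\<v> (\<alpha> (?x \<otimes>\<^sub>o ?y) ?z ?l)"
    using a by (simp add: shuf_assoc_def)
  also have "\<dots> = (shuf u (merge v w) \<triangleleft> ?l) \<cdot> ((?x \<triangleright> shuf v w) \<triangleleft> ?l) \<cdot>
      (\<alpha> ?x ?y ?z \<triangleleft> ?l) \<cdot> \<i>\<n>\<v> (\<alpha> (?x \<otimes>\<^sub>o ?y) ?z ?l)"
    by (simp add: interchange' interchange compA)
  also have "(\<alpha> ?x ?y ?z \<triangleleft> ?l) \<cdot> \<i>\<n>\<v> (\<alpha> (?x \<otimes>\<^sub>o ?y) ?z ?l) =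
      \<i>\<n>\<v> (\<alpha> ?x (?y \<otimes>\<^sub>o ?z) ?l) \<cdot> (?x \<triangleright> \<i>\<n>\<v> (\<alpha> ?y ?z ?l)) \<cdot> \<alpha> ?x ?y (?z \<otimes>\<^sub>o ?l)"
  proof (rule iso_cancel_right[where i = "\<alpha> (?x \<otimes>\<^sub>o ?y) ?z ?l"])
    have "(\<i>\<n>\<v> (\<alpha> ?x (?y \<otimes>\<^sub>o ?z) ?l) \<cdot> (?x \<triangleright> \<i>\<n>\<v> (\<alpha> ?y ?z ?l)) \<cdot> \<alpha> ?x ?y (?z \<otimes>\<^sub>o ?l)) \<cdot> \<alpha> (?x \<otimes>\<^sub>o ?y) ?z ?l
      = \<i>\<n>\<v> (\<alpha> ?x (?y \<otimes>\<^sub>o ?z) ?l) \<cdot> (?x \<triangleright> \<i>\<n>\<v> (\<alpha> ?y ?z ?l)) \<cdot> (\<alpha> ?x ?y (?z \<otimes>\<^sub>o ?l) \<cdot> \<alpha> (?x \<otimes>\<^sub>o ?y) ?z ?l)"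
      by (simp add: compA)
    also have "\<dots> = \<alpha> ?x ?y ?z \<triangleleft> ?l"
      by (subst pentagon[symmetric]) (simp_all add: interchange')
    finally show "((\<alpha> ?x ?y ?z \<triangleleft> ?l) \<cdot> \<i>\<n>\<v> (\<alpha> (?x \<otimes>\<^sub>o ?y) ?z ?l)) \<cdot> \<alpha> (?x \<otimes>\<^sub>o ?y) ?z ?l
       = (\<i>\<n>\<v> (\<alpha> ?x (?y \<otimes>\<^sub>o ?z) ?l) \<cdot> (?x \<triangleright> \<i>\<n>\<v> (\<alpha> ?y ?z ?l)) \<cdot> \<alpha> ?x ?y (?z \<otimes>\<^sub>o ?l)) \<cdot> \<alpha> (?x \<otimes>\<^sub>o ?y) ?z ?l"
      by (simp add: compA)
  qed simp_all
  also have "(shuf u (merge v w) \<triangleleft> ?l) \<cdot> ((?x \<triangleright> shuf v w) \<triangleleft> ?l) \<cdot>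
      \<i>\<n>\<v> (\<alpha> ?x (?y \<otimes>\<^sub>o ?z) ?l) \<cdot> (?x \<triangleright> \<i>\<n>\<v> (\<alpha> ?y ?z ?l)) \<cdot> \<alpha> ?x ?y (?z \<otimes>\<^sub>o ?l)
    = (shuf u (merge v w) \<triangleleft> ?l) \<cdot> (((?x \<triangleright> shuf v w) \<triangleleft> ?l) \<cdot>
      \<i>\<n>\<v> (\<alpha> ?x (?y \<otimes>\<^sub>o ?z) ?l)) \<cdot> (?x \<triangleright> \<i>\<n>\<v> (\<alpha> ?y ?z ?l)) \<cdot> \<alpha> ?x ?y (?z \<otimes>\<^sub>o ?l)"
    by (simp add: compA)
  also have "((?x \<triangleright> shuf v w) \<triangleleft> ?l) \<cdot> \<i>\<n>\<v> (\<alpha> ?x (?y \<otimes>\<^sub>o ?z) ?l)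
     = \<i>\<n>\<v> (\<alpha> ?x (vtens (merge v w)) ?l) \<cdot> (?x \<triangleright> (shuf v w \<triangleleft> ?l))"
    using assoc_inv_nat[of "\<i>\<d> ?x" "shuf v w" "\<i>\<d> ?l"] by simp
  also have "(shuf u (merge v w) \<triangleleft> ?l) \<cdot> (\<i>\<n>\<v> (\<alpha> ?x (vtens (merge v w)) ?l) \<cdot> (?x \<triangleright> (shuf v w \<triangleleft> ?l)))
      \<cdot> (?x \<triangleright> \<i>\<n>\<v> (\<alpha> ?y ?z ?l)) \<cdot> \<alpha> ?x ?y (?z \<otimes>\<^sub>o ?l)
     = shuf u (l # merge v w) \<cdot> (?x \<triangleright> shuf v (l # w)) \<cdot> \<alpha> ?x ?y (?z \<otimes>\<^sub>o ?l)"
    using shuf_Cons[where u = u and n = l and v = "merge v w", OF u] shuf_Cons[where u = v and n = l and v = w, OF v]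
    by (simp add: compA interchange')
  finally show ?thesis
    unfolding shuf_assoc_def using merge_Cons_right[of v l w, OF v] by simp
qed

text \<open>Lets the greatest label sit in the second list: by commutativity and the hexagon the
  instance follows from two instances in which that list stands last.\<close>

lemma shuf_assoc_mid:
  assumes a: "shuf_assoc w u v" "shuf_assoc u w v"
    and [simp]: "vars_ok u" "vars_ok v" "vars_ok w"
    and d: "labels u \<inter> labels v = {}" "labels u \<inter> labels w = {}" "labels v \<inter> labels w = {}"
  shows "shuf_assoc u v w"
proof -
  have d': "labels w \<inter> labels v = {}" "labels w \<inter> labels u = {}" "labels w \<inter> (labels u \<union> labels v) = {}"
    "(labels u \<union> labels v) \<inter> labels w = {}" "labels u \<inter> (labels w \<union> labels v) = {}" "(labels w \<union> labels u) \<inter> labels v = {}"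
    "(labels u \<union> labels w) \<inter> labels v = {}"
    using d by auto
  note [simp] = d d'
  let ?x = "vtens u" and ?y = "vtens v" and ?z = "vtens w"
  have hex: "\<i>\<n>\<v> (\<alpha> ?z ?x ?y) \<cdot> \<sigma> (?x \<otimes>\<^sub>o ?y) ?z
     = (\<sigma> ?x ?z \<triangleleft> ?y) \<cdot> \<i>\<n>\<v> (\<alpha> ?x ?z ?y) \<cdot> (?x \<triangleright> \<sigma> ?y ?z) \<cdot> \<alpha> ?x ?y ?z"
    using arg_cong[OF hexagon_inv[of ?x ?y ?z], of "\<lambda>f. f \<cdot> \<alpha> ?x ?y ?z"] by (simp add: compA)
  have 1: "shuf w (merge u v) \<cdot> (?z \<triangleright> shuf u v) = shuf (merge w u) v \<cdot> (shuf w u \<triangleleft> ?y) \<cdot> \<i>\<n>\<v> (\<alpha> ?z ?x ?y)"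
    using arg_cong[OF a(1)[unfolded shuf_assoc_def], of "\<lambda>f. f \<cdot> \<i>\<n>\<v> (\<alpha> ?z ?x ?y)"] by (simp add: compA)
  have 2: "shuf u (merge w v) \<cdot> (?x \<triangleright> shuf w v) = shuf (merge u w) v \<cdot> (shuf u w \<triangleleft> ?y) \<cdot> \<i>\<n>\<v> (\<alpha> ?x ?z ?y)"
    using arg_cong[OF a(2)[unfolded shuf_assoc_def], of "\<lambda>f. f \<cdot> \<i>\<n>\<v> (\<alpha> ?x ?z ?y)"] by (simp add: compA)
  have c: "shuf (merge u v) w = shuf w (merge u v) \<cdot> \<sigma> (vtens (merge u v)) ?z" "shuf v w = shuf w v \<cdot> \<sigma> ?y ?z"
    "shuf u w = shuf w u \<cdot> \<sigma> ?x ?z" "merge w u = merge u w" "merge v w = merge w v"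
    by (simp_all add: shuf_comm merge_comm[of w u] merge_comm[of v w])
  have "shuf (merge u v) w \<cdot> (shuf u v \<triangleleft> ?z)
      = shuf w (merge u v) \<cdot> (\<sigma> (vtens (merge u v)) ?z \<cdot> (shuf u v \<triangleleft> ?z))"
    by (simp add: c(1) compA)
  also have "\<dots> = (shuf w (merge u v) \<cdot> (?z \<triangleright> shuf u v)) \<cdot> \<sigma> (?x \<otimes>\<^sub>o ?y) ?z"
    using sym_nat[of "shuf u v" "\<i>\<d> ?z"] by (simp add: compA)
  also have "\<dots> = shuf (merge w u) v \<cdot> (shuf w u \<triangleleft> ?y) \<cdot> (\<i>\<n>\<v> (\<alpha> ?z ?x ?y) \<cdot> \<sigma> (?x \<otimes>\<^sub>o ?y) ?z)"
    unfolding 1 by (simp add: compA)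
  also have "\<dots> = (shuf (merge u w) v \<cdot> (shuf u w \<triangleleft> ?y) \<cdot> \<i>\<n>\<v> (\<alpha> ?x ?z ?y)) \<cdot> (?x \<triangleright> \<sigma> ?y ?z) \<cdot> \<alpha> ?x ?y ?z"
    unfolding hex c(3) c(4) by (simp add: compA interchange' interchange c(4)[symmetric])
  also have "\<dots> = shuf u (merge v w) \<cdot> (?x \<triangleright> shuf v w) \<cdot> \<alpha> ?x ?y ?z"
    unfolding 2[symmetric] c(2,5) by (simp add: compA interchange')
  finally show ?thesis
    unfolding shuf_assoc_def .
qed

lemma shuf_assoc_first:
  assumes a: "shuf_assoc v w u" "shuf_assoc v u w"
    and [simp]: "vars_ok u" "vars_ok v" "vars_ok w"
    and d: "labels u \<inter> labels v = {}" "labels u \<inter> labels w = {}" "labels v \<inter> labels w = {}"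
  shows "shuf_assoc u v w"
proof -
  have d': "labels w \<inter> labels u = {}" "labels v \<inter> labels u = {}" "labels v \<inter> (labels u \<union> labels w) = {}"
    "(labels v \<union> labels w) \<inter> labels u = {}" "labels u \<inter> (labels v \<union> labels w) = {}" "(labels v \<union> labels u) \<inter> labels w = {}"
    "(labels u \<union> labels v) \<inter> labels w = {}" "labels v \<inter> (labels w \<union> labels u) = {}"
    using d by auto
  note [simp] = d d'
  let ?x = "vtens u" and ?y = "vtens v" and ?z = "vtens w"
  have c: "shuf u (merge v w) = shuf (merge v w) u \<cdot> \<sigma> ?x (vtens (merge v w))" "shuf u v = shuf v u \<cdot> \<sigma> ?x ?y"
    "shuf u w = shuf w u \<cdot> \<sigma> ?x ?z" "merge u v = merge v u" "merge u w = merge w u"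
    by (simp_all add: shuf_comm merge_comm[of u v] merge_comm[of u w])
  have "shuf u (merge v w) \<cdot> (?x \<triangleright> shuf v w) \<cdot> \<alpha> ?x ?y ?z
     = shuf (merge v w) u \<cdot> (\<sigma> ?x (vtens (merge v w)) \<cdot> (?x \<triangleright> shuf v w)) \<cdot> \<alpha> ?x ?y ?z"
    unfolding c(1) by (simp add: compA)
  also have "\<dots> = (shuf (merge v w) u \<cdot> (shuf v w \<triangleleft> ?x)) \<cdot> \<sigma> ?x (?y \<otimes>\<^sub>o ?z) \<cdot> \<alpha> ?x ?y ?z"
    using sym_nat[of "\<i>\<d> ?x" "shuf v w"] by (simp add: compA)
  also have "\<dots> = (shuf v (merge w u) \<cdot> (?y \<triangleright> shuf w u)) \<cdot> (\<alpha> ?y ?z ?x \<cdot> \<sigma> ?x (?y \<otimes>\<^sub>o ?z) \<cdot> \<alpha> ?x ?y ?z)"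
    using a(1) by (simp add: compA shuf_assoc_def)
  also have "\<dots> = (shuf v (merge u w) \<cdot> (?y \<triangleright> shuf u w) \<cdot> \<alpha> ?y ?x ?z) \<cdot> (\<sigma> ?x ?y \<triangleleft> ?z)"
    unfolding c(3,5) hexagon[of ?x ?y ?z, simplified] by (simp add: compA hexagon interchange')
  also have "\<dots> = shuf (merge u v) w \<cdot> (shuf u v \<triangleleft> ?z)"
    using arg_cong[OF a(2)[unfolded shuf_assoc_def], of "\<lambda>f. f \<cdot> (\<sigma> ?x ?y \<triangleleft> ?z)"]
    unfolding c(2,4) by (simp add: compA interchange)
  finally show ?thesis
    unfolding shuf_assoc_def by simp
qed

text \<open>This is the coherence theorem in the form needed here. The induction peels off the
  variable with the greatest head label, which is possible directly only in the third list; the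
  other positions are brought there by permuting the arguments.\<close>

lemma shuf_assoc:
  assumes "vars_ok u" "vars_ok v" "vars_ok w" "labels u \<inter> labels v = {}" "labels u \<inter> labels w = {}" "labels v \<inter> labels w = {}"
  shows "shuf_assoc u v w"
  using assms
proof (induction "length u + length v + length w" arbitrary: u v w rule: less_induct)
  case less
  note [simp] = less.prems
  show ?case
  proof (cases "u = [] \<or> v = [] \<or> w = []")
    case True
    then consider "u = []" | "v = []" | "w = []"
      by auto
    then show ?thesis
    proof cases
      case 1
      have "\<l> (vtens (merge v w)) \<cdot> (\<I> \<triangleright> shuf v w) \<cdot> \<alpha> \<I> (vtens v) (vtens w)
          = (\<l> (vtens (merge v w)) \<cdot> (\<I> \<triangleright> shuf v w)) \<cdot> \<alpha> \<I> (vtens v) (vtens w)"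
        by (simp add: compA)
      also have "\<dots> = shuf v w \<cdot> (\<l> (vtens v) \<triangleleft> (vtens w))"
        using lunitor_nat[of "shuf v w" "vtens v \<otimes>\<^sub>o vtens w" "vtens (merge v w)"] lunit_tens[of "vtens v" "vtens w"]
        by (simp add: hom_iff compA)
      finally show ?thesis
        using 1 by (simp add: shuf_assoc_def shuf_Nil)
    next
      case 2
      then show ?thesis
        using triangle[of "vtens u" "vtens w"] by (simp add: shuf_assoc_def shuf_Nil)
    next
      case 3
      have "\<r> (vtens (merge u v)) \<cdot> (shuf u v \<triangleleft> \<I>) = shuf u v \<cdot> \<r> (vtens u \<otimes>\<^sub>o vtens v)"
        using runitor_nat[of "shuf u v" "vtens u \<otimes>\<^sub>o vtens v" "vtens (merge u v)"] by (simp add: hom_iff)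
      then show ?thesis
        using 3 runit_tens[of "vtens u" "vtens v"] by (simp add: shuf_assoc_def)
    qed
  next
    case False
    then obtain m u' n v' l w' where uvw: "u = m # u'" "v = n # v'" "w = l # w'"
      by (metis neq_Nil_conv)
    have last: "shuf_assoc (a # a') (b # b') (c # c')"
      if "length a' + length b' + length c' = length u' + length v' + length w'"
        and "fst a < fst c" "fst b < fst c" "vars_ok (a # a')" "vars_ok (b # b')" "vars_ok (c # c')"
        and "labels (a # a') \<inter> labels (b # b') = {}" "labels (a # a') \<inter> labels (c # c') = {}"
          "labels (b # b') \<inter> labels (c # c') = {}"
      for a a' b b' c c'
    proof (rule shuf_assoc_last)
      show "shuf_assoc (a # a') (b # b') c'"
        by (rule less.hyps) (use that uvw in auto)
    qed (use that in auto)
    note d = less.prems[unfolded uvw]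
    have d': "labels v \<inter> labels u = {}" "labels w \<inter> labels u = {}" "labels w \<inter> labels v = {}"
      using less.prems(4-6) by blast+
    note d'' = d'[unfolded uvw]
    have "fst m \<noteq> fst n" "fst m \<noteq> fst l" "fst n \<noteq> fst l"
      using d by auto
    then consider "fst m < fst l" "fst n < fst l" | "fst m < fst n" "fst l < fst n"
      | "fst n < fst m" "fst l < fst m"
      by linarith
    then show ?thesis
    proof cases
      case 1
      then show ?thesis
        unfolding uvw by (intro last) (use d in auto)
    next
      case 2
      have "shuf_assoc w u v" "shuf_assoc u w v"
        unfolding uvw by (intro last; use d d'' 2 in auto)+
      then show ?thesis
        by (rule shuf_assoc_mid) simp_all
    next
      case 3
      have *: "shuf_assoc w v u" "shuf_assoc v w u"
        unfolding uvw by (intro last; use d d'' 3 in auto)+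
      \<comment> \<open>Two permutations are needed when \<open>u\<close> has the greatest head:
        this instance has \<open>u\<close> in the middle, and only with it can \<open>u\<close> be
        moved to the front.\<close>
      then have "shuf_assoc v u w"
        by (rule shuf_assoc_mid) (use d' in simp_all)
      with *(2) show ?thesis
        by (rule shuf_assoc_first) simp_all
    qed
  qed
qed

text \<open>A term is a list of labelled variables \<open>(i, x)\<close> together with an arrow out of their tensor
  product. Terms with disjoint labels are multiplied by merging the lists.\<close>

definition is_term :: "(nat \<times> 'o) list \<times> 'm \<Rightarrow> bool" where
  "is_term t \<longleftrightarrow> vars_ok (fst t) \<and> arr (snd t) \<and> src (snd t) = vtens (fst t)"

definition ty :: "(nat \<times> 'o) list \<times> 'm \<Rightarrow> 'o" where
  "ty t = tgt (snd t)"

definition fv :: "(nat \<times> 'o) list \<times> 'm \<Rightarrow> nat set" where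
  "fv t = labels (fst t)"

definition generic :: "(nat \<times> 'o) list \<times> 'm \<Rightarrow> bool" where
  "generic t \<longleftrightarrow> is_term t \<and> iso_arrow C (snd t)"

definition app :: "'m \<Rightarrow> (nat \<times> 'o) list \<times> 'm \<Rightarrow> (nat \<times> 'o) list \<times> 'm" where
  "app f t = (fst t, f \<cdot> snd t)"

text \<open>The inverse shuffle distributes the merged variables over the two factors. Both sides of
  a structural equation thus have literally the same list of variables, and comparing them is
  comparing terms.\<close>

definition pair :: "(nat \<times> 'o) list \<times> 'm \<Rightarrow> (nat \<times> 'o) list \<times> 'm \<Rightarrow> (nat \<times> 'o) list \<times> 'm" (infixr "\<boxtimes>" 60) where
  "t \<boxtimes> s = (merge (fst t) (fst s), (snd t \<otimes>\<^sub>a snd s) \<cdot> \<i>\<n>\<v> (shuf (fst t) (fst s)))"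

definition star :: "(nat \<times> 'o) list \<times> 'm" where
  "star = ([], \<i>\<d> \<I>)"

text \<open>The unitor appears because \<open>vtens\<close> of a one-element list is
  \<open>\<I> \<otimes>\<^sub>o x\<close> rather than \<open>x\<close>.\<close>

definition var :: "nat \<Rightarrow> 'o \<Rightarrow> (nat \<times> 'o) list \<times> 'm" where
  "var i x = ([(i, x)], \<l> x)"

section \<open>Typing and evaluation of terms\<close>

lemma is_term_app [simp]:
  assumes "is_term t" "arr f" "src f = ty t"
  shows "is_term (app f t)"
  using assms by (simp add: is_term_def app_def ty_def)

lemma ty_app [simp]:
  assumes "is_term t" "arr f" "src f = ty t"
  shows "ty (app f t) = tgt f"
  using assms by (simp add: is_term_def app_def ty_def)

lemma fv_app [simp]: "fv (app f t) = fv t"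
  by (simp add: app_def fv_def)

lemma is_term_pair [simp]:
  assumes "is_term t" "is_term s" "fv t \<inter> fv s = {}"
  shows "is_term (t \<boxtimes> s)" "ty (t \<boxtimes> s) = ty t \<otimes>\<^sub>o ty s"
  using assms by (simp_all add: is_term_def pair_def fv_def ty_def)

lemma fv_pair [simp]: "fv (t \<boxtimes> s) = fv t \<union> fv s"
  by (simp add: pair_def fv_def)

lemma is_term_var [simp]: "x \<in> Ob C \<Longrightarrow> is_term (var i x)" "x \<in> Ob C \<Longrightarrow> ty (var i x) = x" "fv (var i x) = {i}"
  by (simp_all add: is_term_def var_def ty_def fv_def)

lemma is_term_star [simp]: "is_term star" "ty star = \<I>" "fv star = {}"
  by (simp_all add: is_term_def star_def ty_def fv_def)

lemma ty_Ob [simp]: "is_term t \<Longrightarrow> ty t \<in> Ob C"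
  by (simp add: is_term_def ty_def)

lemma generic_var [simp]: "x \<in> Ob C \<Longrightarrow> generic (var i x)"
  by (simp add: generic_def) (simp add: var_def)

lemma generic_pair [simp]: "generic t \<Longrightarrow> generic s \<Longrightarrow> fv t \<inter> fv s = {} \<Longrightarrow> generic (t \<boxtimes> s)"
  by (simp add: generic_def) (simp add: is_term_def pair_def fv_def)

lemma generic_app [simp]: "generic t \<Longrightarrow> iso_arrow C f \<Longrightarrow> src f = ty t \<Longrightarrow> generic (app f t)"
  by (simp add: generic_def iso_arr) (simp add: app_def ty_def is_term_def)

text \<open>An equation between arrows may be tested on a tensor of distinct variables, where
  the structural arrows merely rebracket and permute.\<close>

lemma generic_eqI:
  assumes "app f t = app g t" "generic t" "arr f" "arr g" "src f = ty t" "src g = ty t"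
  shows "f = g"
  by (rule iso_cancel_right[of f "snd t"]) (use assms in \<open>simp_all add: app_def generic_def ty_def\<close>)

lemma app_comp [simp]:
  "is_term t \<Longrightarrow> arr f \<Longrightarrow> arr g \<Longrightarrow> src f = ty t \<Longrightarrow> src g = tgt f \<Longrightarrow> app (g \<cdot> f) t = app g (app f t)"
  by (simp add: app_def is_term_def ty_def compA)

lemma app_id [simp]: "is_term t \<Longrightarrow> x = ty t \<Longrightarrow> app (\<i>\<d> x) t = t"
  by (simp add: app_def is_term_def ty_def)

lemma app_tens [simp]:
  "is_term t \<Longrightarrow> is_term s \<Longrightarrow> fv t \<inter> fv s = {} \<Longrightarrow> arr f \<Longrightarrow> arr g \<Longrightarrow> src f = ty t \<Longrightarrow> src g = ty s
    \<Longrightarrow> app (f \<otimes>\<^sub>a g) (t \<boxtimes> s) = app f t \<boxtimes> app g s"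
  by (simp add: app_def pair_def is_term_def ty_def fv_def interchange')

lemma app_inv:
  assumes "app f t = s" "is_term t" "iso_arrow C f" "src f = ty t"
  shows "app (\<i>\<n>\<v> f) s = t"
  using assms(2-) by (simp add: iso_arr flip: assms(1)) (simp flip: app_comp add: iso_arr)

text \<open>Naturality moves the symmetry past the two arrows, and \<open>shuf_comm\<close> absorbs
  it into the shuffle.\<close>

lemma app_sym [simp]:
  assumes "is_term t" "is_term s" "fv t \<inter> fv s = {}" "x = ty t" "y = ty s"
  shows "app (\<sigma> x y) (t \<boxtimes> s) = s \<boxtimes> t"
proof -
  have d: "labels (fst t) \<inter> labels (fst s) = {}" "labels (fst s) \<inter> labels (fst t) = {}"
    using assms by (auto simp: fv_def)
  have *: "\<i>\<n>\<v> (shuf (fst s) (fst t)) = \<sigma> (vtens (fst t)) (vtens (fst s)) \<cdot> \<i>\<n>\<v> (shuf (fst t) (fst s))"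
    using assms d shuf_comm[of "fst s" "fst t", symmetric] by (simp add: is_term_def)
  show ?thesis
    using assms d sym_nat[of "snd t" "snd s"]
    by (simp add: app_def pair_def is_term_def ty_def merge_comm[of "fst s" "fst t"] * compA[symmetric])
qed

text \<open>Here \<open>shuf_assoc\<close> is spent: after naturality, the associator is absorbed by
  the inverse shuffles. From now on it is a rewrite rule on bracketed variables.\<close>

lemma app_assoc [simp]:
  assumes "is_term t" "is_term s" "is_term r" "fv t \<inter> fv s = {}" "fv t \<inter> fv r = {}" "fv s \<inter> fv r = {}"
    "x = ty t" "y = ty s" "z = ty r"
  shows "app (\<alpha> x y z) ((t \<boxtimes> s) \<boxtimes> r) = t \<boxtimes> s \<boxtimes> r"
proof -
  obtain u f v g w h where [simp]: "t = (u, f)" "s = (v, g)" "r = (w, h)"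
    by (metis surj_pair)
  have [simp]: "vars_ok u" "vars_ok v" "vars_ok w" "arr f" "arr g" "arr h" "src f = vtens u" "src g = vtens v" "src h = vtens w"
    "x = tgt f" "y = tgt g" "z = tgt h"
    using assms by (simp_all add: is_term_def ty_def)
  have d: "labels u \<inter> labels v = {}" "labels u \<inter> labels w = {}" "labels v \<inter> labels w = {}"
    "labels u \<inter> (labels v \<union> labels w) = {}" "(labels u \<union> labels v) \<inter> labels w = {}"
    using assms by (auto simp: fv_def)
  note [simp] = d
  have "\<i>\<n>\<v> (shuf (merge u v) w \<cdot> (shuf u v \<triangleleft> (vtens w)))
      = \<i>\<n>\<v> (shuf u (merge v w) \<cdot> ((vtens u) \<triangleright> shuf v w) \<cdot> \<alpha> (vtens u) (vtens v) (vtens w))"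
    using shuf_assoc[of u v w] by (simp add: shuf_assoc_def)
  then have *: "\<alpha> (vtens u) (vtens v) (vtens w) \<cdot> (\<i>\<n>\<v> (shuf u v) \<triangleleft> (vtens w)) \<cdot> \<i>\<n>\<v> (shuf (merge u v) w)
    = ((vtens u) \<triangleright> \<i>\<n>\<v> (shuf v w)) \<cdot> \<i>\<n>\<v> (shuf u (merge v w))"
    by (simp add: compA)
  have "\<alpha> x y z \<cdot> (((f \<otimes>\<^sub>a g) \<cdot> \<i>\<n>\<v> (shuf u v)) \<otimes>\<^sub>a h) \<cdot> \<i>\<n>\<v> (shuf (merge u v) w)
    = \<alpha> x y z \<cdot> ((f \<otimes>\<^sub>a g) \<otimes>\<^sub>a h) \<cdot> (\<i>\<n>\<v> (shuf u v) \<triangleleft> (vtens w)) \<cdot> \<i>\<n>\<v> (shuf (merge u v) w)"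
    by (simp add: interchange')
  also have "\<dots> = (\<alpha> x y z \<cdot> ((f \<otimes>\<^sub>a g) \<otimes>\<^sub>a h)) \<cdot> (\<i>\<n>\<v> (shuf u v) \<triangleleft> (vtens w)) \<cdot> \<i>\<n>\<v> (shuf (merge u v) w)"
    by (simp add: compA)
  also have "\<dots> = (f \<otimes>\<^sub>a (g \<otimes>\<^sub>a h)) \<cdot> \<alpha> (vtens u) (vtens v) (vtens w) \<cdot> (\<i>\<n>\<v> (shuf u v) \<triangleleft> (vtens w)) \<cdot> \<i>\<n>\<v> (shuf (merge u v) w)"
    using assoc_nat[of f g h] by (simp add: compA)
  also have "\<dots> = (f \<otimes>\<^sub>a ((g \<otimes>\<^sub>a h) \<cdot> \<i>\<n>\<v> (shuf v w))) \<cdot> \<i>\<n>\<v> (shuf u (merge v w))"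
    unfolding * by (simp add: interchange')
  finally show ?thesis
    by (simp add: app_def pair_def merge_assoc)
qed

lemma app_lunit [simp]:
  assumes "is_term t" "x = ty t"
  shows "app (\<l> x) (star \<boxtimes> t) = t"
proof -
  have "\<l> x \<cdot> (\<I> \<triangleright> snd t) \<cdot> \<i>\<n>\<v> (\<l> (vtens (fst t))) = (\<l> x \<cdot> (\<I> \<triangleright> snd t)) \<cdot> \<i>\<n>\<v> (\<l> (vtens (fst t)))"
    using assms by (simp add: compA is_term_def ty_def)
  also have "\<dots> = snd t"
    using assms lunitor_nat[of "snd t" "src (snd t)" "tgt (snd t)"]
    by (simp add: hom_iff compA is_term_def ty_def)
  finally show ?thesis
    using assms by (simp add: app_def pair_def star_def is_term_def ty_def shuf_Nil)
qed

lemma app_runit [simp]: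
  assumes "is_term t" "x = ty t"
  shows "app (\<r> x) (t \<boxtimes> star) = t"
proof -
  have "app (\<r> x) (app (\<sigma> \<I> x) (star \<boxtimes> t)) = t"
    using assms by (subst app_comp[symmetric]) (simp_all add: runit_sym del: app_sym)
  then show ?thesis
    using assms by simp
qed

lemma app_inv_simps [simp]:
  "is_term t \<Longrightarrow> x = ty t \<Longrightarrow> app (\<i>\<n>\<v> (\<l> x)) t = star \<boxtimes> t"
  "is_term t \<Longrightarrow> x = ty t \<Longrightarrow> app (\<i>\<n>\<v> (\<r> x)) t = t \<boxtimes> star"
  "\<lbrakk>is_term t; is_term s; is_term r; fv t \<inter> fv s = {}; fv t \<inter> fv r = {}; fv s \<inter> fv r = {};
    x = ty t; y = ty s; z = ty r\<rbrakk> \<Longrightarrow> app (\<i>\<n>\<v> (\<alpha> x y z)) (t \<boxtimes> s \<boxtimes> r) = (t \<boxtimes> s) \<boxtimes> r"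
  "is_term t \<Longrightarrow> iso_arrow C f \<Longrightarrow> src f = ty t \<Longrightarrow> app (\<i>\<n>\<v> f) (app f t) = t"
  "is_term t \<Longrightarrow> iso_arrow C f \<Longrightarrow> tgt f = ty t \<Longrightarrow> app f (app (\<i>\<n>\<v> f) t) = t"
  by (rule app_inv; simp add: Int_Un_distrib2)+ (simp_all flip: app_comp add: iso_arr)

end

section \<open>Sums of arrows\<close>

context linear_category
begin

text \<open>The module is read off the source and target of the first argument; the result is meaningless
  unless the arrows are parallel.\<close>

definition hadd (infixl "\<boxplus>" 53) where
  "f \<boxplus> g = f \<oplus>\<^bsub>\<H> (src f) (tgt f)\<^esub> g"

definition hsub (infixl "\<boxminus>" 53) where
  "f \<boxminus> g = f \<ominus>\<^bsub>\<H> (src f) (tgt f)\<^esub> g"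

abbreviation zer where
  "zer x y \<equiv> \<zero>\<^bsub>\<H> x y\<^esub>"

lemma hom_group: "x \<in> Ob C \<Longrightarrow> y \<in> Ob C \<Longrightarrow> abelian_group (\<H> x y)"
  using hom_module module.axioms(2) by blast

lemma hom_carrier: "x \<in> Ob C \<Longrightarrow> y \<in> Ob C \<Longrightarrow> f \<in> carrier (\<H> x y) \<longleftrightarrow> arr f \<and> src f = x \<and> tgt f = y"
  by (simp add: carrier_hom_module hom_iff)

lemma hadd_eq: "f \<in> carrier (\<H> x y) \<Longrightarrow> x \<in> Ob C \<Longrightarrow> y \<in> Ob C \<Longrightarrow> f \<boxplus> g = f \<oplus>\<^bsub>\<H> x y\<^esub> g"
  by (simp add: hadd_def hom_carrier)

lemma hsub_eq: "f \<in> carrier (\<H> x y) \<Longrightarrow> x \<in> Ob C \<Longrightarrow> y \<in> Ob C \<Longrightarrow> f \<boxminus> g = f \<ominus>\<^bsub>\<H> x y\<^esub> g"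
  by (simp add: hsub_def hom_carrier)

lemma hadd_arr [simp]:
  assumes "arr f" "arr g" "src f = src g" "tgt f = tgt g"
  shows "arr (f \<boxplus> g)" "src (f \<boxplus> g) = src g" "tgt (f \<boxplus> g) = tgt g"
proof -
  have o: "src g \<in> Ob C" "tgt g \<in> Ob C"
    using assms by simp_all
  interpret abelian_group "\<H> (src g) (tgt g)"
    by (rule hom_group) (use o in simp_all)
  have c: "f \<in> carrier (\<H> (src g) (tgt g))" "g \<in> carrier (\<H> (src g) (tgt g))"
    using assms hom_carrier[OF o] by simp_all
  have "f \<boxplus> g \<in> carrier (\<H> (src g) (tgt g))"
    using c by (simp add: hadd_eq[OF _ o] hsub_eq[OF _ o])
  then show "arr (f \<boxplus> g)" "src (f \<boxplus> g) = src g" "tgt (f \<boxplus> g) = tgt g"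
    using hom_carrier[OF o] by blast+
qed

lemma hsub_arr [simp]:
  assumes "arr f" "arr g" "src f = src g" "tgt f = tgt g"
  shows "arr (f \<boxminus> g)" "src (f \<boxminus> g) = src g" "tgt (f \<boxminus> g) = tgt g"
proof -
  have o: "src g \<in> Ob C" "tgt g \<in> Ob C"
    using assms by simp_all
  interpret abelian_group "\<H> (src g) (tgt g)"
    by (rule hom_group) (use o in simp_all)
  have c: "f \<in> carrier (\<H> (src g) (tgt g))" "g \<in> carrier (\<H> (src g) (tgt g))"
    using assms hom_carrier[OF o] by simp_all
  have "f \<boxminus> g \<in> carrier (\<H> (src g) (tgt g))"
    using c by (simp add: hadd_eq[OF _ o] hsub_eq[OF _ o])
  then show "arr (f \<boxminus> g)" "src (f \<boxminus> g) = src g" "tgt (f \<boxminus> g) = tgt g"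
    using hom_carrier[OF o] by blast+
qed

lemma zer_arr [simp]:
  assumes "x \<in> Ob C" "y \<in> Ob C"
  shows "arr (zer x y)" "src (zer x y) = x" "tgt (zer x y) = y"
proof -
  interpret abelian_group "\<H> x y"
    by (rule hom_group) (use assms in simp_all)
  show "arr (zer x y)" "src (zer x y) = x" "tgt (zer x y) = y"
    using zero_closed hom_carrier[OF assms] by blast+
qed

lemma hadd_assoc:
  assumes "arr f" "arr g" "arr h" "src f = src g" "tgt f = tgt g" "src g = src h" "tgt g = tgt h"
  shows "(f \<boxplus> g) \<boxplus> h = f \<boxplus> (g \<boxplus> h)"
proof -
  have o: "src h \<in> Ob C" "tgt h \<in> Ob C"
    using assms by simp_all
  interpret abelian_group "\<H> (src h) (tgt h)"
    by (rule hom_group) (use o in simp_all)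
  have c: "f \<in> carrier (\<H> (src h) (tgt h))" "g \<in> carrier (\<H> (src h) (tgt h))" "h \<in> carrier (\<H> (src h) (tgt h))"
    using assms hom_carrier[OF o] by simp_all
  show ?thesis
    using c by (simp add: hadd_eq[OF _ o] hsub_eq[OF _ o] a_assoc)
qed

lemma hadd_comm:
  assumes "arr f" "arr g" "src f = src g" "tgt f = tgt g"
  shows "f \<boxplus> g = g \<boxplus> f"
proof -
  have o: "src g \<in> Ob C" "tgt g \<in> Ob C"
    using assms by simp_all
  interpret abelian_group "\<H> (src g) (tgt g)"
    by (rule hom_group) (use o in simp_all)
  have c: "f \<in> carrier (\<H> (src g) (tgt g))" "g \<in> carrier (\<H> (src g) (tgt g))"
    using assms hom_carrier[OF o] by simp_all
  show ?thesis
    using c by (simp add: hadd_eq[OF _ o] hsub_eq[OF _ o] a_comm)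
qed

lemma hadd_left_comm:
  assumes "arr f" "arr g" "arr h" "src f = src g" "tgt f = tgt g" "src g = src h" "tgt g = tgt h"
  shows "f \<boxplus> (g \<boxplus> h) = g \<boxplus> (f \<boxplus> h)"
proof -
  have "f \<boxplus> (g \<boxplus> h) = (f \<boxplus> g) \<boxplus> h"
    using assms by (simp add: hadd_assoc)
  also have "f \<boxplus> g = g \<boxplus> f"
    using assms by (intro hadd_comm)
  also have "(g \<boxplus> f) \<boxplus> h = g \<boxplus> (f \<boxplus> h)"
    using assms by (simp add: hadd_assoc)
  finally show ?thesis .
qed

lemma hsub_hadd_cancel:
  assumes "arr f" "arr g" "src f = src g" "tgt f = tgt g"
  shows "(f \<boxminus> g) \<boxplus> g = f"
proof -
  have o: "src g \<in> Ob C" "tgt g \<in> Ob C"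
    using assms by simp_all
  interpret abelian_group "\<H> (src g) (tgt g)"
    by (rule hom_group) (use o in simp_all)
  have c: "f \<in> carrier (\<H> (src g) (tgt g))" "g \<in> carrier (\<H> (src g) (tgt g))"
    using assms hom_carrier[OF o] by simp_all
  show ?thesis
    using c by (simp add: hadd_eq[OF _ o] hsub_eq[OF _ o] minus_eq a_assoc l_neg)
qed

lemma hadd_hsub_cancel:
  assumes "arr f" "arr g" "src f = src g" "tgt f = tgt g"
  shows "(f \<boxplus> g) \<boxminus> g = f"
proof -
  have o: "src g \<in> Ob C" "tgt g \<in> Ob C"
    using assms by simp_all
  interpret abelian_group "\<H> (src g) (tgt g)"
    by (rule hom_group) (use o in simp_all)
  have c: "f \<in> carrier (\<H> (src g) (tgt g))" "g \<in> carrier (\<H> (src g) (tgt g))"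
    using assms hom_carrier[OF o] by simp_all
  show ?thesis
    using c by (simp add: hadd_eq[OF _ o] hsub_eq[OF _ o] minus_eq a_assoc r_neg)
qed

lemma hadd_zer [simp]:
  assumes "arr f" "x = src f" "y = tgt f"
  shows "f \<boxplus> zer x y = f" "zer x y \<boxplus> f = f"
proof -
  have o: "x \<in> Ob C" "y \<in> Ob C"
    using assms by simp_all
  interpret abelian_group "\<H> (x) (y)"
    by (rule hom_group) (use o in simp_all)
  have c: "f \<in> carrier (\<H> (x) (y))"
    using assms hom_carrier[OF o] by simp_all
  show "f \<boxplus> zer x y = f" "zer x y \<boxplus> f = f"
    using c by (simp_all add: hadd_eq[OF _ o] hsub_eq[OF _ o] )
qed

text \<open>Characterises a difference through addition alone. Compatibility of composition, tensor
  product and scalars with differences thereby follows from additivity.\<close>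

lemma hsub_unique:
  assumes "h \<boxplus> g = f" "arr h" "arr g" "src h = src g" "tgt h = tgt g"
  shows "f \<boxminus> g = h"
  using hadd_hsub_cancel[of h g] assms by simp

lemma hsub_self [simp]: "arr f \<Longrightarrow> f \<boxminus> f = zer (src f) (tgt f)"
  by (rule hsub_unique) simp_all

lemma hsub_zer [simp]: "arr f \<Longrightarrow> x = src f \<Longrightarrow> y = tgt f \<Longrightarrow> f \<boxminus> zer x y = f"
  by (rule hsub_unique) simp_all

lemma hsub_eq_zer:
  "\<lbrakk>f \<boxminus> g = zer x y; arr f; arr g; src f = x; src g = x; tgt f = y; tgt g = y\<rbrakk> \<Longrightarrow> f = g"
  using hsub_hadd_cancel[of f g] by auto

lemma comp_hadd:
  assumes "arr f" "arr f'" "arr g" "src f = src f'" "tgt f = tgt f'" "src g = tgt f'"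
  shows "g \<cdot> (f \<boxplus> f') = g \<cdot> f \<boxplus> g \<cdot> f'"
  using assms comp_add_right[of f "src f'" "tgt f'" f' g "tgt g"] by (simp add: hadd_def hom_iff)

lemma hadd_comp:
  assumes "arr f" "arr g'" "arr g" "src g = src g'" "tgt g = tgt g'" "src g' = tgt f"
  shows "(g \<boxplus> g') \<cdot> f = g \<cdot> f \<boxplus> g' \<cdot> f"
  using assms comp_add_left[of f "src f" "tgt f" g "tgt g'" g'] by (simp add: hadd_def hom_iff)

lemma comp_hsub:
  assumes "arr f" "arr f'" "arr g" "src f = src f'" "tgt f = tgt f'" "src g = tgt f'"
  shows "g \<cdot> (f \<boxminus> f') = g \<cdot> f \<boxminus> g \<cdot> f'"
  by (rule hsub_unique[symmetric]) (use assms in \<open>simp_all flip: comp_hadd add: hsub_hadd_cancel\<close>)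

lemma hsub_comp:
  assumes "arr f" "arr g'" "arr g" "src g = src g'" "tgt g = tgt g'" "src g' = tgt f"
  shows "(g \<boxminus> g') \<cdot> f = g \<cdot> f \<boxminus> g' \<cdot> f"
  by (rule hsub_unique[symmetric]) (use assms in \<open>simp_all flip: hadd_comp add: hsub_hadd_cancel\<close>)

text \<open>Zero is a difference of equal arrows, so additivity carries it to another such
  difference.\<close>

lemma zer_comp [simp]:
  assumes "arr f" "z \<in> Ob C" "y = tgt f"
  shows "zer y z \<cdot> f = zer (src f) z"
proof -
  have "(zer y z \<boxminus> zer y z) \<cdot> f = zer y z \<cdot> f \<boxminus> zer y z \<cdot> f"
    by (rule hsub_comp) (use assms in simp_all)
  then show ?thesis
    using assms by simp
qed

lemma comp_zer [simp]:
  assumes "arr f" "x \<in> Ob C" "y = src f"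
  shows "f \<cdot> zer x y = zer x (tgt f)"
proof -
  have "f \<cdot> (zer x y \<boxminus> zer x y) = f \<cdot> zer x y \<boxminus> f \<cdot> zer x y"
    by (rule comp_hsub) (use assms in simp_all)
  then show ?thesis
    using assms by simp
qed

lemma hsub_hadd_distrib:
  assumes "arr f" "arr g" "arr f'" "arr g'" "src f = src g" "src f' = src g" "src g' = src g"
    "tgt f = tgt g" "tgt f' = tgt g" "tgt g' = tgt g"
  shows "(f \<boxplus> f') \<boxminus> (g \<boxplus> g') = (f \<boxminus> g) \<boxplus> (f' \<boxminus> g')"
proof (rule hsub_unique)
  have "((f \<boxminus> g) \<boxplus> (f' \<boxminus> g')) \<boxplus> (g \<boxplus> g') = ((f \<boxminus> g) \<boxplus> g) \<boxplus> ((f' \<boxminus> g') \<boxplus> g')"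
    using assms by (simp add: hadd_assoc hadd_left_comm[of g])
  then show "((f \<boxminus> g) \<boxplus> (f' \<boxminus> g')) \<boxplus> (g \<boxplus> g') = f \<boxplus> f'"
    using assms by (simp add: hsub_hadd_cancel)
qed (use assms in simp_all)

lemma hsub_hadd_swap:
  assumes "arr f" "arr g" "arr h" "src f = src g" "src h = src g" "tgt f = tgt g" "tgt h = tgt g"
  shows "(f \<boxplus> h) \<boxminus> g = (f \<boxminus> g) \<boxplus> h"
proof -
  have "(f \<boxplus> h) \<boxminus> (g \<boxplus> zer (src g) (tgt g)) = (f \<boxminus> g) \<boxplus> (h \<boxminus> zer (src g) (tgt g))"
    by (rule hsub_hadd_distrib) (use assms in simp_all)
  then show ?thesis
    using assms by simp
qed

definition hsmult where
  "hsmult r f = r \<odot>\<^bsub>\<H> (src f) (tgt f)\<^esub> f"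

lemma hsmult_arr [simp]:
  assumes "r \<in> carrier R" "arr f"
  shows "arr (hsmult r f)" "src (hsmult r f) = src f" "tgt (hsmult r f) = tgt f"
proof -
  interpret M: module R "\<H> (src f) (tgt f)"
    by (rule hom_module) (use assms in simp_all)
  have "hsmult r f \<in> carrier (\<H> (src f) (tgt f))"
    unfolding hsmult_def by (rule M.smult_closed) (use assms in \<open>simp_all add: hom_carrier\<close>)
  then show "arr (hsmult r f)" "src (hsmult r f) = src f" "tgt (hsmult r f) = tgt f"
    using assms by (simp_all add: hom_carrier)
qed

lemma hsmult_hadd:
  assumes "r \<in> carrier R" "arr f" "arr g" "src f = src g" "tgt f = tgt g"
  shows "hsmult r (f \<boxplus> g) = hsmult r f \<boxplus> hsmult r g"
proof -
  have o: "src g \<in> Ob C" "tgt g \<in> Ob C"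
    using assms by simp_all
  interpret M: module R "\<H> (src g) (tgt g)"
    by (rule hom_module) (use o in simp_all)
  have c: "f \<in> carrier (\<H> (src g) (tgt g))" "g \<in> carrier (\<H> (src g) (tgt g))"
    using assms hom_carrier[OF o] by simp_all
  have "hsmult r (f \<boxplus> g) = r \<odot>\<^bsub>\<H> (src g) (tgt g)\<^esub> (f \<oplus>\<^bsub>\<H> (src g) (tgt g)\<^esub> g)"
    using assms by (simp add: hsmult_def) (simp add: hadd_def)
  also have "\<dots> = hsmult r f \<boxplus> hsmult r g"
    using assms(1) c by (simp add: M.smult_r_distr hadd_eq[OF _ o] hsmult_def assms(4,5))
  finally show ?thesis .
qed

lemma hsmult_hsub:
  assumes "r \<in> carrier R" "arr f" "arr g" "src f = src g" "tgt f = tgt g"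
  shows "hsmult r (f \<boxminus> g) = hsmult r f \<boxminus> hsmult r g"
  by (rule hsub_unique[symmetric]) (use assms in \<open>simp_all flip: hsmult_hadd add: hsub_hadd_cancel\<close>)

lemma comp_hsmult:
  "r \<in> carrier R \<Longrightarrow> arr f \<Longrightarrow> arr g \<Longrightarrow> src g = tgt f \<Longrightarrow> g \<cdot> hsmult r f = hsmult r (g \<cdot> f)"
  using comp_smult_right[of r f "src f" "tgt f" g "tgt g"] by (simp add: hsmult_def hom_iff)

lemma hsmult_comp:
  "r \<in> carrier R \<Longrightarrow> arr f \<Longrightarrow> arr g \<Longrightarrow> src g = tgt f \<Longrightarrow> hsmult r g \<cdot> f = hsmult r (g \<cdot> f)"
  using comp_smult_left[of r f "src f" "tgt f" g "tgt g"] by (simp add: hsmult_def hom_iff)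

lemma hsmult_zer [simp]:
  assumes "r \<in> carrier R" "x \<in> Ob C" "y \<in> Ob C"
  shows "hsmult r (zer x y) = zer x y"
proof -
  have "hsmult r (zer x y \<boxminus> zer x y) = hsmult r (zer x y) \<boxminus> hsmult r (zer x y)"
    by (rule hsmult_hsub) (use assms in simp_all)
  then show ?thesis
    using assms by simp
qed

end

section \<open>Bilinearity of the tensor product\<close>

context sm_category
begin

lemma tens_hadd:
  assumes "arr f" "arr g" "arr h" "src f = src g" "tgt f = tgt g"
  shows "h \<otimes>\<^sub>a (f \<boxplus> g) = (h \<otimes>\<^sub>a f) \<boxplus> (h \<otimes>\<^sub>a g)"
  using assms tens_add_right[of h "src h" "tgt h" f "src g" "tgt g" g] by (simp add: hadd_def hom_iff)

lemma hadd_tens: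
  assumes "arr f" "arr g" "arr h" "src f = src g" "tgt f = tgt g"
  shows "(f \<boxplus> g) \<otimes>\<^sub>a h = (f \<otimes>\<^sub>a h) \<boxplus> (g \<otimes>\<^sub>a h)"
  using assms tens_add_left[of f "src g" "tgt g" g h "src h" "tgt h"] by (simp add: hadd_def hom_iff)

lemma tens_hsub:
  assumes "arr f" "arr g" "arr h" "src f = src g" "tgt f = tgt g"
  shows "h \<otimes>\<^sub>a (f \<boxminus> g) = (h \<otimes>\<^sub>a f) \<boxminus> (h \<otimes>\<^sub>a g)"
  by (rule hsub_unique[symmetric]) (use assms in \<open>simp_all flip: tens_hadd add: hsub_hadd_cancel\<close>)

lemma hsub_tens:
  assumes "arr f" "arr g" "arr h" "src f = src g" "tgt f = tgt g"
  shows "(f \<boxminus> g) \<otimes>\<^sub>a h = (f \<otimes>\<^sub>a h) \<boxminus> (g \<otimes>\<^sub>a h)"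
  by (rule hsub_unique[symmetric]) (use assms in \<open>simp_all flip: hadd_tens add: hsub_hadd_cancel\<close>)

lemma tens_zer [simp]:
  assumes "arr h" "x \<in> Ob C" "y \<in> Ob C"
  shows "h \<otimes>\<^sub>a zer x y = zer (src h \<otimes>\<^sub>o x) (tgt h \<otimes>\<^sub>o y)" "zer x y \<otimes>\<^sub>a h = zer (x \<otimes>\<^sub>o src h) (y \<otimes>\<^sub>o tgt h)"
proof -
  have "h \<otimes>\<^sub>a (zer x y \<boxminus> zer x y) = (h \<otimes>\<^sub>a zer x y) \<boxminus> (h \<otimes>\<^sub>a zer x y)"
    "(zer x y \<boxminus> zer x y) \<otimes>\<^sub>a h = (zer x y \<otimes>\<^sub>a h) \<boxminus> (zer x y \<otimes>\<^sub>a h)"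
    by (rule tens_hsub hsub_tens; use assms in simp)+
  then show "h \<otimes>\<^sub>a zer x y = zer (src h \<otimes>\<^sub>o x) (tgt h \<otimes>\<^sub>o y)" "zer x y \<otimes>\<^sub>a h = zer (x \<otimes>\<^sub>o src h) (y \<otimes>\<^sub>o tgt h)"
    using assms by simp_all
qed

lemma tens_hsmult:
  "r \<in> carrier R \<Longrightarrow> arr f \<Longrightarrow> arr g \<Longrightarrow> g \<otimes>\<^sub>a hsmult r f = hsmult r (g \<otimes>\<^sub>a f)"
  using tens_smult_right[of r g "src g" "tgt g" f "src f" "tgt f"] by (simp add: hsmult_def hom_iff)

end

section \<open>Operators with parameters\<close>

locale monoid_in = sm_category R C
  for R :: "('r, 'k) ring_scheme" and C :: "('r, 'o, 'm, 'z) sm_category_scheme" (structure)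
    and A :: "('o, 'm, 'y) monoid_object_scheme" +
  assumes monoid: "commutative_monoid C A"
begin

abbreviation a where "a \<equiv> und A"
abbreviation \<mu> where "\<mu> \<equiv> mul A"

section \<open>The monoid laws as equations between terms\<close>

definition unit_term where
  "unit_term = app (uni A) star"

lemma a_Ob [simp]: "a \<in> Ob C"
  using monoid by (simp add: commutative_monoid_def Let_def)

lemma mul_arr [simp]: "arr \<mu>" "src \<mu> = a \<otimes>\<^sub>o a" "tgt \<mu> = a"
  using monoid by (simp_all add: commutative_monoid_def Let_def hom_iff)

lemma uni_arr [simp]: "arr (uni A)" "src (uni A) = \<I>" "tgt (uni A) = a"
  using monoid by (simp_all add: commutative_monoid_def Let_def hom_iff)

lemma unit_term_is_term [simp]: "is_term unit_term" "ty unit_term = a" "fv unit_term = {}"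
  by (simp_all add: unit_term_def)

lemma mul_unit_term [simp]:
  assumes "is_term t" "ty t = a"
  shows "app \<mu> (unit_term \<boxtimes> t) = t" "app \<mu> (t \<boxtimes> unit_term) = t"
proof -
  have "app \<mu> (app (uni A \<triangleleft> a) (star \<boxtimes> t)) = app (\<mu> \<cdot> (uni A \<triangleleft> a)) (star \<boxtimes> t)"
    using assms by (simp del: app_tens)
  also have "\<dots> = t"
    using assms monoid by (simp add: commutative_monoid_def Let_def)
  finally show "app \<mu> (unit_term \<boxtimes> t) = t"
    using assms by (simp add: unit_term_def)
  have "app \<mu> (app (a \<triangleright> uni A) (t \<boxtimes> star)) = app (\<mu> \<cdot> (a \<triangleright> uni A)) (t \<boxtimes> star)"
    using assms by (simp del: app_tens)
  also have "\<dots> = t"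
    using assms monoid by (simp add: commutative_monoid_def Let_def)
  finally show "app \<mu> (t \<boxtimes> unit_term) = t"
    using assms by (simp add: unit_term_def)
qed

lemma mul_comm:
  assumes "is_term t" "is_term s" "ty t = a" "ty s = a" "fv t \<inter> fv s = {}"
  shows "app \<mu> (t \<boxtimes> s) = app \<mu> (s \<boxtimes> t)"
proof -
  have "app \<mu> (app (\<sigma> a a) (t \<boxtimes> s)) = app (\<mu> \<cdot> \<sigma> a a) (t \<boxtimes> s)"
    using assms by (simp del: app_sym)
  also have "\<dots> = app \<mu> (t \<boxtimes> s)"
    using monoid by (simp add: commutative_monoid_def Let_def)
  finally show ?thesis
    using assms by simp
qed

lemma mul_assoc:
  assumes "is_term t" "is_term s" "is_term r" "ty t = a" "ty s = a" "ty r = a"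
    "fv t \<inter> fv s = {}" "fv t \<inter> fv r = {}" "fv s \<inter> fv r = {}"
  shows "app \<mu> (app \<mu> (t \<boxtimes> s) \<boxtimes> r) = app \<mu> (t \<boxtimes> app \<mu> (s \<boxtimes> r))"
proof -
  have d: "(fv t \<union> fv s) \<inter> fv r = {}" "fv t \<inter> (fv s \<union> fv r) = {}"
    using assms by auto
  have "app \<mu> (app \<mu> (t \<boxtimes> s) \<boxtimes> r) = app (\<mu> \<cdot> (\<mu> \<triangleleft> a)) ((t \<boxtimes> s) \<boxtimes> r)"
    using assms d by simp
  also have "\<dots> = app (\<mu> \<cdot> (a \<triangleright> \<mu>) \<cdot> \<alpha> a a a) ((t \<boxtimes> s) \<boxtimes> r)"
    using monoid by (simp add: commutative_monoid_def Let_def)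
  also have "\<dots> = app \<mu> (t \<boxtimes> app \<mu> (s \<boxtimes> r))"
    using assms d by simp
  finally show ?thesis .
qed

text \<open>Completes the monoid laws to a system for ordered rewriting, which brings products in
  \<open>a\<close> of terms with disjoint variables into a normal form.\<close>

lemma mul_left_comm:
  assumes "is_term t" "is_term s" "is_term r" "ty t = a" "ty s = a" "ty r = a"
    "fv t \<inter> fv s = {}" "fv t \<inter> fv r = {}" "fv s \<inter> fv r = {}"
  shows "app \<mu> (t \<boxtimes> app \<mu> (s \<boxtimes> r)) = app \<mu> (s \<boxtimes> app \<mu> (t \<boxtimes> r))"
proof -
  have d: "fv s \<inter> fv t = {}"
    using assms by auto
  have "app \<mu> (t \<boxtimes> app \<mu> (s \<boxtimes> r)) = app \<mu> (app \<mu> (t \<boxtimes> s) \<boxtimes> r)"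
    using assms by (intro mul_assoc[symmetric])
  also have "app \<mu> (t \<boxtimes> s) = app \<mu> (s \<boxtimes> t)"
    using assms by (intro mul_comm)
  also have "app \<mu> (app \<mu> (s \<boxtimes> t) \<boxtimes> r) = app \<mu> (s \<boxtimes> app \<mu> (t \<boxtimes> r))"
    using assms d by (intro mul_assoc)
  finally show ?thesis .
qed

lemmas mul_ac = mul_assoc mul_comm mul_left_comm

definition opr where
  "opr w f \<longleftrightarrow> w \<in> Ob C \<and> arr f \<and> src f = w \<otimes>\<^sub>o a \<and> tgt f = a"

lemma oprD:
  assumes "opr w f"
  shows "w \<in> Ob C" "arr f" "src f = w \<otimes>\<^sub>o a" "tgt f = a"
  using assms by (simp_all add: opr_def)

text \<open>On elements, \<open>lft w f\<close> is \<open>(v, p, b) \<mapsto> f (p, v b)\<close>, \<open>out w f\<close> is \<open>(v, p, b) \<mapsto> v f (p, b)\<close>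
  and \<open>rgt w f\<close> is \<open>(p, v, b) \<mapsto> f (p, v b)\<close>.\<close>

definition lft where
  "lft w f = f \<cdot> (w \<triangleright> \<mu>) \<cdot> \<alpha> w a a \<cdot> (\<sigma> a w \<triangleleft> a)"

definition out where
  "out w f = \<mu> \<cdot> (a \<triangleright> f) \<cdot> \<alpha> a w a"

definition rgt where
  "rgt w f = f \<cdot> (w \<triangleright> \<mu>) \<cdot> \<alpha> w a a"

text \<open>The commutator of f with multiplication by a variable element v: on elements (v, p, b)
  goes to f (p, v b) - v f (p, b). The element v joins the parameter, so brackets can be
  iterated.\<close>

definition bracket where
  "bracket w f = lft w f \<boxminus> out w f"

lemmas opr_defs = lft_def out_def rgt_def

lemma lft_arr [simp]:
  assumes "w \<in> Ob C" "arr f" "src f = w \<otimes>\<^sub>o a"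
  shows "arr (lft w f)" "src (lft w f) = (a \<otimes>\<^sub>o w) \<otimes>\<^sub>o a" "tgt (lft w f) = tgt f"
  using assms by (simp_all add: lft_def)

lemma out_arr [simp]:
  assumes "w \<in> Ob C" "arr f" "src f = w \<otimes>\<^sub>o a" "tgt f = a"
  shows "arr (out w f)" "src (out w f) = (a \<otimes>\<^sub>o w) \<otimes>\<^sub>o a" "tgt (out w f) = a"
  using assms by (simp_all add: out_def)

lemma rgt_arr [simp]:
  assumes "w \<in> Ob C" "arr f" "src f = w \<otimes>\<^sub>o a"
  shows "arr (rgt w f)" "src (rgt w f) = (w \<otimes>\<^sub>o a) \<otimes>\<^sub>o a" "tgt (rgt w f) = tgt f"
  using assms by (simp_all add: rgt_def)

lemma bracket_arr [simp]:
  assumes "w \<in> Ob C" "arr f" "src f = w \<otimes>\<^sub>o a" "tgt f = a"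
  shows "arr (bracket w f)" "src (bracket w f) = (a \<otimes>\<^sub>o w) \<otimes>\<^sub>o a" "tgt (bracket w f) = a"
  using assms by (simp_all add: bracket_def)

text \<open>The number counts the brackets that kill f, so it exceeds the usual order by one: order
  at most k is \<open>has_order (Suc k)\<close>. This lets inductions begin with the zero
  operator.\<close>

primrec has_order where
  "has_order 0 w f \<longleftrightarrow> f = zer (w \<otimes>\<^sub>o a) a"
| "has_order (Suc n) w f \<longleftrightarrow> has_order n (a \<otimes>\<^sub>o w) (bracket w f)"

lemma lft_hadd: "opr w f \<Longrightarrow> opr w g \<Longrightarrow> lft w (f \<boxplus> g) = lft w f \<boxplus> lft w g"
  by (simp add: opr_def lft_def hadd_comp)

lemma rgt_hsub: "opr w f \<Longrightarrow> opr w g \<Longrightarrow> rgt w (f \<boxminus> g) = rgt w f \<boxminus> rgt w g"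
  by (simp add: opr_def rgt_def hsub_comp)

lemma out_hadd: "opr w f \<Longrightarrow> opr w g \<Longrightarrow> out w (f \<boxplus> g) = out w f \<boxplus> out w g"
  by (simp add: opr_def out_def hadd_comp comp_hadd tens_hadd)

lemma out_hsub: "opr w f \<Longrightarrow> opr w g \<Longrightarrow> out w (f \<boxminus> g) = out w f \<boxminus> out w g"
  by (simp add: opr_def out_def hsub_comp comp_hsub tens_hsub)

lemma bracket_hadd: "opr w f \<Longrightarrow> opr w g \<Longrightarrow> bracket w (f \<boxplus> g) = bracket w f \<boxplus> bracket w g"
  by (simp add: bracket_def lft_hadd out_hadd) (simp add: hsub_hadd_distrib opr_def)

lemma opr_hsub: "opr w f \<Longrightarrow> opr w g \<Longrightarrow> opr w (f \<boxminus> g)"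
  by (simp add: opr_def)

lemma bracket_hsub:
  assumes f: "opr w f" and g: "opr w g"
  shows "bracket w (f \<boxminus> g) = bracket w f \<boxminus> bracket w g"
proof (rule hsub_unique[symmetric])
  show "bracket w (f \<boxminus> g) \<boxplus> bracket w g = bracket w f"
    using f g bracket_hadd[OF opr_hsub[OF f g] g] by (simp add: opr_def hsub_hadd_cancel)
qed (use f g in \<open>simp_all add: opr_def\<close>)

lemma opr_bracket: "opr w f \<Longrightarrow> opr (a \<otimes>\<^sub>o w) (bracket w f)"
  by (simp add: opr_def)

lemma bracket_zer: "w \<in> Ob C \<Longrightarrow> bracket w (zer (w \<otimes>\<^sub>o a) a) = zer ((a \<otimes>\<^sub>o w) \<otimes>\<^sub>o a) a"
  by (simp add: bracket_def opr_defs)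

lemma bracket_hsmult:
  assumes "r \<in> carrier R" "opr w f"
  shows "bracket w (hsmult r f) = hsmult r (bracket w f)"
  using assms by (simp add: bracket_def opr_defs opr_def hsmult_hsub hsmult_comp comp_hsmult tens_hsmult)

lemma has_order_zer: "w \<in> Ob C \<Longrightarrow> has_order n w (zer (w \<otimes>\<^sub>o a) a)"
  by (induction n arbitrary: w) (simp_all add: bracket_zer)

lemma has_order_Suc: "opr w f \<Longrightarrow> has_order n w f \<Longrightarrow> has_order (Suc n) w f"
  by (induction n arbitrary: w f) (simp_all add: bracket_zer opr_bracket opr_def)

lemma has_order_hadd: "\<lbrakk>opr w f; opr w g; has_order n w f; has_order n w g\<rbrakk> \<Longrightarrow> has_order n w (f \<boxplus> g)"
  by (induction n arbitrary: w f g) (auto simp: bracket_hadd opr_bracket, simp add: opr_def)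

lemma has_order_hsub: "\<lbrakk>opr w f; opr w g; has_order n w f; has_order n w g\<rbrakk> \<Longrightarrow> has_order n w (f \<boxminus> g)"
  by (induction n arbitrary: w f g) (auto simp: bracket_hsub opr_bracket, simp add: opr_def)

lemma has_order_hsmult: "\<lbrakk>r \<in> carrier R; opr w f; has_order n w f\<rbrakk> \<Longrightarrow> has_order n w (hsmult r f)"
  by (induction n arbitrary: w f) (auto simp: bracket_hsmult opr_bracket, simp add: opr_def)

section \<open>Stability of the order under substitution and multiplication\<close>

lemma bracket_precomp:
  assumes "opr w f" and [simp]: "arr h" "tgt h = w"
  shows "bracket (src h) (f \<cdot> (h \<triangleleft> a)) = bracket w f \<cdot> ((a \<triangleright> h) \<triangleleft> a)"
proof -
  have [simp]: "w \<in> Ob C" "arr f" "src f = w \<otimes>\<^sub>o a" "tgt f = a"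
    using assms by (simp_all add: opr_def)
  let ?t = "(var 0 a \<boxtimes> var 1 (src h)) \<boxtimes> var 2 a"
  have "lft (src h) (f \<cdot> (h \<triangleleft> a)) = lft w f \<cdot> ((a \<triangleright> h) \<triangleleft> a)"
    by (rule generic_eqI[of _ ?t]) (simp_all add: opr_defs)
  moreover have "out (src h) (f \<cdot> (h \<triangleleft> a)) = out w f \<cdot> ((a \<triangleright> h) \<triangleleft> a)"
    by (rule generic_eqI[of _ ?t]) (simp_all add: opr_defs)
  ultimately show ?thesis
    by (simp add: bracket_def hsub_comp)
qed

lemma has_order_precomp: "\<lbrakk>opr w f; has_order n w f; arr h; tgt h = w\<rbrakk> \<Longrightarrow> has_order n (src h) (f \<cdot> (h \<triangleleft> a))"
proof (induction n arbitrary: w f h)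
  case 0
  then show ?case
    by (simp add: opr_def)
next
  case (Suc n)
  then have "has_order n (src (a \<triangleright> h)) (bracket w f \<cdot> ((a \<triangleright> h) \<triangleleft> a))"
    by (intro Suc.IH) (simp_all add: opr_bracket)
  then show ?case
    using Suc by (simp add: bracket_precomp)
qed

text \<open>Multiplications commute with each other, so the commutator of v f with u is v times the
  commutator of f with u. The two occur in the parameter in opposite orders.\<close>

lemma has_order_out: "opr w f \<Longrightarrow> has_order n w f \<Longrightarrow> has_order n (a \<otimes>\<^sub>o w) (out w f)"
proof (induction n arbitrary: w f)
  case 0
  then show ?case
    by (simp add: opr_def opr_defs)
next
  case (Suc n)
  note [simp] = oprD[OF Suc.prems(1)]
  \<comment> \<open>Exchanges the multiplier with the new commutator variable.\<close>
  let ?s = "\<alpha> a a w \<cdot> (\<sigma> a a \<triangleleft> w) \<cdot> \<i>\<n>\<v> (\<alpha> a a w)"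
  let ?t = "(var 0 a \<boxtimes> var 1 a \<boxtimes> var 2 w) \<boxtimes> var 3 a"
  have "lft (a \<otimes>\<^sub>o w) (out w f) = out (a \<otimes>\<^sub>o w) (lft w f) \<cdot> (?s \<triangleleft> a)"
    by (rule generic_eqI[of _ ?t]) (simp_all add: opr_defs)
  moreover have "out (a \<otimes>\<^sub>o w) (out w f) = out (a \<otimes>\<^sub>o w) (out w f) \<cdot> (?s \<triangleleft> a)"
    by (rule generic_eqI[of _ ?t]) (simp_all add: opr_defs mul_ac)
  ultimately have *: "bracket (a \<otimes>\<^sub>o w) (out w f) = out (a \<otimes>\<^sub>o w) (bracket w f) \<cdot> (?s \<triangleleft> a)"
    unfolding bracket_def by (subst out_hsub) (simp_all add: hsub_comp opr_def)
  have "has_order n (a \<otimes>\<^sub>o a \<otimes>\<^sub>o w) (out (a \<otimes>\<^sub>o w) (bracket w f))"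
    by (rule Suc.IH) (use Suc.prems in \<open>simp_all add: opr_bracket\<close>)
  then have "has_order n (src ?s) (out (a \<otimes>\<^sub>o w) (bracket w f) \<cdot> (?s \<triangleleft> a))"
    by (intro has_order_precomp[of "a \<otimes>\<^sub>o a \<otimes>\<^sub>o w"]) (simp_all add: opr_def)
  then show ?case
    by (simp add: *)
qed

text \<open>Same reason as for multiplication on the outside: a fixed multiplication inside the
  argument commutes with every commutator. Here the variables only have to be rebracketed.\<close>

lemma has_order_rgt: "opr w f \<Longrightarrow> has_order n w f \<Longrightarrow> has_order n (w \<otimes>\<^sub>o a) (rgt w f)"
proof (induction n arbitrary: w f)
  case 0
  then show ?case
    by (simp add: opr_def opr_defs)
next
  case (Suc n)
  note [simp] = oprD[OF Suc.prems(1)]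
  let ?s = "\<i>\<n>\<v> (\<alpha> a w a)"
  let ?t = "(var 0 a \<boxtimes> var 1 w \<boxtimes> var 2 a) \<boxtimes> var 3 a"
  have "lft (w \<otimes>\<^sub>o a) (rgt w f) = rgt (a \<otimes>\<^sub>o w) (lft w f) \<cdot> (?s \<triangleleft> a)"
    by (rule generic_eqI[of _ ?t]) (simp_all add: opr_defs mul_ac)
  moreover have "out (w \<otimes>\<^sub>o a) (rgt w f) = rgt (a \<otimes>\<^sub>o w) (out w f) \<cdot> (?s \<triangleleft> a)"
    by (rule generic_eqI[of _ ?t]) (simp_all add: opr_defs)
  ultimately have *: "bracket (w \<otimes>\<^sub>o a) (rgt w f) = rgt (a \<otimes>\<^sub>o w) (bracket w f) \<cdot> (?s \<triangleleft> a)"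
    unfolding bracket_def by (subst rgt_hsub) (simp_all add: hsub_comp opr_def)
  have "has_order n ((a \<otimes>\<^sub>o w) \<otimes>\<^sub>o a) (rgt (a \<otimes>\<^sub>o w) (bracket w f))"
    by (rule Suc.IH) (use Suc.prems in \<open>simp_all add: opr_bracket\<close>)
  then have "has_order n (src ?s) (rgt (a \<otimes>\<^sub>o w) (bracket w f) \<cdot> (?s \<triangleleft> a))"
    by (intro has_order_precomp[of "(a \<otimes>\<^sub>o w) \<otimes>\<^sub>o a"]) (simp_all add: opr_def)
  then show ?case
    by (simp add: *)
qed

end

section \<open>Monoids generated by an object\<close>

context sm_category
begin

text \<open>The arrow with \<open>t \<mapsto> s\<close>, for a generic \<open>t\<close>.\<close>

definition abst :: "(nat \<times> 'o) list \<times> 'm \<Rightarrow> (nat \<times> 'o) list \<times> 'm \<Rightarrow> 'm" where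
  "abst t s = snd s \<cdot> \<i>\<n>\<v> (snd t)"

lemma abst_simps:
  assumes "generic t" "is_term s" "fst t = fst s"
  shows "arr (abst t s)" "src (abst t s) = ty t" "tgt (abst t s) = ty s" "app (abst t s) t = s"
proof -
  have t: "is_term t" "iso_arrow C (snd t)"
    using assms(1) by (simp_all add: generic_def)
  with assms show "arr (abst t s)" "src (abst t s) = ty t" "tgt (abst t s) = ty s"
    by (simp_all add: abst_def is_term_def ty_def)
  show "app (abst t s) t = s"
    using t assms(2,3) by (cases s) (simp add: abst_def is_term_def app_def compA)
qed

text \<open>Computes the variable list of a concrete term, to discharge the premise
  \<open>fst t = fst s\<close> of \<open>abst_simps\<close>.\<close>

lemma fst_terms: "fst (t \<boxtimes> s) = merge (fst t) (fst s)" "fst (app f t) = fst t" "fst (var i y) = [(i, y)]"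
    "fst star = []"
  by (simp_all add: pair_def app_def var_def star_def)

lemma generic_star [simp]: "generic star"
  by (simp add: generic_def) (simp add: star_def)

lemma tpow_Ob [simp]: "x \<in> Ob C \<Longrightarrow> tpow C x n \<in> Ob C"
proof (induction n)
  case (Suc n)
  then show ?case
    by (cases n) simp_all
qed simp

lemma snoc_arr [simp]:
  assumes "x \<in> Ob C"
  shows "arr (snoc C x n)" "src (snoc C x n) = tpow C x n \<otimes>\<^sub>o x" "tgt (snoc C x n) = tpow C x (Suc n)"
    "iso_arrow C (snoc C x n)"
  using assms by (cases n; simp add: snoc_def)+

lemma tcat_arr [simp]:
  assumes "x \<in> Ob C"
  shows "iso_arrow C (tcat C x m n) \<and> arr (tcat C x m n)
    \<and> src (tcat C x m n) = tpow C x m \<otimes>\<^sub>o tpow C x n \<and> tgt (tcat C x m n) = tpow C x (m + n)"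
proof (induction n)
  case (Suc n)
  then show ?case
    using assms by (simp add: iso_arr)
qed (use assms in simp)

end

declare tpow.simps(3) [simp del]

text \<open>The setting common to both claims. \<open>E n\<close> multiplies out a word of length n
  in the generators. Joint epimorphy is required with an arbitrary parameter \<open>w\<close>
  tensored on, because operators carry parameters; it will be derived from cocompleteness.\<close>

locale generated_monoid = monoid_in R C A
  for R :: "('r, 'k) ring_scheme" and C :: "('r, 'o, 'm, 'z) sm_category_scheme" (structure)
    and A :: "('o, 'm, 'y) monoid_object_scheme" +
  fixes x :: 'o and E :: "nat \<Rightarrow> 'm"
  assumes x_Ob [simp]: "x \<in> Ob C"
    and E_Hom: "E n \<in> Hom C (tpow C x n) (und A)"
    and E_0: "E 0 = uni A"
    and E_Suc: "mul A \<cdot> (E n \<otimes>\<^sub>a E (Suc 0)) = E (Suc n) \<cdot> snoc C x n"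
    and E_epi: "\<lbrakk>w \<in> Ob C; f \<in> Hom C (w \<otimes>\<^sub>o und A) z; g \<in> Hom C (w \<otimes>\<^sub>o und A) z;
       \<And>n. f \<cdot> (w \<triangleright> E n) = g \<cdot> (w \<triangleright> E n)\<rbrakk> \<Longrightarrow> f = g"
begin

abbreviation X where "X n \<equiv> tpow C x n"
abbreviation E1 where "E1 \<equiv> E (Suc 0)"

lemma E_arr [simp]: "arr (E n)" "src (E n) = X n" "tgt (E n) = a"
  using E_Hom[of n] by (simp_all add: hom_iff)

lemma E_star [simp]: "app (E 0) star = unit_term"
  by (simp add: E_0 unit_term_def)

lemma app_E_snoc [simp]:
  assumes "is_term b" "is_term y" "ty b = X n" "ty y = x" "fv b \<inter> fv y = {}"
  shows "app (E (Suc n)) (app (snoc C x n) (b \<boxtimes> y)) = app \<mu> (app (E n) b \<boxtimes> app E1 y)"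
proof -
  have "app (E (Suc n)) (app (snoc C x n) (b \<boxtimes> y)) = app (E (Suc n) \<cdot> snoc C x n) (b \<boxtimes> y)"
    using assms by simp
  also have "\<dots> = app \<mu> (app (E n) b \<boxtimes> app E1 y)"
    unfolding E_Suc[symmetric] using assms by simp
  finally show ?thesis .
qed

lemma E_epi':
  assumes "\<And>n. f \<cdot> (w \<triangleright> E n) = g \<cdot> (w \<triangleright> E n)"
    "w \<in> Ob C" "arr f" "arr g" "src f = w \<otimes>\<^sub>o a" "src g = w \<otimes>\<^sub>o a" "tgt f = tgt g"
  shows "f = g"
  by (rule E_epi[of w f "tgt g" g]) (use assms in \<open>simp_all add: hom_iff\<close>)

text \<open>The factor \<open>a\<close> is moved to the last place along the isomorphism
  \<open>p\<close>, natural in that factor, where \<open>E_epi'\<close> applies.\<close>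

lemma E_epi_mid:
  assumes *: "\<And>n. f \<cdot> (w \<triangleright> (E n \<triangleleft> v)) = g \<cdot> (w \<triangleright> (E n \<triangleleft> v))"
    and [simp]: "w \<in> Ob C" "v \<in> Ob C" "arr f" "arr g" "src f = w \<otimes>\<^sub>o a \<otimes>\<^sub>o v" "src g = w \<otimes>\<^sub>o a \<otimes>\<^sub>o v" "tgt f = tgt g"
  shows "f = g"
proof -
  define p where "p = (\<lambda>b. (w \<triangleright> \<sigma> v b) \<cdot> \<alpha> w v b)"
  have p [simp]: "iso_arrow C (p b)" "arr (p b)" "src (p b) = (w \<otimes>\<^sub>o v) \<otimes>\<^sub>o b" "tgt (p b) = w \<otimes>\<^sub>o b \<otimes>\<^sub>o v"
    if "b \<in> Ob C" for b
    using that by (simp_all add: p_def)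
  have nat: "p a \<cdot> ((w \<otimes>\<^sub>o v) \<triangleright> E n) = (w \<triangleright> (E n \<triangleleft> v)) \<cdot> p (X n)" for n
    by (rule generic_eqI[of _ "(var 0 w \<boxtimes> var 1 v) \<boxtimes> var 2 (X n)"]) (simp_all, simp add: p_def)
  have "f \<cdot> p a = g \<cdot> p a"
  proof (rule E_epi'[where w = "w \<otimes>\<^sub>o v"])
    fix n
    have "(f \<cdot> (w \<triangleright> (E n \<triangleleft> v))) \<cdot> p (X n) = (g \<cdot> (w \<triangleright> (E n \<triangleleft> v))) \<cdot> p (X n)"
      by (simp only: *)
    then show "(f \<cdot> p a) \<cdot> ((w \<otimes>\<^sub>o v) \<triangleright> E n) = (g \<cdot> p a) \<cdot> ((w \<otimes>\<^sub>o v) \<triangleright> E n)"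
      by (simp add: compA nat)
  qed simp_all
  then show ?thesis
    by (rule iso_cancel_right) simp_all
qed

lemma E_epi_left:
  assumes *: "\<And>n. f \<cdot> ((E n \<triangleleft> w) \<triangleleft> v) = g \<cdot> ((E n \<triangleleft> w) \<triangleleft> v)"
    and [simp]: "w \<in> Ob C" "v \<in> Ob C" "arr f" "arr g" "src f = (a \<otimes>\<^sub>o w) \<otimes>\<^sub>o v" "src g = (a \<otimes>\<^sub>o w) \<otimes>\<^sub>o v" "tgt f = tgt g"
  shows "f = g"
proof -
  define p where "p = (\<lambda>b. (\<sigma> w b \<triangleleft> v) \<cdot> \<i>\<n>\<v> (\<alpha> w b v))"
  have p [simp]: "iso_arrow C (p b)" "arr (p b)" "src (p b) = w \<otimes>\<^sub>o b \<otimes>\<^sub>o v" "tgt (p b) = (b \<otimes>\<^sub>o w) \<otimes>\<^sub>o v"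
    if "b \<in> Ob C" for b
    using that by (simp_all add: p_def)
  have nat: "p a \<cdot> (w \<triangleright> (E n \<triangleleft> v)) = ((E n \<triangleleft> w) \<triangleleft> v) \<cdot> p (X n)" for n
    by (rule generic_eqI[of _ "var 0 w \<boxtimes> var 1 (X n) \<boxtimes> var 2 v"]) (simp_all, simp add: p_def)
  have "f \<cdot> p a = g \<cdot> p a"
  proof (rule E_epi_mid[where w = w and v = v])
    fix n
    have "(f \<cdot> ((E n \<triangleleft> w) \<triangleleft> v)) \<cdot> p (X n) = (g \<cdot> ((E n \<triangleleft> w) \<triangleleft> v)) \<cdot> p (X n)"
      by (simp only: *)
    then show "(f \<cdot> p a) \<cdot> (w \<triangleright> (E n \<triangleleft> v)) = (g \<cdot> p a) \<cdot> (w \<triangleright> (E n \<triangleleft> v))"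
      by (simp add: compA nat)
  qed simp_all
  then show ?thesis
    by (rule iso_cancel_right) simp_all
qed

text \<open>By induction, the commutator of \<open>f\<close> with a generator vanishes, so that \<open>f\<close> is linear over the
  whole of \<open>a\<close>.\<close>

lemma has_order_vanish:
  assumes "opr w f" "has_order m w f" "\<And>n. n < m \<Longrightarrow> f \<cdot> (w \<triangleright> E n) = zer (w \<otimes>\<^sub>o X n) a"
  shows "f = zer (w \<otimes>\<^sub>o a) a"
  using assms
proof (induction m arbitrary: w f)
  case (Suc m)
  note [simp] = oprD[OF Suc.prems(1)]
  let ?h = "E1 \<triangleleft> w"
  let ?f = "bracket w f \<cdot> (?h \<triangleleft> a)"
  \<comment> \<open>\<open>L\<close> and \<open>K\<close> are the two halves of the commutator with
    a generator y: f (p, y b) and y f (p, b).\<close>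
  define L where "L = lft w f \<cdot> (?h \<triangleleft> a)"
  define K where "K = out w f \<cdot> (?h \<triangleleft> a)"
  \<comment> \<open>Moves the generator behind the word, where \<open>E (Suc n)\<close> expects it;
    commutativity of \<open>a\<close> makes this harmless.\<close>
  define s where "s n = (w \<triangleright> snoc C x n) \<cdot> (w \<triangleright> \<sigma> x (X n)) \<cdot> \<alpha> w x (X n) \<cdot> (\<sigma> x w \<triangleleft> (X n))" for n
  have [simp]: "arr (s n)" "iso_arrow C (s n)" "src (s n) = (x \<otimes>\<^sub>o w) \<otimes>\<^sub>o X n" "tgt (s n) = w \<otimes>\<^sub>o X (Suc n)" for n
    by (simp_all add: s_def)
  have Ln: "L \<cdot> ((x \<otimes>\<^sub>o w) \<triangleright> E n) = (f \<cdot> (w \<triangleright> E (Suc n))) \<cdot> s n" for n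
    by (rule generic_eqI[of _ "(var 0 x \<boxtimes> var 1 w) \<boxtimes> var 2 (X n)"])
      (simp_all add: L_def opr_defs s_def mul_comm)
  have Kn: "K \<cdot> ((x \<otimes>\<^sub>o w) \<triangleright> E n) = \<mu> \<cdot> (E1 \<otimes>\<^sub>a (f \<cdot> (w \<triangleright> E n))) \<cdot> \<alpha> x w (X n)" for n
    by (rule generic_eqI[of _ "(var 0 x \<boxtimes> var 1 w) \<boxtimes> var 2 (X n)"]) (simp_all add: K_def opr_defs)
  have f: "?f = L \<boxminus> K"
    by (simp add: bracket_def hsub_comp L_def K_def)
  have "?f = zer ((x \<otimes>\<^sub>o w) \<otimes>\<^sub>o a) a"
  proof (rule Suc.IH)
    show "opr (x \<otimes>\<^sub>o w) ?f"
      by (simp add: opr_def)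
    have "has_order m (a \<otimes>\<^sub>o w) (bracket w f)"
      using Suc.prems by simp
    from has_order_precomp[OF opr_bracket[OF Suc.prems(1)] this, of ?h] show "has_order m (x \<otimes>\<^sub>o w) ?f"
      by simp
  next
    fix n assume "n < m"
    then have "f \<cdot> (w \<triangleright> E (Suc n)) = zer (w \<otimes>\<^sub>o X (Suc n)) a" "f \<cdot> (w \<triangleright> E n) = zer (w \<otimes>\<^sub>o X n) a"
      using Suc.prems(3) by simp_all
    then have "L \<cdot> ((x \<otimes>\<^sub>o w) \<triangleright> E n) = zer ((x \<otimes>\<^sub>o w) \<otimes>\<^sub>o X n) a" "K \<cdot> ((x \<otimes>\<^sub>o w) \<triangleright> E n) = zer ((x \<otimes>\<^sub>o w) \<otimes>\<^sub>o X n) a"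
      unfolding Ln Kn by simp_all
    then show "?f \<cdot> ((x \<otimes>\<^sub>o w) \<triangleright> E n) = zer ((x \<otimes>\<^sub>o w) \<otimes>\<^sub>o X n) a"
      unfolding f by (subst hsub_comp) (simp_all add: L_def K_def)
  qed
  \<comment> \<open>The equation says that f commutes with generators, so its values on words of
    length \<open>Suc n\<close> follow from those of length n.\<close>
  then have LK: "L = K"
    unfolding f by (rule hsub_eq_zer) (simp_all add: L_def K_def)
  have vanish: "f \<cdot> (w \<triangleright> E n) = zer (w \<otimes>\<^sub>o X n) a" for n
  proof (induction n)
    case 0
    \<comment> \<open>Only the empty word is needed to start, and it is covered because the bound is
      \<open>Suc m\<close> and not 0.\<close>
    then show ?case
      using Suc.prems(3) by simp
  next
    case (Suc n)
    have "(f \<cdot> (w \<triangleright> E (Suc n))) \<cdot> s n = zer (w \<otimes>\<^sub>o X (Suc n)) a \<cdot> s n"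
      unfolding Ln[symmetric] LK Kn Suc by simp
    then show ?case
      by (rule iso_cancel_right) simp_all
  qed
  show ?case
    by (rule E_epi'[where w = w]) (simp_all add: vanish)
qed simp

text \<open>For zero operators this is joint epimorphy. A bracket adds a new copy of
  \<open>a\<close> in front of the one to be tested on words, so the two copies are exchanged before
  the induction hypothesis applies and exchanged back afterwards.\<close>

lemma has_order_detect:
  assumes "opr (a \<otimes>\<^sub>o w) f" "w \<in> Ob C" "\<And>n. has_order m (X n \<otimes>\<^sub>o w) (f \<cdot> ((E n \<triangleleft> w) \<triangleleft> a))"
  shows "has_order m (a \<otimes>\<^sub>o w) f"
  using assms
proof (induction m arbitrary: w f)
  case 0
  then have [simp]: "w \<in> Ob C" "arr f" "src f = (a \<otimes>\<^sub>o w) \<otimes>\<^sub>o a" "tgt f = a"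
    by (simp_all add: opr_def)
  show ?case
    unfolding has_order.simps by (rule E_epi_left[of f w a]) (use 0 in simp_all)
next
  case (Suc m)
  then have [simp]: "w \<in> Ob C" "arr f" "src f = (a \<otimes>\<^sub>o w) \<otimes>\<^sub>o a" "tgt f = a"
    by (simp_all add: opr_def)
  define s where "s b = \<alpha> a b w \<cdot> (\<sigma> b a \<triangleleft> w) \<cdot> \<i>\<n>\<v> (\<alpha> b a w)" for b
  have s [simp]: "arr (s b)" "iso_arrow C (s b)" "src (s b) = b \<otimes>\<^sub>o a \<otimes>\<^sub>o w" "tgt (s b) = a \<otimes>\<^sub>o b \<otimes>\<^sub>o w" if "b \<in> Ob C" for b
    using that by (simp_all add: s_def)
  let ?T = "bracket (a \<otimes>\<^sub>o w) f"
  have T: "opr (a \<otimes>\<^sub>o a \<otimes>\<^sub>o w) ?T"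
    by (simp add: opr_def)
  have "has_order m (a \<otimes>\<^sub>o a \<otimes>\<^sub>o w) (?T \<cdot> (s a \<triangleleft> a))"
  proof (rule Suc.IH)
    fix n
    have "has_order m (a \<otimes>\<^sub>o X n \<otimes>\<^sub>o w) (bracket (src (E n \<triangleleft> w)) (f \<cdot> ((E n \<triangleleft> w) \<triangleleft> a)))"
      using Suc.prems(3)[of n] by simp
    then have "has_order m (a \<otimes>\<^sub>o X n \<otimes>\<^sub>o w) (?T \<cdot> ((a \<triangleright> (E n \<triangleleft> w)) \<triangleleft> a))"
      by (subst (asm) bracket_precomp[of "a \<otimes>\<^sub>o w"]) (use Suc.prems in simp_all)
    then have "has_order m (src (s (X n))) ((?T \<cdot> ((a \<triangleright> (E n \<triangleleft> w)) \<triangleleft> a)) \<cdot> (s (X n) \<triangleleft> a))"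
      by (intro has_order_precomp[of "a \<otimes>\<^sub>o X n \<otimes>\<^sub>o w"]) (simp_all add: opr_def)
    moreover have "(?T \<cdot> ((a \<triangleright> (E n \<triangleleft> w)) \<triangleleft> a)) \<cdot> (s (X n) \<triangleleft> a)
        = (?T \<cdot> (s a \<triangleleft> a)) \<cdot> ((E n \<triangleleft> (a \<otimes>\<^sub>o w)) \<triangleleft> a)"
      by (rule generic_eqI[of _ "(var 0 (X n) \<boxtimes> var 1 a \<boxtimes> var 2 w) \<boxtimes> var 3 a"]) (simp_all, simp add: s_def)
    ultimately show "has_order m (X n \<otimes>\<^sub>o a \<otimes>\<^sub>o w) ((?T \<cdot> (s a \<triangleleft> a)) \<cdot> ((E n \<triangleleft> (a \<otimes>\<^sub>o w)) \<triangleleft> a))"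
      by simp
  qed (simp_all add: opr_def)
  then have "has_order m (src (\<i>\<n>\<v> (s a))) ((?T \<cdot> (s a \<triangleleft> a)) \<cdot> (\<i>\<n>\<v> (s a) \<triangleleft> a))"
    by (intro has_order_precomp[of "a \<otimes>\<^sub>o a \<otimes>\<^sub>o w"]) (simp_all add: opr_def)
  then show ?case
    by (simp add: compA interchange)
qed

end

section \<open>Existence of operators on free monoids\<close>

context sm_category
begin

lemma tpow_2: "tpow C x (Suc (Suc 0)) = x \<otimes>\<^sub>o x"
  by (simp add: tpow.simps(3))

abbreviation swp where "swp n i x \<equiv> adjacent_swap C x n i"

text \<open>Conjugation by this arrow defines \<^const>\<open>adjacent_swap\<close>.\<close>

definition brk where
  "brk x i j = tcat C x (i + 2) j \<cdot> (tcat C x i 2 \<triangleleft> (tpow C x j))"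

lemma brk_arr [simp]:
  assumes "x \<in> Ob C"
  shows "iso_arrow C (brk x i j)" "arr (brk x i j)" "src (brk x i j) = (tpow C x i \<otimes>\<^sub>o x \<otimes>\<^sub>o x) \<otimes>\<^sub>o tpow C x j"
    "tgt (brk x i j) = tpow C x (Suc (Suc (i + j)))"
  using assms tcat_arr[of x "i + 2" j] tcat_arr[of x i 2] by (simp_all add: brk_def eval_nat_numeral tpow_2)

lemma swp_brk:
  "swp (Suc (Suc (i + j))) i x = brk x i j \<cdot> (((tpow C x i) \<triangleright> \<sigma> x x) \<triangleleft> (tpow C x j)) \<cdot> \<i>\<n>\<v> (brk x i j)"
  by (simp add: adjacent_swap_def Let_def brk_def)

lemma swp_arr [simp]:
  assumes "x \<in> Ob C" "Suc i < n"
  shows "iso_arrow C (swp n i x)" "arr (swp n i x)" "src (swp n i x) = tpow C x n" "tgt (swp n i x) = tpow C x n"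
proof -
  obtain j where n: "n = Suc (Suc (i + j))"
    using less_imp_Suc_add[OF assms(2)] by auto
  show "iso_arrow C (swp n i x)" "arr (swp n i x)" "src (swp n i x) = tpow C x n" "tgt (swp n i x) = tpow C x n"
    unfolding n swp_brk using assms by simp_all
qed

lemma app_tcat_Suc:
  assumes "x \<in> Ob C" "is_term b" "is_term c" "is_term y" "ty b = tpow C x m" "ty c = tpow C x n" "ty y = x"
    "fv b \<inter> fv c = {}" "fv b \<inter> fv y = {}" "fv c \<inter> fv y = {}"
  shows "app (tcat C x m (Suc n)) (b \<boxtimes> app (snoc C x n) (c \<boxtimes> y))
    = app (snoc C x (m + n)) (app (tcat C x m n) (b \<boxtimes> c) \<boxtimes> y)"
proof -
  have [simp]: "fv b \<inter> (fv c \<union> fv y) = {}" "(fv b \<union> fv c) \<inter> fv y = {}"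
    using assms by auto
  show ?thesis
    using assms by simp
qed

lemma app_tcat_1:
  assumes "x \<in> Ob C" "is_term b" "is_term y" "ty b = tpow C x m" "ty y = x" "fv b \<inter> fv y = {}"
  shows "app (tcat C x m (Suc 0)) (b \<boxtimes> y) = app (snoc C x m) (b \<boxtimes> y)"
  using app_tcat_Suc[of x b star y m 0] assms by (simp add: snoc_def[of C x 0])

lemma app_tcat_2:
  assumes "x \<in> Ob C" "is_term b" "is_term c" "is_term y" "ty b = tpow C x m" "ty c = x" "ty y = x"
    "fv b \<inter> fv c = {}" "fv b \<inter> fv y = {}" "fv c \<inter> fv y = {}"
  shows "app (tcat C x m 2) (b \<boxtimes> c \<boxtimes> y)
    = app (snoc C x (Suc m)) (app (snoc C x m) (b \<boxtimes> c) \<boxtimes> y)"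
  using app_tcat_Suc[of x b c y m "Suc 0"] assms app_tcat_1[of x b c m]
  by (simp add: snoc_def[of C x "Suc 0"] tpow_2 eval_nat_numeral)

lemma app_brk:
  assumes "x \<in> Ob C" "is_term b" "is_term y" "is_term z" "is_term c" "ty b = tpow C x i" "ty y = x" "ty z = x" "ty c = tpow C x j"
    "fv b \<inter> fv y = {}" "fv b \<inter> fv z = {}" "fv b \<inter> fv c = {}" "fv y \<inter> fv z = {}" "fv y \<inter> fv c = {}" "fv z \<inter> fv c = {}"
  shows "app (brk x i j) ((b \<boxtimes> y \<boxtimes> z) \<boxtimes> c) = app (tcat C x (Suc (Suc i)) j)
      (app (snoc C x (Suc i)) (app (snoc C x i) (b \<boxtimes> y) \<boxtimes> z) \<boxtimes> c)"
proof -
  have [simp]: "fv b \<inter> (fv y \<union> fv z) = {}" "(fv b \<union> (fv y \<union> fv z)) \<inter> fv c = {}"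
    using assms by auto
  have [simp]: "src (tcat C x i 2) = tpow C x i \<otimes>\<^sub>o x \<otimes>\<^sub>o x" "tgt (tcat C x i 2) = tpow C x (Suc (Suc i))"
    "arr (tcat C x i 2)"
    using assms tcat_arr[of x i 2] by (simp_all add: eval_nat_numeral tpow_2)
  show ?thesis
    using assms tcat_arr[of x "i + 2" j] by (simp add: brk_def app_tcat_2)
qed

lemma app_swp:
  assumes "x \<in> Ob C" "is_term b" "is_term y" "is_term z" "is_term c" "ty b = tpow C x i" "ty y = x" "ty z = x" "ty c = tpow C x j"
    "fv b \<inter> fv y = {}" "fv b \<inter> fv z = {}" "fv b \<inter> fv c = {}" "fv y \<inter> fv z = {}" "fv y \<inter> fv c = {}" "fv z \<inter> fv c = {}"
  shows "app (swp (Suc (Suc (i + j))) i x) (app (brk x i j) ((b \<boxtimes> y \<boxtimes> z) \<boxtimes> c))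
    = app (brk x i j) ((b \<boxtimes> z \<boxtimes> y) \<boxtimes> c)"
proof -
  have [simp]: "fv b \<inter> (fv y \<union> fv z) = {}" "(fv b \<union> (fv y \<union> fv z)) \<inter> fv c = {}"
    "fv z \<inter> fv y = {}" "fv b \<inter> (fv z \<union> fv y) = {}" "(fv b \<union> (fv z \<union> fv y)) \<inter> fv c = {}"
    using assms by auto
  show ?thesis
    unfolding swp_brk using assms by simp
qed

text \<open>Operators will be built by appending generators one at a time. This lemma and the next
  describe adjacent swaps recursively in the same way: a swap among the earlier factors passes
  through the last one, and a swap of the last two is the plain symmetry.\<close>

lemma swp_snoc:
  assumes x [simp]: "x \<in> Ob C" and i: "Suc i < n"
  shows "swp (Suc n) i x \<cdot> snoc C x n = snoc C x n \<cdot> (swp n i x \<triangleleft> x)"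
proof -
  obtain j where n: "n = Suc (Suc (i + j))"
    using less_imp_Suc_add[OF i] by auto
  let ?b = "var 0 (tpow C x i)" and ?y = "var 1 x" and ?z = "var 2 x" and ?c = "var 3 (tpow C x j)" and ?u = "var 4 x"
  \<comment> \<open>Both orders of the swapped factors are covered, since the equation is used once
    before the swap and once after it.\<close>
  have e: "app (snoc C x n) (app (brk x i j) ((?b \<boxtimes> p \<boxtimes> q) \<boxtimes> ?c) \<boxtimes> ?u)
      = app (brk x i (Suc j)) ((?b \<boxtimes> p \<boxtimes> q) \<boxtimes> app (snoc C x j) (?c \<boxtimes> ?u))"
    if "p = ?y \<and> q = ?z \<or> p = ?z \<and> q = ?y" for p q
    using that app_tcat_Suc[of x _ ?c ?u "Suc (Suc i)" j]
    by (elim disjE) (simp_all add: app_brk n)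
  show ?thesis
  proof (rule generic_eqI[of _ "app (brk x i j) ((?b \<boxtimes> ?y \<boxtimes> ?z) \<boxtimes> ?c) \<boxtimes> ?u"])
    have "app (swp (Suc n) i x \<cdot> snoc C x n) (app (brk x i j) ((?b \<boxtimes> ?y \<boxtimes> ?z) \<boxtimes> ?c) \<boxtimes> ?u)
      = app (swp (Suc n) i x) (app (brk x i (Suc j)) ((?b \<boxtimes> ?y \<boxtimes> ?z) \<boxtimes> app (snoc C x j) (?c \<boxtimes> ?u)))"
      by (subst e[symmetric]) (use i in \<open>simp_all add: n\<close>)
    also have "\<dots> = app (brk x i (Suc j)) ((?b \<boxtimes> ?z \<boxtimes> ?y) \<boxtimes> app (snoc C x j) (?c \<boxtimes> ?u))"
      using app_swp[of x ?b ?y ?z "app (snoc C x j) (?c \<boxtimes> ?u)" i "Suc j"] by (simp add: n)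
    also have "\<dots> = app (snoc C x n) (app (brk x i j) ((?b \<boxtimes> ?z \<boxtimes> ?y) \<boxtimes> ?c) \<boxtimes> ?u)"
      by (subst e) simp_all
    also have "\<dots> = app (snoc C x n \<cdot> (swp n i x \<triangleleft> x)) (app (brk x i j) ((?b \<boxtimes> ?y \<boxtimes> ?z) \<boxtimes> ?c) \<boxtimes> ?u)"
      using i app_swp[of x ?b ?y ?z ?c i j] by (simp add: n)
    finally show "app (swp (Suc n) i x \<cdot> snoc C x n) (app (brk x i j) ((?b \<boxtimes> ?y \<boxtimes> ?z) \<boxtimes> ?c) \<boxtimes> ?u)
      = app (snoc C x n \<cdot> (swp n i x \<triangleleft> x)) (app (brk x i j) ((?b \<boxtimes> ?y \<boxtimes> ?z) \<boxtimes> ?c) \<boxtimes> ?u)" .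
  qed (use i in \<open>simp_all add: n\<close>)
qed

lemma swp_snoc_last:
  assumes x [simp]: "x \<in> Ob C"
  shows "swp (Suc (Suc n)) n x \<cdot> snoc C x (Suc n) \<cdot> (snoc C x n \<triangleleft> x)
    = snoc C x (Suc n) \<cdot> (snoc C x n \<triangleleft> x) \<cdot> \<i>\<n>\<v> (\<alpha> (tpow C x n) x x) \<cdot> ((tpow C x n) \<triangleright> \<sigma> x x) \<cdot> \<alpha> (tpow C x n) x x"
proof (rule generic_eqI[of _ "(var 0 (tpow C x n) \<boxtimes> var 1 x) \<boxtimes> var 2 x"])
  show "app (swp (Suc (Suc n)) n x \<cdot> snoc C x (Suc n) \<cdot> (snoc C x n \<triangleleft> x)) ((var 0 (tpow C x n) \<boxtimes> var 1 x) \<boxtimes> var 2 x)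
    = app (snoc C x (Suc n) \<cdot> (snoc C x n \<triangleleft> x) \<cdot> \<i>\<n>\<v> (\<alpha> (tpow C x n) x x) \<cdot> ((tpow C x n) \<triangleright> \<sigma> x x) \<cdot> \<alpha> (tpow C x n) x x)
       ((var 0 (tpow C x n) \<boxtimes> var 1 x) \<boxtimes> var 2 x)"
    \<comment> \<open>Nothing follows the last two factors, so the rest of the word is
      \<open>star\<close>, of length 0.\<close>
    using app_swp[of x "var 0 (tpow C x n)" "var 1 x" "var 2 x" star n 0] by (simp add: app_brk)
qed simp_all

end

text \<open>Adds the universal property: families on words that are symmetric extend to w \<otimes>
  a. Symmetry is expressed through adjacent swaps alone, as these generate the symmetric
  groups.\<close>

locale free_monoid = generated_monoid R C A x E
  for R :: "('r, 'k) ring_scheme" and C :: "('r, 'o, 'm, 'z) sm_category_scheme" (structure)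
    and A :: "('o, 'm, 'y) monoid_object_scheme" and x and E +
  assumes E_swap: "Suc i < n \<Longrightarrow> E n \<cdot> adjacent_swap C x n i = E n"
    and E_univ: "\<lbrakk>w \<in> Ob C; z \<in> Ob C; \<And>n. r n \<in> Hom C (w \<otimes>\<^sub>o tpow C x n) z;
       \<And>n i. Suc i < n \<Longrightarrow> r n \<cdot> (w \<triangleright> adjacent_swap C x n i) = r n\<rbrakk>
      \<Longrightarrow> \<exists>h \<in> Hom C (w \<otimes>\<^sub>o und A) z. \<forall>n. h \<cdot> (w \<triangleright> E n) = r n"

section \<open>The recursion on words\<close>

context free_monoid
begin

text \<open>On elements, \<open>step w b g\<close> is \<open>((p, c), (v, y)) \<mapsto> g ((p, c), v) y + g ((p, c y), v)\<close>. Iterating it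
  expands \<open>\<Delta> (v y) = \<Delta> v y + [\<Delta>, y] v\<close>, where the accumulator \<open>c\<close> collects the generators with
  which the operator has been commuted.\<close>

definition right_mul where
  "right_mul v b g = \<mu> \<cdot> (g \<otimes>\<^sub>a E1) \<cdot> \<i>\<n>\<v> (\<alpha> v b x)"

definition absorb where
  "absorb w b = ((w \<triangleright> (\<mu> \<cdot> (a \<triangleright> E1))) \<triangleleft> b) \<cdot> (\<alpha> w a x \<triangleleft> b)
     \<cdot> \<i>\<n>\<v> (\<alpha> (w \<otimes>\<^sub>o a) x b) \<cdot> ((w \<otimes>\<^sub>o a) \<triangleright> \<sigma> b x)"

definition step where
  "step w b g = right_mul (w \<otimes>\<^sub>o a) b g \<boxplus> g \<cdot> absorb w b"

lemma right_mul_arr [simp]: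
  assumes "v \<in> Ob C" "b \<in> Ob C" "arr g" "src g = v \<otimes>\<^sub>o b" "tgt g = a"
  shows "arr (right_mul v b g)" "src (right_mul v b g) = v \<otimes>\<^sub>o b \<otimes>\<^sub>o x" "tgt (right_mul v b g) = a"
  using assms by (simp_all add: right_mul_def)

lemma app_right_mul [simp]:
  assumes "arr g" "src g = v \<otimes>\<^sub>o b" "tgt g = a" "is_term p" "is_term t" "is_term y" "ty p = v" "ty t = b" "ty y = x"
    "fv p \<inter> fv t = {}" "fv p \<inter> fv y = {}" "fv t \<inter> fv y = {}"
  shows "app (right_mul v b g) (p \<boxtimes> t \<boxtimes> y) = app \<mu> (app g (p \<boxtimes> t) \<boxtimes> app E1 y)"
proof -
  have [simp]: "fv p \<inter> (fv t \<union> fv y) = {}" "(fv p \<union> fv t) \<inter> fv y = {}" "v \<in> Ob C" "b \<in> Ob C"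
    using assms by auto
  show ?thesis
    using assms by (simp add: right_mul_def)
qed

lemma absorb_arr [simp]:
  assumes "w \<in> Ob C" "b \<in> Ob C"
  shows "arr (absorb w b)" "src (absorb w b) = (w \<otimes>\<^sub>o a) \<otimes>\<^sub>o b \<otimes>\<^sub>o x" "tgt (absorb w b) = (w \<otimes>\<^sub>o a) \<otimes>\<^sub>o b"
  using assms by (simp_all add: absorb_def)

lemma app_absorb [simp]:
  assumes "is_term p" "is_term c" "is_term t" "is_term y" "ty p = w" "ty c = a" "ty t = b" "ty y = x"
    "fv p \<inter> fv c = {}" "fv p \<inter> fv t = {}" "fv p \<inter> fv y = {}" "fv c \<inter> fv t = {}" "fv c \<inter> fv y = {}" "fv t \<inter> fv y = {}"
  shows "app (absorb w b) ((p \<boxtimes> c) \<boxtimes> t \<boxtimes> y) = (p \<boxtimes> app \<mu> (c \<boxtimes> app E1 y)) \<boxtimes> t"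
proof -
  have [simp]: "(fv p \<union> fv c) \<inter> (fv t \<union> fv y) = {}" "(fv p \<union> fv c) \<inter> fv t = {}" "(fv p \<union> fv c) \<inter> fv y = {}"
    "(fv p \<union> fv c) \<inter> (fv y \<union> fv t) = {}" "fv y \<inter> fv t = {}" "((fv p \<union> fv c) \<union> fv y) \<inter> fv t = {}"
    "fv p \<inter> (fv c \<union> fv y) = {}" "(fv p \<union> (fv c \<union> fv y)) \<inter> fv t = {}" "w \<in> Ob C" "b \<in> Ob C"
    using assms by auto
  show ?thesis
    using assms by (simp add: absorb_def)
qed

lemma step_arr [simp]:
  assumes "w \<in> Ob C" "b \<in> Ob C" "arr g" "src g = (w \<otimes>\<^sub>o a) \<otimes>\<^sub>o b" "tgt g = a"
  shows "arr (step w b g)" "src (step w b g) = (w \<otimes>\<^sub>o a) \<otimes>\<^sub>o b \<otimes>\<^sub>o x" "tgt (step w b g) = a"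
  using assms by (simp_all add: step_def)

lemma step_nat:
  assumes [simp]: "w \<in> Ob C" "arr h" "arr g" "src g = (w \<otimes>\<^sub>o a) \<otimes>\<^sub>o tgt h" "tgt g = a"
  shows "step w (tgt h) g \<cdot> ((w \<otimes>\<^sub>o a) \<triangleright> (h \<triangleleft> x)) = step w (src h) (g \<cdot> ((w \<otimes>\<^sub>o a) \<triangleright> h))"
proof -
  let ?t = "(var 0 w \<boxtimes> var 1 a) \<boxtimes> var 2 (src h) \<boxtimes> var 3 x"
  have "right_mul (w \<otimes>\<^sub>o a) (tgt h) g \<cdot> ((w \<otimes>\<^sub>o a) \<triangleright> (h \<triangleleft> x)) = right_mul (w \<otimes>\<^sub>o a) (src h) (g \<cdot> ((w \<otimes>\<^sub>o a) \<triangleright> h))"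
    by (rule generic_eqI[of _ ?t]) simp_all
  moreover have "(g \<cdot> absorb w (tgt h)) \<cdot> ((w \<otimes>\<^sub>o a) \<triangleright> (h \<triangleleft> x)) = (g \<cdot> ((w \<otimes>\<^sub>o a) \<triangleright> h)) \<cdot> absorb w (src h)"
    by (rule generic_eqI[of _ ?t]) simp_all
  ultimately show ?thesis
    by (simp add: step_def hadd_comp)
qed

text \<open>Appending y and then z gives four terms, g (c, v) y z + g (c y, v) z + g (c z, v) y + g
  (c z y, v). Exchanging y and z swaps the two middle ones and, by commutativity, fixes the others.
  This is why the recursion descends to symmetric powers.\<close>

lemma step_swap:
  assumes [simp]: "w \<in> Ob C" "b \<in> Ob C" "arr g" "src g = (w \<otimes>\<^sub>o a) \<otimes>\<^sub>o b" "tgt g = a"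
  shows "step w (b \<otimes>\<^sub>o x) (step w b g) \<cdot> ((w \<otimes>\<^sub>o a) \<triangleright> (\<i>\<n>\<v> (\<alpha> b x x) \<cdot> (b \<triangleright> \<sigma> x x) \<cdot> \<alpha> b x x))
    = step w (b \<otimes>\<^sub>o x) (step w b g)"
proof -
  let ?s = "(w \<otimes>\<^sub>o a) \<triangleright> (\<i>\<n>\<v> (\<alpha> b x x) \<cdot> (b \<triangleright> \<sigma> x x) \<cdot> \<alpha> b x x)"
  let ?t = "(var 0 w \<boxtimes> var 1 a) \<boxtimes> (var 2 b \<boxtimes> var 3 x) \<boxtimes> var 4 x"
  let ?m = "right_mul (w \<otimes>\<^sub>o a) b g" and ?r = "g \<cdot> absorb w b"
  define M where "M = right_mul (w \<otimes>\<^sub>o a) (b \<otimes>\<^sub>o x)"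
  define r where "r = absorb w (b \<otimes>\<^sub>o x)"
  have M: "M (f \<boxplus> g) = M f \<boxplus> M g"
    if "arr f" "arr g" "src f = (w \<otimes>\<^sub>o a) \<otimes>\<^sub>o b \<otimes>\<^sub>o x" "src g = (w \<otimes>\<^sub>o a) \<otimes>\<^sub>o b \<otimes>\<^sub>o x" "tgt f = a" "tgt g = a" for f g
    using that by (simp add: M_def right_mul_def comp_hadd hadd_comp hadd_tens)
  have arr: "arr (M f)" "src (M f) = (w \<otimes>\<^sub>o a) \<otimes>\<^sub>o (b \<otimes>\<^sub>o x) \<otimes>\<^sub>o x" "tgt (M f) = a"
    if "arr f" "src f = (w \<otimes>\<^sub>o a) \<otimes>\<^sub>o b \<otimes>\<^sub>o x" "tgt f = a" for f
    using that by (simp_all add: M_def)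
  have r: "arr r" "src r = (w \<otimes>\<^sub>o a) \<otimes>\<^sub>o (b \<otimes>\<^sub>o x) \<otimes>\<^sub>o x" "tgt r = (w \<otimes>\<^sub>o a) \<otimes>\<^sub>o b \<otimes>\<^sub>o x"
    by (simp_all add: r_def)
  have e: "step w (b \<otimes>\<^sub>o x) (step w b g) = (M ?m \<boxplus> M ?r) \<boxplus> (?m \<cdot> r \<boxplus> ?r \<cdot> r)"
    unfolding step_def M_def[symmetric] r_def[symmetric] by (simp add: M hadd_comp r)
  have mm: "M ?m \<cdot> ?s = M ?m"
    by (rule generic_eqI[of _ ?t]) (simp_all add: M_def mul_ac)
  \<comment> \<open>This equation and the next one exchange the two mixed terms.\<close>
  have mr: "M ?r \<cdot> ?s = ?m \<cdot> r"
    by (rule generic_eqI[of _ ?t]) (simp_all add: M_def r_def mul_ac)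
  have rm: "(?m \<cdot> r) \<cdot> ?s = M ?r"
    by (rule generic_eqI[of _ ?t]) (simp_all add: M_def r_def mul_ac)
  have rr: "(?r \<cdot> r) \<cdot> ?s = ?r \<cdot> r"
    by (rule generic_eqI[of _ ?t]) (simp_all add: M_def r_def mul_ac)
  define K where "K = ?s"
  have K: "arr K" "tgt K = (w \<otimes>\<^sub>o a) \<otimes>\<^sub>o (b \<otimes>\<^sub>o x) \<otimes>\<^sub>o x" "src K = (w \<otimes>\<^sub>o a) \<otimes>\<^sub>o (b \<otimes>\<^sub>o x) \<otimes>\<^sub>o x"
    by (simp_all add: K_def)
  have "step w (b \<otimes>\<^sub>o x) (step w b g) \<cdot> K = (M ?m \<cdot> K \<boxplus> M ?r \<cdot> K) \<boxplus> ((?m \<cdot> r) \<cdot> K \<boxplus> (?r \<cdot> r) \<cdot> K)"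
    unfolding e by (simp add: hadd_comp K arr r)
  also have "\<dots> = (M ?m \<boxplus> ?m \<cdot> r) \<boxplus> (M ?r \<boxplus> ?r \<cdot> r)"
    unfolding K_def mm mr rm rr ..
  also have "\<dots> = step w (b \<otimes>\<^sub>o x) (step w b g)"
    unfolding e by (simp add: hadd_assoc hadd_left_comm arr r)
  finally show ?thesis
    unfolding K_def .
qed

text \<open>Unfolded, the value at ((p, c), y_1 ... y_n) is the sum over all subsets I of \<phi> (p,
  c y_I) times the product of the letters outside I: each letter is either multiplied onto the
  result or absorbed into the accumulator c.\<close>

primrec G where
  "G w \<phi> 0 = \<phi> \<cdot> \<r> (w \<otimes>\<^sub>o a)"
| "G w \<phi> (Suc n) = step w (X n) (G w \<phi> n) \<cdot> ((w \<otimes>\<^sub>o a) \<triangleright> \<i>\<n>\<v> (snoc C x n))"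

lemma G_arr [simp]:
  assumes "w \<in> Ob C" "arr \<phi>" "src \<phi> = w \<otimes>\<^sub>o a" "tgt \<phi> = a"
  shows "arr (G w \<phi> n)" "src (G w \<phi> n) = (w \<otimes>\<^sub>o a) \<otimes>\<^sub>o X n" "tgt (G w \<phi> n) = a"
proof -
  have "arr (G w \<phi> n) \<and> src (G w \<phi> n) = (w \<otimes>\<^sub>o a) \<otimes>\<^sub>o X n \<and> tgt (G w \<phi> n) = a"
    using assms by (induction n) simp_all
  then show "arr (G w \<phi> n)" "src (G w \<phi> n) = (w \<otimes>\<^sub>o a) \<otimes>\<^sub>o X n" "tgt (G w \<phi> n) = a"
    by simp_all
qed

lemma G_snoc:
  assumes "opr w \<phi>"
  shows "G w \<phi> (Suc n) \<cdot> ((w \<otimes>\<^sub>o a) \<triangleright> snoc C x n) = step w (X n) (G w \<phi> n)"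
  using assms by (simp add: opr_def compA interchange)

text \<open>A swap among earlier letters passes through the last step by naturality; a swap of the
  last two letters is absorbed by \<open>step_swap\<close>.\<close>

lemma G_swap:
  assumes \<phi>: "opr w \<phi>" and "Suc i < n"
  shows "G w \<phi> n \<cdot> ((w \<otimes>\<^sub>o a) \<triangleright> swp n i x) = G w \<phi> n"
  using assms(2)
proof (induction n)
  case (Suc n)
  note [simp] = oprD[OF \<phi>]
  let ?W = "\<i>\<d> (w \<otimes>\<^sub>o a)"
  note G = G_snoc[OF \<phi>]
  show ?case
  proof (cases "Suc i = n")
    case False
    with Suc have i: "Suc i < n"
      by simp
    have "(G w \<phi> (Suc n) \<cdot> (?W \<otimes>\<^sub>a swp (Suc n) i x)) \<cdot> (?W \<otimes>\<^sub>a snoc C x n)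
        = G w \<phi> (Suc n) \<cdot> (?W \<otimes>\<^sub>a (swp (Suc n) i x \<cdot> snoc C x n))"
      using Suc.prems by (simp add: compA interchange del: G.simps)
    also have "\<dots> = (G w \<phi> (Suc n) \<cdot> (?W \<otimes>\<^sub>a snoc C x n)) \<cdot> (?W \<otimes>\<^sub>a (swp n i x \<triangleleft> x))"
      unfolding swp_snoc[OF x_Ob i] using i by (simp add: compA interchange del: G.simps)
    also have "\<dots> = step w (X n) (G w \<phi> n \<cdot> (?W \<otimes>\<^sub>a swp n i x))"
      unfolding G using step_nat[of w "swp n i x" "G w \<phi> n"] i by simp
    also have "\<dots> = G w \<phi> (Suc n) \<cdot> (?W \<otimes>\<^sub>a snoc C x n)"
      unfolding G Suc.IH[OF i] ..
    finally show ?thesis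
      by (rule iso_cancel_right) (use Suc.prems in \<open>simp_all del: G.simps\<close>)
  next
    case True
    let ?n = "Suc (Suc i)"
    let ?s = "snoc C x (Suc i) \<cdot> (snoc C x i \<triangleleft> x)"
    let ?b = "\<i>\<n>\<v> (\<alpha> (X i) x x) \<cdot> ((X i) \<triangleright> \<sigma> x x) \<cdot> \<alpha> (X i) x x"
    have *: "G w \<phi> ?n \<cdot> (?W \<otimes>\<^sub>a ?s) = step w (X i \<otimes>\<^sub>o x) (step w (X i) (G w \<phi> i))"
    proof -
      have "G w \<phi> ?n \<cdot> (?W \<otimes>\<^sub>a ?s) = (G w \<phi> ?n \<cdot> (?W \<otimes>\<^sub>a snoc C x (Suc i))) \<cdot> (?W \<otimes>\<^sub>a (snoc C x i \<triangleleft> x))"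
        by (simp add: compA interchange del: G.simps)
      also have "\<dots> = step w (X i \<otimes>\<^sub>o x) (G w \<phi> (Suc i) \<cdot> (?W \<otimes>\<^sub>a snoc C x i))"
        unfolding G[of "Suc i"] using step_nat[of w "snoc C x i" "G w \<phi> (Suc i)"] by (simp del: G.simps)
      finally show ?thesis
        unfolding G .
    qed
    have "(G w \<phi> ?n \<cdot> (?W \<otimes>\<^sub>a swp ?n i x)) \<cdot> (?W \<otimes>\<^sub>a ?s)
        = G w \<phi> ?n \<cdot> (?W \<otimes>\<^sub>a (swp ?n i x \<cdot> snoc C x (Suc i) \<cdot> (snoc C x i \<triangleleft> x)))"
      by (simp add: compA interchange del: G.simps)
    also have "\<dots> = (G w \<phi> ?n \<cdot> (?W \<otimes>\<^sub>a ?s)) \<cdot> (?W \<otimes>\<^sub>a ?b)"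
      unfolding swp_snoc_last[OF x_Ob] by (simp add: compA interchange del: G.simps)
    also have "\<dots> = G w \<phi> ?n \<cdot> (?W \<otimes>\<^sub>a ?s)"
      unfolding * by (rule step_swap) simp_all
    finally have "G w \<phi> ?n \<cdot> (?W \<otimes>\<^sub>a swp ?n i x) = G w \<phi> ?n"
      by (rule iso_cancel_right) (simp_all del: G.simps)
    then show ?thesis
      using True by simp
  qed
qed simp

text \<open>The recursion with the accumulator restricted to words of length j. Its second summand
  has an accumulator of length \<open>Suc j\<close>, so degrees can be tracked by induction on n
  with j varying.\<close>

lemma G_snoc_E:
  assumes \<phi>: "opr w \<phi>"
  shows "(G w \<phi> (Suc n) \<cdot> ((w \<triangleright> E j) \<triangleleft> (X (Suc n)))) \<cdot> ((w \<otimes>\<^sub>o X j) \<triangleright> snoc C x n)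
    = right_mul (w \<otimes>\<^sub>o X j) (X n) (G w \<phi> n \<cdot> ((w \<triangleright> E j) \<triangleleft> (X n)))
      \<boxplus> (G w \<phi> n \<cdot> ((w \<triangleright> E (Suc j)) \<triangleleft> (X n)))
        \<cdot> ((w \<triangleright> snoc C x j) \<triangleleft> (X n)) \<cdot> (\<alpha> w (X j) x \<triangleleft> (X n))
        \<cdot> \<i>\<n>\<v> (\<alpha> (w \<otimes>\<^sub>o X j) x (X n)) \<cdot> ((w \<otimes>\<^sub>o X j) \<triangleright> \<sigma> (X n) x)"
proof -
  note [simp] = oprD[OF \<phi>]
  let ?t = "(var 0 w \<boxtimes> var 1 (X j)) \<boxtimes> var 2 (X n) \<boxtimes> var 3 x"
  let ?e = "(w \<triangleright> E j) \<triangleleft> (X n \<otimes>\<^sub>o x)"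
  have "(G w \<phi> (Suc n) \<cdot> ((w \<triangleright> E j) \<triangleleft> (X (Suc n)))) \<cdot> ((w \<otimes>\<^sub>o X j) \<triangleright> snoc C x n)
     = (G w \<phi> (Suc n) \<cdot> ((w \<otimes>\<^sub>o a) \<triangleright> snoc C x n)) \<cdot> ?e"
    by (simp add: compA interchange del: G.simps)
  also have "\<dots> = right_mul (w \<otimes>\<^sub>o a) (X n) (G w \<phi> n) \<cdot> ?e \<boxplus> (G w \<phi> n \<cdot> absorb w (X n)) \<cdot> ?e"
    unfolding G_snoc[OF \<phi>] step_def by (simp add: hadd_comp)
  also have "right_mul (w \<otimes>\<^sub>o a) (X n) (G w \<phi> n) \<cdot> ?e = right_mul (w \<otimes>\<^sub>o X j) (X n) (G w \<phi> n \<cdot> ((w \<triangleright> E j) \<triangleleft> (X n)))"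
    by (rule generic_eqI[of _ ?t]) (simp_all flip: tens_id)
  also have "(G w \<phi> n \<cdot> absorb w (X n)) \<cdot> ?e = (G w \<phi> n \<cdot> ((w \<triangleright> E (Suc j)) \<triangleleft> (X n)))
        \<cdot> ((w \<triangleright> snoc C x j) \<triangleleft> (X n)) \<cdot> (\<alpha> w (X j) x \<triangleleft> (X n))
        \<cdot> \<i>\<n>\<v> (\<alpha> (w \<otimes>\<^sub>o X j) x (X n)) \<cdot> ((w \<otimes>\<^sub>o X j) \<triangleright> \<sigma> (X n) x)"
    by (rule generic_eqI[of _ ?t]) (simp_all flip: tens_id)
  finally show ?thesis .
qed

text \<open>The products c y_I have degrees from j to j + n, and \<phi> vanishes in all of
  them.\<close>

lemma G_zero:
  assumes \<phi>: "opr w \<phi>" and "\<And>i. j \<le> i \<Longrightarrow> i \<le> j + n \<Longrightarrow> \<phi> \<cdot> (w \<triangleright> E i) = zer (w \<otimes>\<^sub>o X i) a"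
  shows "G w \<phi> n \<cdot> ((w \<triangleright> E j) \<triangleleft> (X n)) = zer ((w \<otimes>\<^sub>o X j) \<otimes>\<^sub>o X n) a"
  using assms(2)
proof (induction n arbitrary: j)
  case 0
  note [simp] = oprD[OF \<phi>]
  have "G w \<phi> 0 \<cdot> ((w \<triangleright> E j) \<triangleleft> (X 0)) = (\<phi> \<cdot> (w \<triangleright> E j)) \<cdot> \<r> (w \<otimes>\<^sub>o X j)"
    by (rule generic_eqI[of _ "(var 0 w \<boxtimes> var 1 (X j)) \<boxtimes> star"]) simp_all
  then show ?case
    using 0[of j] by simp
next
  case (Suc n)
  note [simp] = oprD[OF \<phi>]
  have "G w \<phi> n \<cdot> ((w \<triangleright> E j) \<triangleleft> (X n)) = zer ((w \<otimes>\<^sub>o X j) \<otimes>\<^sub>o X n) a"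
    "G w \<phi> n \<cdot> ((w \<triangleright> E (Suc j)) \<triangleleft> (X n)) = zer ((w \<otimes>\<^sub>o X (Suc j)) \<otimes>\<^sub>o X n) a"
    by (rule Suc.IH; use Suc.prems in simp)+
  then have "(G w \<phi> (Suc n) \<cdot> ((w \<triangleright> E j) \<triangleleft> (X (Suc n)))) \<cdot> ((w \<otimes>\<^sub>o X j) \<triangleright> snoc C x n)
     = zer ((w \<otimes>\<^sub>o X j) \<otimes>\<^sub>o X (Suc n)) a \<cdot> ((w \<otimes>\<^sub>o X j) \<triangleright> snoc C x n)"
    unfolding G_snoc_E[OF \<phi>] by (simp add: right_mul_def)
  then show ?case
    by (rule iso_cancel_right) (simp_all del: G.simps)
qed

text \<open>If \<phi> vanishes below degree j + n, only the full subset survives, so every letter is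
  absorbed. In the recursion the first summand is zero by \<open>G_zero\<close>.\<close>

lemma G_top:
  assumes \<phi>: "opr w \<phi>" and "\<And>i. i < j + n \<Longrightarrow> \<phi> \<cdot> (w \<triangleright> E i) = zer (w \<otimes>\<^sub>o X i) a"
  shows "G w \<phi> n \<cdot> ((w \<triangleright> E j) \<triangleleft> (X n))
      = \<phi> \<cdot> (w \<triangleright> (\<mu> \<cdot> (E j \<otimes>\<^sub>a E n))) \<cdot> \<alpha> w (X j) (X n)"
  using assms(2)
proof (induction n arbitrary: j)
  case 0
  note [simp] = oprD[OF \<phi>]
  show ?case
    by (rule generic_eqI[of _ "(var 0 w \<boxtimes> var 1 (X j)) \<boxtimes> star"]) simp_all
next
  case (Suc n)
  note [simp] = oprD[OF \<phi>]
  let ?t = "(var 0 w \<boxtimes> var 1 (X j)) \<boxtimes> var 2 (X n) \<boxtimes> var 3 x"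
  have 1: "G w \<phi> n \<cdot> ((w \<triangleright> E j) \<triangleleft> (X n)) = zer ((w \<otimes>\<^sub>o X j) \<otimes>\<^sub>o X n) a"
    by (rule G_zero[OF \<phi>]) (use Suc.prems in simp)
  have 2: "G w \<phi> n \<cdot> ((w \<triangleright> E (Suc j)) \<triangleleft> (X n))
      = \<phi> \<cdot> (w \<triangleright> (\<mu> \<cdot> (E (Suc j) \<otimes>\<^sub>a E n))) \<cdot> \<alpha> w (X (Suc j)) (X n)"
    by (rule Suc.IH) (use Suc.prems in simp)
  have right_mul_zer: "right_mul (w \<otimes>\<^sub>o X j) (X n) (zer ((w \<otimes>\<^sub>o X j) \<otimes>\<^sub>o X n) a) = zer ((w \<otimes>\<^sub>o X j) \<otimes>\<^sub>o X n \<otimes>\<^sub>o x) a"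
    by (simp add: right_mul_def)
  have "(G w \<phi> (Suc n) \<cdot> ((w \<triangleright> E j) \<triangleleft> (X (Suc n)))) \<cdot> ((w \<otimes>\<^sub>o X j) \<triangleright> snoc C x n)
    = (\<phi> \<cdot> (w \<triangleright> (\<mu> \<cdot> (E (Suc j) \<otimes>\<^sub>a E n))) \<cdot> \<alpha> w (X (Suc j)) (X n))
      \<cdot> ((w \<triangleright> snoc C x j) \<triangleleft> (X n)) \<cdot> (\<alpha> w (X j) x \<triangleleft> (X n))
        \<cdot> \<i>\<n>\<v> (\<alpha> (w \<otimes>\<^sub>o X j) x (X n)) \<cdot> ((w \<otimes>\<^sub>o X j) \<triangleright> \<sigma> (X n) x)"
    unfolding G_snoc_E[OF \<phi>] 1 2 right_mul_zer by (rule hadd_zer(2)) simp_all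
  also have "\<dots> = (\<phi> \<cdot> (w \<triangleright> (\<mu> \<cdot> (E j \<otimes>\<^sub>a E (Suc n)))) \<cdot> \<alpha> w (X j) (X (Suc n))) \<cdot> ((w \<otimes>\<^sub>o X j) \<triangleright> snoc C x n)"
    by (rule generic_eqI[of _ ?t]) (simp_all add: mul_ac)
  finally show ?case
    by (rule iso_cancel_right) (simp_all del: G.simps)
qed

text \<open>Turns the recursion on words of fixed length into an identity valid for every v in
  \<open>a\<close>: both sides agree on all words, and these are jointly epi.\<close>

lemma step_extend:
  assumes \<phi>: "opr w \<phi>" and [simp]: "arr h" "src h = (w \<otimes>\<^sub>o a) \<otimes>\<^sub>o a" "tgt h = a"
    and h: "\<And>n. h \<cdot> ((w \<otimes>\<^sub>o a) \<triangleright> E n) = G w \<phi> n"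
  shows "h \<cdot> ((w \<otimes>\<^sub>o a) \<triangleright> (\<mu> \<cdot> (a \<triangleright> E1))) = step w a h"
proof (rule E_epi_mid[where w = "w \<otimes>\<^sub>o a" and v = x])
  note [simp] = oprD[OF \<phi>]
  let ?W = "\<i>\<d> (w \<otimes>\<^sub>o a)"
  fix n
  have "(h \<cdot> (?W \<otimes>\<^sub>a (\<mu> \<cdot> (a \<triangleright> E1)))) \<cdot> (?W \<otimes>\<^sub>a (E n \<triangleleft> x)) = h \<cdot> (?W \<otimes>\<^sub>a (\<mu> \<cdot> (E n \<otimes>\<^sub>a E1)))"
    by (simp add: compA interchange)
  also have "\<dots> = (h \<cdot> (?W \<otimes>\<^sub>a E (Suc n))) \<cdot> (?W \<otimes>\<^sub>a snoc C x n)"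
    unfolding E_Suc by (simp add: compA interchange)
  also have "\<dots> = step w (X n) (h \<cdot> (?W \<otimes>\<^sub>a E n))"
    unfolding h by (rule G_snoc[OF \<phi>])
  also have "\<dots> = step w a h \<cdot> (?W \<otimes>\<^sub>a (E n \<triangleleft> x))"
    using step_nat[of w "E n" h] by simp
  finally show "(h \<cdot> (?W \<otimes>\<^sub>a (\<mu> \<cdot> (a \<triangleright> E1)))) \<cdot> (?W \<otimes>\<^sub>a (E n \<triangleleft> x))
      = step w a h \<cdot> (?W \<otimes>\<^sub>a (E n \<triangleleft> x))" .
qed (use \<phi> in \<open>simp_all add: opr_def\<close>)

text \<open>Let \<Delta>_c be \<open>h\<close> with accumulator c, a word of length j. By the
  recursion [\<Delta>_c, v y] = y [\<Delta>_c, v] + \<Delta>_(cy) v. The first summand is handled by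
  the inner induction on the length of v, the second by the outer induction, as c y has length
  \<open>Suc j\<close> while m drops by one. For m = 0 the accumulator has degree above k, where
  \<phi> vanishes.\<close>

lemma has_order_extend:
  assumes \<phi>: "opr w \<phi>" and [simp]: "arr h" "src h = (w \<otimes>\<^sub>o a) \<otimes>\<^sub>o a" "tgt h = a"
    and h: "\<And>n. h \<cdot> ((w \<otimes>\<^sub>o a) \<triangleright> E n) = G w \<phi> n"
    and \<phi>0: "\<And>i. k < i \<Longrightarrow> \<phi> \<cdot> (w \<triangleright> E i) = zer (w \<otimes>\<^sub>o X i) a"
  shows "k < j + m \<Longrightarrow> has_order m (w \<otimes>\<^sub>o X j) (h \<cdot> ((w \<triangleright> E j) \<triangleleft> a))"
proof (induction m arbitrary: j)
  case 0
  note [simp] = oprD[OF \<phi>]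
  have *: "(h \<cdot> ((w \<triangleright> E j) \<triangleleft> a)) \<cdot> ((w \<otimes>\<^sub>o X j) \<triangleright> E n) = zer ((w \<otimes>\<^sub>o X j) \<otimes>\<^sub>o X n) a" for n
  proof -
    have "(h \<cdot> ((w \<triangleright> E j) \<triangleleft> a)) \<cdot> ((w \<otimes>\<^sub>o X j) \<triangleright> E n)
       = (h \<cdot> ((w \<otimes>\<^sub>o a) \<triangleright> E n)) \<cdot> ((w \<triangleright> E j) \<triangleleft> (X n))"
      by (simp add: compA interchange)
    also have "\<dots> = zer ((w \<otimes>\<^sub>o X j) \<otimes>\<^sub>o X n) a"
      unfolding h by (rule G_zero[OF \<phi>]) (use 0 in \<open>simp add: \<phi>0\<close>)
    finally show ?thesis .
  qed
  show ?case
    unfolding has_order.simps by (rule E_epi'[where w = "w \<otimes>\<^sub>o X j"]) (simp_all add: *)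
next
  case (Suc m)
  note IH = Suc.IH
  note [simp] = oprD[OF \<phi>]
  let ?V = "w \<otimes>\<^sub>o X j"
  define g where "g i = h \<cdot> ((w \<triangleright> E i) \<triangleleft> a)" for i
  have [simp]: "arr (g i)" "src (g i) = (w \<otimes>\<^sub>o X i) \<otimes>\<^sub>o a" "tgt (g i) = a" for i
    by (simp_all add: g_def)
  define L where "L n = lft ?V (g j) \<cdot> ((E n \<triangleleft> ?V) \<triangleleft> a)" for n
  define K where "K n = out ?V (g j) \<cdot> ((E n \<triangleleft> ?V) \<triangleleft> a)" for n
  have LK [simp]: "arr (L n)" "arr (K n)" "src (L n) = (X n \<otimes>\<^sub>o ?V) \<otimes>\<^sub>o a" "src (K n) = (X n \<otimes>\<^sub>o ?V) \<otimes>\<^sub>o a" "tgt (L n) = a" "tgt (K n) = a" for n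
    by (simp_all add: L_def K_def)
  have F: "bracket ?V (g j) \<cdot> ((E n \<triangleleft> ?V) \<triangleleft> a) = L n \<boxminus> K n" for n
    unfolding bracket_def by (simp add: hsub_comp L_def K_def)
  have "has_order m (X n \<otimes>\<^sub>o ?V) (L n \<boxminus> K n)" for n
  proof (induction n)
    case 0
    \<comment> \<open>The commutator with the unit of \<open>a\<close> is zero.\<close>
    have "L 0 = K 0"
      by (rule generic_eqI[of _ "(star \<boxtimes> var 1 w \<boxtimes> var 2 (X j)) \<boxtimes> var 3 a"])
        (simp_all add: L_def K_def g_def opr_defs)
    then show ?case
      using has_order_zer[of "\<I> \<otimes>\<^sub>o ?V" m] by simp
  next
    case (Suc n)
    let ?P = "(var 0 (X n) \<boxtimes> var 5 x) \<boxtimes> var 2 w \<boxtimes> var 3 (X j)"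
    let ?t = "?P \<boxtimes> var 4 a"
    let ?s = "(snoc C x n \<triangleleft> ?V) \<triangleleft> a"
    \<comment> \<open>Three rearrangements given by their effect on variables: \<open>q\<close>
      supplies the arguments of the recursion, with v b as the element and y as the appended
      generator; \<open>u\<close> pulls y out in front; \<open>u'\<close> appends y to the
      accumulator.\<close>
    define q where "q = abst ?t ((var 2 w \<boxtimes> app (E j) (var 3 (X j))) \<boxtimes> app \<mu> (app (E n) (var 0 (X n)) \<boxtimes> var 4 a) \<boxtimes> var 5 x)"
    define u where "u = abst ?P (app E1 (var 5 x) \<boxtimes> var 0 (X n) \<boxtimes> var 2 w \<boxtimes> var 3 (X j))"
    define u' where "u' = abst ?P ((var 2 w \<boxtimes> app (snoc C x j) (var 3 (X j) \<boxtimes> var 5 x)) \<boxtimes> app (E n) (var 0 (X n)))"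
    have q [simp]: "arr q" "src q = ((X n \<otimes>\<^sub>o x) \<otimes>\<^sub>o ?V) \<otimes>\<^sub>o a" "tgt q = (w \<otimes>\<^sub>o a) \<otimes>\<^sub>o a \<otimes>\<^sub>o x"
      "app q ?t = (var 2 w \<boxtimes> app (E j) (var 3 (X j))) \<boxtimes> app \<mu> (app (E n) (var 0 (X n)) \<boxtimes> var 4 a) \<boxtimes> var 5 x"
      unfolding q_def by (simp_all add: abst_simps fst_terms)
    have u [simp]: "arr u" "src u = (X n \<otimes>\<^sub>o x) \<otimes>\<^sub>o ?V" "tgt u = a \<otimes>\<^sub>o X n \<otimes>\<^sub>o ?V"
      "app u ?P = app E1 (var 5 x) \<boxtimes> var 0 (X n) \<boxtimes> var 2 w \<boxtimes> var 3 (X j)"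
      unfolding u_def by (simp_all add: abst_simps fst_terms)
    have u' [simp]: "arr u'" "src u' = (X n \<otimes>\<^sub>o x) \<otimes>\<^sub>o ?V" "tgt u' = (w \<otimes>\<^sub>o X (Suc j)) \<otimes>\<^sub>o a"
      "app u' ?P = (var 2 w \<boxtimes> app (snoc C x j) (var 3 (X j) \<boxtimes> var 5 x)) \<boxtimes> app (E n) (var 0 (X n))"
      unfolding u'_def by (simp_all add: abst_simps fst_terms)
    let ?U = "u \<triangleleft> a"
    have 1: "L (Suc n) \<cdot> ?s = (h \<cdot> ((w \<otimes>\<^sub>o a) \<triangleright> (\<mu> \<cdot> (a \<triangleright> E1)))) \<cdot> q"
      by (rule generic_eqI[of _ ?t]) (simp_all add: L_def g_def opr_defs mul_ac)
    have 2: "right_mul (w \<otimes>\<^sub>o a) a h \<cdot> q = out (X n \<otimes>\<^sub>o ?V) (L n) \<cdot> ?U"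
      by (rule generic_eqI[of _ ?t]) (simp_all add: L_def g_def opr_defs mul_ac)
    have 3: "K (Suc n) \<cdot> ?s = out (X n \<otimes>\<^sub>o ?V) (K n) \<cdot> ?U"
      by (rule generic_eqI[of _ ?t]) (simp_all add: K_def g_def opr_defs mul_ac)
    have 4: "(h \<cdot> absorb w a) \<cdot> q = rgt (w \<otimes>\<^sub>o X (Suc j)) (g (Suc j)) \<cdot> (u' \<triangleleft> a)"
      by (rule generic_eqI[of _ ?t]) (simp_all add: g_def opr_defs mul_ac)
    have "(L (Suc n) \<boxminus> K (Suc n)) \<cdot> ?s = L (Suc n) \<cdot> ?s \<boxminus> K (Suc n) \<cdot> ?s"
      by (simp add: hsub_comp)
    also have "L (Suc n) \<cdot> ?s = step w a h \<cdot> q"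
      unfolding 1 step_extend[OF \<phi> assms(2-4) h] ..
    also have "\<dots> = right_mul (w \<otimes>\<^sub>o a) a h \<cdot> q \<boxplus> (h \<cdot> absorb w a) \<cdot> q"
      unfolding step_def by (rule hadd_comp) simp_all
    also have "(right_mul (w \<otimes>\<^sub>o a) a h \<cdot> q \<boxplus> (h \<cdot> absorb w a) \<cdot> q) \<boxminus> K (Suc n) \<cdot> ?s
      = (right_mul (w \<otimes>\<^sub>o a) a h \<cdot> q \<boxminus> K (Suc n) \<cdot> ?s) \<boxplus> (h \<cdot> absorb w a) \<cdot> q"
      by (rule hsub_hadd_swap) simp_all
    also have "right_mul (w \<otimes>\<^sub>o a) a h \<cdot> q \<boxminus> K (Suc n) \<cdot> ?s = out (X n \<otimes>\<^sub>o ?V) (L n \<boxminus> K n) \<cdot> ?U"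
      unfolding 2 3 by (simp add: out_hsub hsub_comp opr_def)
    \<comment> \<open>The Leibniz rule announced above, up to the rearrangements \<open>u\<close>
      and \<open>u'\<close>.\<close>
    finally have e: "(L (Suc n) \<boxminus> K (Suc n)) \<cdot> ?s
      = out (X n \<otimes>\<^sub>o ?V) (L n \<boxminus> K n) \<cdot> ?U \<boxplus> rgt (w \<otimes>\<^sub>o X (Suc j)) (g (Suc j)) \<cdot> (u' \<triangleleft> a)"
      unfolding 4 .
    have "has_order m (src u) (out (X n \<otimes>\<^sub>o ?V) (L n \<boxminus> K n) \<cdot> ?U)"
      by (rule has_order_precomp[of "a \<otimes>\<^sub>o X n \<otimes>\<^sub>o ?V"], simp add: opr_def, rule has_order_out) (simp_all add: Suc.IH opr_def)
    moreover have "has_order m (src u') (rgt (w \<otimes>\<^sub>o X (Suc j)) (g (Suc j)) \<cdot> (u' \<triangleleft> a))"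
    proof (rule has_order_precomp[of "(w \<otimes>\<^sub>o X (Suc j)) \<otimes>\<^sub>o a"])
      have "has_order m (w \<otimes>\<^sub>o X (Suc j)) (g (Suc j))"
        unfolding g_def by (rule IH) (use \<open>k < j + Suc m\<close> in simp)
      then show "has_order m ((w \<otimes>\<^sub>o X (Suc j)) \<otimes>\<^sub>o a) (rgt (w \<otimes>\<^sub>o X (Suc j)) (g (Suc j)))"
        by (rule has_order_rgt[rotated]) (simp add: opr_def)
    qed (simp_all add: opr_def)
    ultimately have "has_order m ((X n \<otimes>\<^sub>o x) \<otimes>\<^sub>o ?V) ((L (Suc n) \<boxminus> K (Suc n)) \<cdot> ?s)"
      unfolding e by (intro has_order_hadd) (simp_all add: opr_def)
    then have "has_order m (src (\<i>\<n>\<v> (snoc C x n) \<triangleleft> ?V))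
        (((L (Suc n) \<boxminus> K (Suc n)) \<cdot> ?s) \<cdot> ((\<i>\<n>\<v> (snoc C x n) \<triangleleft> ?V) \<triangleleft> a))"
      by (intro has_order_precomp[of "(X n \<otimes>\<^sub>o x) \<otimes>\<^sub>o ?V"]) (simp_all add: opr_def)
    then show ?case
      by (simp add: compA interchange)
  qed
  \<comment> \<open>Words were enough: by \<open>has_order_detect\<close> the bound passes to
    commutators with all of \<open>a\<close>.\<close>
  then have "has_order m (a \<otimes>\<^sub>o ?V) (bracket ?V (g j))"
    by (intro has_order_detect) (simp_all add: F opr_def)
  then show ?case
    by (simp add: g_def)
qed

lemma has_order_exists:
  assumes [simp]: "w \<in> Ob C"
    and r: "\<And>n. n < m \<Longrightarrow> r n \<in> Hom C (w \<otimes>\<^sub>o X n) a"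
    and r_swap: "\<And>n i. n < m \<Longrightarrow> Suc i < n \<Longrightarrow> r n \<cdot> (w \<triangleright> swp n i x) = r n"
  shows "\<exists>f. opr w f \<and> has_order m w f \<and> (\<forall>n<m. f \<cdot> (w \<triangleright> E n) = r n)"
  using r r_swap
proof (induction m)
  case 0
  show ?case
    by (rule exI[of _ "zer (w \<otimes>\<^sub>o a) a"]) (simp add: opr_def)
next
  case (Suc m)
  then obtain f where f: "opr w f" "has_order m w f" "\<And>n. n < m \<Longrightarrow> f \<cdot> (w \<triangleright> E n) = r n"
    by auto
  have [simp]: "arr f" "src f = w \<otimes>\<^sub>o a" "tgt f = a"
    using f by (simp_all add: opr_def)
  have [simp]: "arr (r m)" "src (r m) = w \<otimes>\<^sub>o X m" "tgt (r m) = a"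
    using Suc.prems(1)[of m] by (simp_all add: hom_iff)
  \<comment> \<open>The error of f in degree m and zero in every other degree; adding an operator
    with these values up to degree m leaves the lower values of f intact.\<close>
  define s where "s n = (if n = m then r m \<boxminus> f \<cdot> (w \<triangleright> E m) else zer (w \<otimes>\<^sub>o X n) a)" for n
  have s [simp]: "arr (s n)" "src (s n) = w \<otimes>\<^sub>o X n" "tgt (s n) = a" for n
    by (simp_all add: s_def)
  have s_swap: "s n \<cdot> (w \<triangleright> swp n i x) = s n" if i: "Suc i < n" for n i
  proof (cases "n = m")
    case True
    have "(f \<cdot> (w \<triangleright> E m)) \<cdot> (w \<triangleright> swp m i x) = f \<cdot> (w \<triangleright> E m)"
      using i True E_swap[of i m] by (simp add: compA interchange)
    then show ?thesis
      using True i Suc.prems(2)[of m i] by (simp add: s_def hsub_comp)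
  qed (use i in \<open>simp add: s_def\<close>)
  obtain \<phi> where \<phi>: "\<phi> \<in> Hom C (w \<otimes>\<^sub>o a) a" "\<And>n. \<phi> \<cdot> (w \<triangleright> E n) = s n"
    using E_univ[of w a s] s_swap by (auto simp: hom_iff)
  then have [simp]: "arr \<phi>" "src \<phi> = w \<otimes>\<^sub>o a" "tgt \<phi> = a" and op: "opr w \<phi>"
    by (simp_all add: hom_iff opr_def)
  obtain h where h: "h \<in> Hom C ((w \<otimes>\<^sub>o a) \<otimes>\<^sub>o a) a" "\<And>n. h \<cdot> ((w \<otimes>\<^sub>o a) \<triangleright> E n) = G w \<phi> n"
    using E_univ[of "w \<otimes>\<^sub>o a" a "G w \<phi>"] G_swap[OF op] by (auto simp: hom_iff)
  then have [simp]: "arr h" "src h = (w \<otimes>\<^sub>o a) \<otimes>\<^sub>o a" "tgt h = a"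
    by (simp_all add: hom_iff)
  \<comment> \<open>The member of the family with accumulator 1, inserted through the unit
    \<open>E 0\<close>.\<close>
  define d where "d = (h \<cdot> ((w \<triangleright> E 0) \<triangleleft> a)) \<cdot> (\<i>\<n>\<v> (\<r> w) \<triangleleft> a)"
  have [simp]: "arr d" "src d = w \<otimes>\<^sub>o a" "tgt d = a"
    by (simp_all add: d_def)
  \<comment> \<open>The accumulator has length 0 and \<phi> vanishes above degree m, so the bound is
    m < 0 + Suc m.\<close>
  have "has_order (Suc m) (w \<otimes>\<^sub>o X 0) (h \<cdot> ((w \<triangleright> E 0) \<triangleleft> a))"
    by (rule has_order_extend[OF op _ _ _ h(2), where k = m]) (simp_all add: \<phi> s_def)
  then have "has_order (Suc m) (src (\<i>\<n>\<v> (\<r> w))) d"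
    unfolding d_def by (intro has_order_precomp[of "w \<otimes>\<^sub>o X 0"]) (simp_all add: opr_def)
  then have d_has_order: "has_order (Suc m) w d"
    by simp
  have d: "d \<cdot> (w \<triangleright> E n) = s n" if "n \<le> m" for n
  proof -
    have "G w \<phi> n \<cdot> ((w \<triangleright> E 0) \<triangleleft> (X n)) = \<phi> \<cdot> (w \<triangleright> (\<mu> \<cdot> (E 0 \<otimes>\<^sub>a E n))) \<cdot> \<alpha> w (X 0) (X n)"
      \<comment> \<open>For n \<le> m every degree below n differs from m, so \<phi> vanishes
        there.\<close>
      by (rule G_top[OF op]) (use that in \<open>simp add: \<phi> s_def\<close>)
    then have *: "(h \<cdot> ((w \<otimes>\<^sub>o a) \<triangleright> E n)) \<cdot> ((w \<triangleright> E 0) \<triangleleft> (X n)) = \<phi> \<cdot> (w \<triangleright> (\<mu> \<cdot> (E 0 \<otimes>\<^sub>a E n))) \<cdot> \<alpha> w (X 0) (X n)"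
      unfolding h .
    have "d \<cdot> (w \<triangleright> E n) = ((h \<cdot> ((w \<otimes>\<^sub>o a) \<triangleright> E n)) \<cdot> ((w \<triangleright> E 0) \<triangleleft> (X n))) \<cdot> (\<i>\<n>\<v> (\<r> w) \<triangleleft> (X n))"
      by (simp add: d_def compA interchange)
    also have "\<dots> = \<phi> \<cdot> (w \<triangleright> E n)"
      unfolding * by (rule generic_eqI[of _ "var 0 w \<boxtimes> var 1 (X n)"]) simp_all
    finally show ?thesis
      by (simp add: \<phi>)
  qed
  show ?case
  proof (intro exI[of _ "d \<boxplus> f"] conjI allI impI)
    show "has_order (Suc m) w (d \<boxplus> f)"
      by (rule has_order_hadd) (use f d_has_order in \<open>simp_all add: opr_def del: has_order.simps add: has_order_Suc\<close>)
    fix n assume n: "n < Suc m"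
    have "(d \<boxplus> f) \<cdot> (w \<triangleright> E n) = s n \<boxplus> f \<cdot> (w \<triangleright> E n)"
      using n d[of n] by (simp add: hadd_comp)
    also have "\<dots> = r n"
    proof (cases "n = m")
      case True
      then show ?thesis
        by (simp add: s_def hsub_hadd_cancel)
    next
      case False
      then have "n < m" "arr (r n)" "src (r n) = w \<otimes>\<^sub>o X n" "tgt (r n) = a"
        using n Suc.prems(1)[of n] by (simp_all add: hom_iff)
      then show ?thesis
        using False f(3) by (simp add: s_def)
    qed
    finally show "(d \<boxplus> f) \<cdot> (w \<triangleright> E n) = r n" .
  qed (simp add: opr_def)
qed

end

section \<open>Tensor products and colimits\<close>

text \<open>An infinite index type contains a copy of the natural numbers, so countable diagrams
  count as small.\<close>

locale cocomplete_category = sm_category R C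
  for R :: "('r, 'k) ring_scheme" and C :: "('r, 'o, 'm, 'z) sm_category_scheme" (structure) +
  fixes small :: "'s itself"
  assumes infinite_small: "infinite (UNIV :: 's set)"
    and cocomplete: "tensor_cocomplete small C"
begin

text \<open>Colimits over the free category on a graph with vertices \<open>N\<close> and edges \<open>D\<close>, in which no two
  edges are composable.\<close>

definition graph_colimit ::
  "nat set \<Rightarrow> nat set \<Rightarrow> (nat \<Rightarrow> nat) \<Rightarrow> (nat \<Rightarrow> nat) \<Rightarrow> (nat \<Rightarrow> 'o) \<Rightarrow> (nat \<Rightarrow> 'm) \<Rightarrow> 'o \<Rightarrow> (nat \<Rightarrow> 'm) \<Rightarrow> bool"
where
  "graph_colimit N D s t Fo Fm c \<iota> \<longleftrightarrow>
     c \<in> Ob C \<and> (\<forall>i\<in>N. \<iota> i \<in> Hom C (Fo i) c) \<and> (\<forall>d\<in>D. \<iota> (t d) \<cdot> Fm d = \<iota> (s d)) \<and>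
     (\<forall>z \<kappa>. z \<in> Ob C \<and> (\<forall>i\<in>N. \<kappa> i \<in> Hom C (Fo i) z) \<and> (\<forall>d\<in>D. \<kappa> (t d) \<cdot> Fm d = \<kappa> (s d)) \<longrightarrow>
       (\<exists>!h. h \<in> Hom C c z \<and> (\<forall>i\<in>N. h \<cdot> \<iota> i = \<kappa> i)))"

text \<open>Cocompleteness speaks of index categories on the type \<open>'s\<close>. The graph is
  coded as such a category, and its colimits are translated in both directions.\<close>

lemma tens_graph_colimit:
  assumes Fm: "\<And>d. d \<in> D \<Longrightarrow> s d \<in> N \<and> t d \<in> N \<and> Fm d \<in> Hom C (Fo (s d)) (Fo (t d))"
    and D: "\<And>d d'. d \<in> D \<Longrightarrow> d' \<in> D \<Longrightarrow> t d \<noteq> s d'"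
    and col: "graph_colimit N D s t Fo Fm c \<iota>" and w: "w \<in> Ob C"
  shows "graph_colimit N D s t (\<lambda>i. w \<otimes>\<^sub>o Fo i) (\<lambda>d. w \<triangleright> Fm d) (w \<otimes>\<^sub>o c) (\<lambda>i. w \<triangleright> \<iota> i)"
proof -
  obtain e :: "nat \<Rightarrow> 's" where e: "inj e"
    using infinite_small infinite_countable_subset by blast
  define e' where "e' = inv_into UNIV e"
  have [simp]: "e' (e i) = i" for i
    by (simp add: e'_def e)
  have [simp]: "e i = e j \<longleftrightarrow> i = j" for i j
    using e by (simp add: inj_eq)
  have nat_double: "2 * i \<noteq> Suc (2 * d)" for i d :: nat
    by presburger
  \<comment> \<open>Even codes are identities and odd codes are edges. No two edges are composable,
    so one of two composable arrows is an identity and the composite is the other one.\<close>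
  define J :: "('s, 's) category" where
    "J = \<lparr>Ob = e ` N,
       Hom = (\<lambda>p q. {e (2 * i) |i. i \<in> N \<and> p = e i \<and> q = e i}
         \<union> {e (Suc (2 * d)) |d. d \<in> D \<and> p = e (s d) \<and> q = e (t d)}),
       ident = (\<lambda>p. e (2 * e' p)),
       compose = (\<lambda>v u. if even (e' u) then v else u)\<rparr>"
  have Fo: "Fo i \<in> Ob C" if "i \<in> N" for i
    using col that Hom_Ob unfolding graph_colimit_def by blast
  have J: "category J"
    by unfold_locales (auto simp: J_def nat_double nat_double[symmetric] dest: Fm D)
  have Ob_J: "Ob J = e ` N"
    by (simp add: J_def)
  \<comment> \<open>Stated for an arbitrary functor, as it serves the given diagram and the tensored
    one.\<close>
  have iff: "is_colimit J C Go Gm b \<gamma> \<longleftrightarrow> graph_colimit N D s t (\<lambda>i. Go (e i)) (\<lambda>d. Gm (e (Suc (2 * d)))) b (\<lambda>i. \<gamma> (e i))"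
    if G: "is_functor J C Go Gm" for Go Gm b and \<gamma> :: "'s \<Rightarrow> 'm"
  proof -
    have G_id: "Gm (e (2 * i)) = \<i>\<d> (Go (e i))" "Go (e i) \<in> Ob C" if "i \<in> N" for i
      using G that unfolding is_functor_def by (auto simp: J_def)
    have cocone: "is_cocone J C Go Gm z \<kappa> \<longleftrightarrow> z \<in> Ob C \<and> (\<forall>i\<in>N. \<kappa> (e i) \<in> Hom C (Go (e i)) z) \<and>
        (\<forall>d\<in>D. \<kappa> (e (t d)) \<cdot> Gm (e (Suc (2 * d))) = \<kappa> (e (s d)))" (is "_ \<longleftrightarrow> ?R") for z \<kappa>
    proof
      assume "is_cocone J C Go Gm z \<kappa>"
      then show ?R
        unfolding is_cocone_def by (auto simp: J_def)
    next
      assume ?R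
      then show "is_cocone J C Go Gm z \<kappa>"
        unfolding is_cocone_def by (auto simp: J_def G_id hom_iff)
    qed
    have "(\<forall>z \<kappa>. is_cocone J C Go Gm z \<kappa> \<longrightarrow> (\<exists>!h. h \<in> Hom C b z \<and> (\<forall>i \<in> Ob J. h \<cdot> \<gamma> i = \<kappa> i)))
      \<longleftrightarrow> (\<forall>z \<kappa>. z \<in> Ob C \<and> (\<forall>i\<in>N. \<kappa> i \<in> Hom C (Go (e i)) z) \<and> (\<forall>d\<in>D. \<kappa> (t d) \<cdot> Gm (e (Suc (2 * d))) = \<kappa> (s d)) \<longrightarrow>
       (\<exists>!h. h \<in> Hom C b z \<and> (\<forall>i\<in>N. h \<cdot> \<gamma> (e i) = \<kappa> i)))" (is "?A \<longleftrightarrow> ?B")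
    proof
      assume A: ?A
      show ?B
      proof (intro allI impI)
        fix z and \<kappa> :: "nat \<Rightarrow> 'm"
        assume "z \<in> Ob C \<and> (\<forall>i\<in>N. \<kappa> i \<in> Hom C (Go (e i)) z) \<and> (\<forall>d\<in>D. \<kappa> (t d) \<cdot> Gm (e (Suc (2 * d))) = \<kappa> (s d))"
        then have "is_cocone J C Go Gm z (\<lambda>p. \<kappa> (e' p))"
          unfolding cocone by simp
        with A[rule_format, of z "\<lambda>p. \<kappa> (e' p)"] show "\<exists>!h. h \<in> Hom C b z \<and> (\<forall>i\<in>N. h \<cdot> \<gamma> (e i) = \<kappa> i)"
          by (simp add: Ob_J)
      qed
    next
      assume B: ?B
      show ?A
      proof (intro allI impI)
        fix z and \<kappa> :: "'s \<Rightarrow> 'm"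
        assume "is_cocone J C Go Gm z \<kappa>"
        with B[rule_format, of z "\<lambda>i. \<kappa> (e i)"] show "\<exists>!h. h \<in> Hom C b z \<and> (\<forall>i \<in> Ob J. h \<cdot> \<gamma> i = \<kappa> i)"
          unfolding cocone by (simp add: Ob_J)
      qed
    qed
    then show ?thesis
      unfolding is_colimit_def graph_colimit_def cocone by auto
  qed
  define Go where "Go p = Fo (e' p)" for p
  define Gm where "Gm u = (if even (e' u) then \<i>\<d> (Fo (e' u div 2)) else Fm (e' u div 2))" for u
  have G: "is_functor J C Go Gm"
    unfolding is_functor_def using Fm Fo ident_Hom
    by (auto simp: J_def Go_def Gm_def hom_iff dest: D)
  have wG: "is_functor J C (\<lambda>i. w \<otimes>\<^sub>o Go i) (\<lambda>u. w \<triangleright> Gm u)"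
    unfolding is_functor_def using Fm Fo w ident_Hom
    by (auto simp: J_def Go_def Gm_def hom_iff dest: D)
  have "is_colimit J C Go Gm c (\<lambda>p. \<iota> (e' p))"
    unfolding iff[OF G] using col by (simp add: Go_def Gm_def)
  with cocomplete J G w have "is_colimit J C (\<lambda>i. w \<otimes>\<^sub>o Go i) (\<lambda>u. w \<triangleright> Gm u) (w \<otimes>\<^sub>o c) (\<lambda>i. w \<triangleright> \<iota> (e' i))"
    unfolding tensor_cocomplete_def by blast
  then show ?thesis
    unfolding iff[OF wG] by (simp add: Go_def Gm_def)
qed

lemma tens_coproduct:
  assumes c: "is_coproduct C (I :: nat set) X c \<iota>" and w: "w \<in> Ob C"
  shows "is_coproduct C I (\<lambda>i. w \<otimes>\<^sub>o X i) (w \<otimes>\<^sub>o c) (\<lambda>i. w \<triangleright> \<iota> i)"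
proof -
  have "graph_colimit I {} id id X (\<lambda>_. \<i>\<d> w) c \<iota>"
    using c unfolding graph_colimit_def is_coproduct_def by simp
  from tens_graph_colimit[OF _ _ this w] show ?thesis
    unfolding graph_colimit_def is_coproduct_def by simp
qed

lemma tens_epi:
  assumes g: "epi_arrow C g" and w: "w \<in> Ob C" and eq: "f \<cdot> (w \<triangleright> g) = f' \<cdot> (w \<triangleright> g)"
    and f: "f \<in> Hom C (w \<otimes>\<^sub>o tgt g) z" "f' \<in> Hom C (w \<otimes>\<^sub>o tgt g) z"
  shows "f = f'"
proof -
  obtain y y' where "g \<in> Hom C y y'"
    and epi: "\<forall>z. \<forall>p \<in> Hom C y' z. \<forall>q \<in> Hom C y' z. p \<cdot> g = q \<cdot> g \<longrightarrow> p = q"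
    using g unfolding epi_arrow_def by blast
  then have [simp]: "arr g" and y': "y' = tgt g"
    by (simp_all add: hom_iff)
  define \<iota> where "\<iota> i = (if i = 0 then g else \<i>\<d> (tgt g))" for i :: nat
  define N where "N = {0, Suc 0, Suc (Suc 0)}"
  define Fo where "Fo i = (if i = 0 then src g else tgt g)" for i :: nat
  text \<open>An arrow is epi iff its cokernel pair has identity legs, which is a colimit condition.\<close>
  have epi_col: "graph_colimit N {0, Suc 0} (\<lambda>_. 0) Suc Fo (\<lambda>_. g) (tgt g) \<iota>"
    unfolding graph_colimit_def
  proof (intro conjI allI impI)
    fix z \<kappa>
    assume *: "z \<in> Ob C \<and> (\<forall>i\<in>N. \<kappa> i \<in> Hom C (Fo i) z) \<and> (\<forall>d\<in>{0, Suc 0}. \<kappa> (Suc d) \<cdot> g = \<kappa> 0)"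
    then have \<kappa>: "\<kappa> (Suc 0) \<in> Hom C (tgt g) z" "\<kappa> (Suc (Suc 0)) \<in> Hom C (tgt g) z" "\<kappa> (Suc 0) \<cdot> g = \<kappa> 0" "\<kappa> (Suc (Suc 0)) \<cdot> g = \<kappa> 0"
      by (simp_all add: N_def Fo_def)
    then have "\<kappa> (Suc 0) = \<kappa> (Suc (Suc 0))"
      using epi[unfolded y', rule_format, of "\<kappa> (Suc 0)" z "\<kappa> (Suc (Suc 0))"] by simp
    then show "\<exists>!h. h \<in> Hom C (tgt g) z \<and> (\<forall>i\<in>N. h \<cdot> \<iota> i = \<kappa> i)"
      using \<kappa> by (intro ex1I[of _ "\<kappa> (Suc 0)"]) (auto simp: N_def \<iota>_def hom_iff)
  qed (auto simp: \<iota>_def N_def Fo_def hom_iff)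
  have col: "graph_colimit N {0, Suc 0} (\<lambda>_. 0) Suc (\<lambda>i. w \<otimes>\<^sub>o Fo i) (\<lambda>_. w \<triangleright> g) (w \<otimes>\<^sub>o tgt g) (\<lambda>i. w \<triangleright> \<iota> i)"
    by (rule tens_graph_colimit[OF _ _ epi_col w]) (auto simp: N_def Fo_def hom_iff)
  \<comment> \<open>The arrows to be compared form a cocone. The legs of the tensored colimit are
    identities, so the induced arrow equals both of them.\<close>
  define \<kappa> where "\<kappa> i = (if i = 0 then f \<cdot> (w \<triangleright> g) else if i = Suc 0 then f else f')" for i :: nat
  have [simp]: "\<kappa> 0 = f \<cdot> (w \<triangleright> g)" "\<kappa> (Suc 0) = f" "\<kappa> (Suc (Suc 0)) = f'"
    by (simp_all add: \<kappa>_def)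
  have "\<exists>!h. h \<in> Hom C (w \<otimes>\<^sub>o tgt g) z \<and> (\<forall>i\<in>N. h \<cdot> (w \<triangleright> \<iota> i) = \<kappa> i)"
  proof (rule col[unfolded graph_colimit_def, THEN conjunct2, THEN conjunct2, THEN conjunct2, rule_format], intro conjI ballI)
    show "z \<in> Ob C"
      using Hom_Ob[OF f(1)] by simp
    show "\<kappa> i \<in> Hom C (w \<otimes>\<^sub>o Fo i) z" if "i \<in> N" for i
      using that f w by (auto simp: N_def Fo_def hom_iff)
    show "\<kappa> (Suc d) \<cdot> (w \<triangleright> g) = \<kappa> 0" if "d \<in> {0, Suc 0}" for d
      using that eq by (elim insertE) simp_all
  qed
  then obtain h where h: "h \<in> Hom C (w \<otimes>\<^sub>o tgt g) z" "\<forall>i\<in>N. h \<cdot> (w \<triangleright> \<iota> i) = \<kappa> i"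
    by blast
  have "h \<cdot> (w \<triangleright> \<iota> (Suc 0)) = f" "h \<cdot> (w \<triangleright> \<iota> (Suc (Suc 0))) = f'"
    using h(2) by (simp_all add: N_def)
  then show ?thesis
    by (simp add: \<iota>_def)
qed

text \<open>Reduces invariance under all permutations to adjacent swaps, following the way
  \<open>perm_action\<close> is generated.\<close>

lemma perm_action_invariant:
  assumes "perm_action C x n p f" "x \<in> Ob C" "r \<in> Hom C (tpow C x n) z" "\<And>i. Suc i < n \<Longrightarrow> r \<cdot> swp n i x = r"
  shows "f \<in> Hom C (tpow C x n) (tpow C x n) \<and> r \<cdot> f = r"
  using assms(1)
proof induction
  case (perm_action_transpose p f i)
  with assms show ?case
    by (simp add: hom_iff compA[symmetric])
qed (use assms in \<open>simp_all add: hom_iff\<close>)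

text \<open>The coequaliser becomes a colimit over two vertices with all edges from the first to the
  second; loops at one vertex would be composable edges.\<close>

lemma tens_quo:
  assumes q: "is_coequaliser C {f. \<exists>p. perm_action C x n p f} (tpow C x n) c q"
    and x [simp]: "x \<in> Ob C" and w [simp]: "w \<in> Ob C"
    and r: "r \<in> Hom C (w \<otimes>\<^sub>o tpow C x n) z" "\<And>i. Suc i < n \<Longrightarrow> r \<cdot> (w \<triangleright> swp n i x) = r"
  shows "\<exists>!h. h \<in> Hom C (w \<otimes>\<^sub>o c) z \<and> h \<cdot> (w \<triangleright> q) = r"
proof -
  \<comment> \<open>Every natural number indexes an edge. Surplus edges carry the identity, which
    forces the two legs of a cocone to agree.\<close>
  define \<phi> where "\<phi> i = (if Suc i < n then swp n i x else \<i>\<d> (tpow C x n))" for i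
  have \<phi>: "arr (\<phi> i)" "src (\<phi> i) = tpow C x n" "tgt (\<phi> i) = tpow C x n" for i
    by (simp_all add: \<phi>_def)
  have qh: "arr q" "src q = tpow C x n" "tgt q = c"
    using q by (simp_all add: is_coequaliser_def hom_iff)
  have q_inv: "q \<cdot> f = q" if "perm_action C x n p f" for p f
  proof -
    have "q \<cdot> f = q \<cdot> \<i>\<d> (tpow C x n)"
      using q that perm_action_id[of C x n] unfolding is_coequaliser_def by blast
    then show ?thesis
      by (simp add: qh)
  qed
  have swap: "perm_action C x n (id \<circ> transpose i (Suc i)) (\<i>\<d> (tpow C x n) \<cdot> swp n i x)" if "Suc i < n" for i
    using that by (intro perm_action_transpose perm_action_id)
  have q_col: "graph_colimit {0, Suc 0} UNIV (\<lambda>_. 0) (\<lambda>_. Suc 0) (\<lambda>_. tpow C x n) \<phi> c (\<lambda>_. q)"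
    unfolding graph_colimit_def
  proof (intro conjI allI impI ballI)
    show "q \<cdot> \<phi> d = q" for d
      using q_inv[OF swap[of d]] by (simp add: \<phi>_def qh)
    fix z \<kappa>
    assume *: "z \<in> Ob C \<and> (\<forall>i\<in>{0, Suc 0}. \<kappa> i \<in> Hom C (tpow C x n) z) \<and> (\<forall>d\<in>UNIV. \<kappa> (Suc 0) \<cdot> \<phi> d = \<kappa> 0)"
    have "\<kappa> (Suc 0) \<cdot> \<phi> n = \<kappa> 0"
      using * by blast
    then have 01: "\<kappa> (Suc 0) = \<kappa> 0"
      using * by (simp add: \<phi>_def hom_iff)
    have inv: "\<kappa> 0 \<cdot> swp n i x = \<kappa> 0" if "Suc i < n" for i
    proof -
      have "\<kappa> (Suc 0) \<cdot> \<phi> i = \<kappa> 0"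
        using * by blast
      then show ?thesis
        using that by (simp add: 01 \<phi>_def)
    qed
    have "\<kappa> 0 \<cdot> f = \<kappa> 0" if "perm_action C x n p f" for p f
      using perm_action_invariant[OF that x, of "\<kappa> 0" z] * inv by blast
    then have "\<exists>!h. h \<in> Hom C c z \<and> h \<cdot> q = \<kappa> 0"
      by (intro q[unfolded is_coequaliser_def, THEN conjunct2, THEN conjunct2, rule_format]) (use * in auto)
    then show "\<exists>!h. h \<in> Hom C c z \<and> (\<forall>i\<in>{0, Suc 0}. h \<cdot> q = \<kappa> i)"
      by (simp add: 01)
  qed (use qh in \<open>auto simp: hom_iff\<close>)
  have w_col: "graph_colimit {0, Suc 0} UNIV (\<lambda>_. 0) (\<lambda>_. Suc 0) (\<lambda>_. w \<otimes>\<^sub>o tpow C x n) (\<lambda>d. w \<triangleright> \<phi> d) (w \<otimes>\<^sub>o c) (\<lambda>_. w \<triangleright> q)"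
    by (rule tens_graph_colimit[OF _ _ q_col w]) (simp_all add: hom_iff \<phi>)
  have "r \<cdot> (w \<triangleright> \<phi> d) = r" for d
    using r by (simp add: \<phi>_def hom_iff)
  then have "\<exists>!h. h \<in> Hom C (w \<otimes>\<^sub>o c) z \<and> (\<forall>i\<in>{0, Suc 0}. h \<cdot> (w \<triangleright> q) = (\<lambda>_. r) i)"
    using r(1) Hom_Ob[OF r(1)]
    by (intro w_col[unfolded graph_colimit_def, THEN conjunct2, THEN conjunct2, THEN conjunct2, rule_format]) simp
  then show ?thesis
    by (simp add: ex_disj_distrib)
qed

end

section \<open>The symmetric algebra as a free monoid with parameters\<close>

locale symmetric_algebra_in = cocomplete_category R C small
  for R :: "('r, 'k) ring_scheme" and C :: "('r, 'o, 'm, 'z) sm_category_scheme" (structure)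
    and small :: "'s itself" +
  fixes x :: 'o and S :: "('o, 'm, 'y) symmetric_algebra_scheme"
  assumes x_Ob' [simp]: "x \<in> Ob C"
    and sym_alg: "is_symmetric_algebra C x S"
begin

definition E where "E n = inc S n \<cdot> quo S n"

lemma quo_coeq: "is_coequaliser C {f. \<exists>p. perm_action C x n p f} (tpow C x n) (spow S n) (quo S n)"
  using sym_alg by (simp add: is_symmetric_algebra_def)

lemma inc_coprod: "is_coproduct C UNIV (spow S) (und S) (inc S)"
  using sym_alg by (simp add: is_symmetric_algebra_def)

lemma quo_arr [simp]: "arr (quo S n)" "src (quo S n) = tpow C x n" "tgt (quo S n) = spow S n"
  using quo_coeq[of n] by (simp_all add: is_coequaliser_def hom_iff)

lemma inc_arr [simp]: "arr (inc S n)" "src (inc S n) = spow S n" "tgt (inc S n) = und S"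
  using inc_coprod by (simp_all add: is_coproduct_def hom_iff)

lemma E_arr' [simp]: "arr (E n)" "src (E n) = tpow C x n" "tgt (E n) = und S"
  by (simp_all add: E_def)

lemma quo_swap:
  assumes "Suc i < n"
  shows "quo S n \<cdot> swp n i x = quo S n"
proof -
  have "perm_action C x n (id \<circ> transpose i (Suc i)) (\<i>\<d> (tpow C x n) \<cdot> swp n i x)"
    using assms by (intro perm_action_transpose perm_action_id)
  then have "quo S n \<cdot> \<i>\<d> (tpow C x n) \<cdot> swp n i x = quo S n \<cdot> \<i>\<d> (tpow C x n)"
    using quo_coeq[of n] perm_action_id[of C x n] unfolding is_coequaliser_def by blast
  then show ?thesis
    using assms by simp
qed

text \<open>A symmetric family first factors through the tensored quotients, degree by degree, and
  the factors are then assembled by the tensored coproduct.\<close>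

lemma sym_univ:
  assumes [simp]: "w \<in> Ob C" and r: "\<And>n. r n \<in> Hom C (w \<otimes>\<^sub>o tpow C x n) z"
    and r_swap: "\<And>n i. Suc i < n \<Longrightarrow> r n \<cdot> (w \<triangleright> swp n i x) = r n"
  shows "\<exists>!h. h \<in> Hom C (w \<otimes>\<^sub>o und S) z \<and> (\<forall>n. h \<cdot> (w \<triangleright> E n) = r n)"
proof -
  have 1: "\<exists>!h. h \<in> Hom C (w \<otimes>\<^sub>o spow S n) z \<and> h \<cdot> (w \<triangleright> quo S n) = r n" for n
    by (rule tens_quo[OF quo_coeq]) (use r r_swap in simp_all)
  then obtain k where k: "\<And>n. k n \<in> Hom C (w \<otimes>\<^sub>o spow S n) z" "\<And>n. k n \<cdot> (w \<triangleright> quo S n) = r n"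
    by metis
  have "is_coproduct C UNIV (\<lambda>n. w \<otimes>\<^sub>o spow S n) (w \<otimes>\<^sub>o und S) (\<lambda>n. w \<triangleright> inc S n)"
    by (rule tens_coproduct[OF inc_coprod]) simp
  then have "\<exists>!h. h \<in> Hom C (w \<otimes>\<^sub>o und S) z \<and> (\<forall>n\<in>UNIV. h \<cdot> (w \<triangleright> inc S n) = k n)"
    using k(1) Hom_Ob[OF k(1)] unfolding is_coproduct_def by blast
  moreover have "h \<cdot> (w \<triangleright> inc S n) = k n \<longleftrightarrow> h \<cdot> (w \<triangleright> E n) = r n"
    if h: "h \<in> Hom C (w \<otimes>\<^sub>o und S) z" for h n
  proof -
    have "h \<cdot> (w \<triangleright> E n) = (h \<cdot> (w \<triangleright> inc S n)) \<cdot> (w \<triangleright> quo S n)"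
      using h by (simp add: E_def hom_iff compA interchange)
    moreover have "h \<cdot> (w \<triangleright> inc S n) \<in> Hom C (w \<otimes>\<^sub>o spow S n) z"
      using h by (simp add: hom_iff)
    ultimately show ?thesis
      using 1[of n] k by metis
  qed
  ultimately show ?thesis
    by (auto cong: conj_cong)
qed

lemma S_monoid: "commutative_monoid C S"
  using sym_alg by (simp add: is_symmetric_algebra_def)

lemma tcat_1: "tcat C x n (Suc 0) = snoc C x n"
proof (rule generic_eqI[of _ "var 0 (tpow C x n) \<boxtimes> var 2 x"])
  show "app (tcat C x n (Suc 0)) (var 0 (tpow C x n) \<boxtimes> var 2 x) = app (snoc C x n) (var 0 (tpow C x n) \<boxtimes> var 2 x)"
    by (rule app_tcat_1) simp_all
qed (use tcat_arr[of x n "Suc 0"] in \<open>simp_all del: tcat.simps\<close>)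

lemma E_mul: "mul S \<cdot> (E n \<otimes>\<^sub>a E (Suc 0)) = E (Suc n) \<cdot> snoc C x n"
proof -
  have "mul S \<cdot> (E n \<otimes>\<^sub>a E (Suc 0)) = inc S (n + Suc 0) \<cdot> quo S (n + Suc 0) \<cdot> tcat C x n (Suc 0)"
    unfolding E_def using sym_alg unfolding is_symmetric_algebra_def by blast
  then show ?thesis
    unfolding tcat_1 by (simp add: E_def compA)
qed

text \<open>Uniqueness in \<open>sym_univ\<close>, applied to the symmetric family of restrictions
  of f itself.\<close>

lemma E_epi_S:
  assumes "w \<in> Ob C" "f \<in> Hom C (w \<otimes>\<^sub>o und S) z" "g \<in> Hom C (w \<otimes>\<^sub>o und S) z"
    and *: "\<And>n. f \<cdot> (w \<triangleright> E n) = g \<cdot> (w \<triangleright> E n)"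
  shows "f = g"
proof -
  have sw: "E n \<cdot> swp n i x = E n" if "Suc i < n" for n i
    using that by (simp add: E_def compA quo_swap)
  have "\<exists>!h. h \<in> Hom C (w \<otimes>\<^sub>o und S) z \<and> (\<forall>n. h \<cdot> (w \<triangleright> E n) = f \<cdot> (w \<triangleright> E n))"
    by (rule sym_univ) (use assms(1-3) in \<open>simp_all add: hom_iff compA interchange sw\<close>)
  moreover have "\<forall>n. f \<cdot> (w \<triangleright> E n) = f \<cdot> (w \<triangleright> E n)" "\<forall>n. g \<cdot> (w \<triangleright> E n) = f \<cdot> (w \<triangleright> E n)"
    by (simp_all only: * simp_thms)
  ultimately show ?thesis
    using assms(2,3) by blast
qed

lemma free: "free_monoid R C S x E"
proof -
  interpret S: monoid_in R C S
    by unfold_locales (rule S_monoid)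
  show ?thesis
  proof unfold_locales
    show "E n \<in> Hom C (tpow C x n) (und S)" for n
      by (simp add: hom_iff)
    show "E 0 = uni S"
      using sym_alg by (simp add: is_symmetric_algebra_def E_def)
    show "mul S \<cdot> (E n \<otimes>\<^sub>a E (Suc 0)) = E (Suc n) \<cdot> snoc C x n" for n
      by (rule E_mul)
    show "f = g" if "w \<in> Ob C" "f \<in> Hom C (w \<otimes>\<^sub>o und S) z" "g \<in> Hom C (w \<otimes>\<^sub>o und S) z"
      "\<And>n. f \<cdot> (w \<triangleright> E n) = g \<cdot> (w \<triangleright> E n)" for w f g z
      using that by (rule E_epi_S)
    show "E n \<cdot> swp n i x = E n" if "Suc i < n" for n i
      using that by (simp add: E_def compA quo_swap)
    show "\<exists>h\<in>Hom C (w \<otimes>\<^sub>o und S) z. \<forall>n. h \<cdot> (w \<triangleright> E n) = r n"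
      if "w \<in> Ob C" "z \<in> Ob C" "\<And>n. r n \<in> Hom C (w \<otimes>\<^sub>o tpow C x n) z"
        "\<And>n i. Suc i < n \<Longrightarrow> r n \<cdot> (w \<triangleright> swp n i x) = r n" for w z r
      using sym_univ[of w r z] that by blast
  qed simp
qed

text \<open>A monoid map carries words to words, and an epimorphism stays epi after tensoring with
  w, so joint epimorphy passes from \<open>S\<close> to \<open>A\<close>.\<close>

lemma generated:
  assumes A: "commutative_monoid C A" and g: "monoid_map C S A g" "epi_arrow C g"
  shows "generated_monoid R C A x (\<lambda>n. g \<cdot> E n)"
proof -
  interpret S: monoid_in R C S
    by unfold_locales (rule S_monoid)
  interpret A: monoid_in R C A
    by unfold_locales (rule A)
  have [simp]: "arr g" "src g = und S" "tgt g = und A"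
    using g by (simp_all add: monoid_map_def hom_iff)
  show ?thesis
  proof unfold_locales
    show "g \<cdot> E n \<in> Hom C (tpow C x n) (und A)" for n
      by (simp add: hom_iff)
    show "g \<cdot> E 0 = uni A"
      using g sym_alg by (simp add: is_symmetric_algebra_def E_def monoid_map_def)
    show "mul A \<cdot> ((g \<cdot> E n) \<otimes>\<^sub>a (g \<cdot> E (Suc 0))) = (g \<cdot> E (Suc n)) \<cdot> snoc C x n" for n
    proof -
      have "mul A \<cdot> ((g \<cdot> E n) \<otimes>\<^sub>a (g \<cdot> E (Suc 0))) = (mul A \<cdot> (g \<otimes>\<^sub>a g)) \<cdot> (E n \<otimes>\<^sub>a E (Suc 0))"
        by (simp add: compA interchange)
      also have "mul A \<cdot> (g \<otimes>\<^sub>a g) = g \<cdot> mul S"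
        using g by (simp add: monoid_map_def)
      finally show ?thesis
        by (simp add: compA E_mul)
    qed
    fix w f f' z
    assume *: "w \<in> Ob C" "f \<in> Hom C (w \<otimes>\<^sub>o und A) z" "f' \<in> Hom C (w \<otimes>\<^sub>o und A) z"
      "\<And>n. f \<cdot> (w \<triangleright> (g \<cdot> E n)) = f' \<cdot> (w \<triangleright> (g \<cdot> E n))"
    have "f \<cdot> (w \<triangleright> g) = f' \<cdot> (w \<triangleright> g)"
    proof (rule E_epi_S[of w _ z])
      fix n
      show "(f \<cdot> (w \<triangleright> g)) \<cdot> (w \<triangleright> E n) = (f' \<cdot> (w \<triangleright> g)) \<cdot> (w \<triangleright> E n)"
        using * by (simp add: hom_iff compA interchange)
    qed (use * in \<open>simp_all add: hom_iff\<close>)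
    then show "f = f'"
      by (rule tens_epi[OF g(2) *(1)]) (use * in simp_all)
  qed simp
qed

end

section \<open>The supercategory\<close>

text \<open>Negation is multiplication by -1, so it preserves \<open>K\<close>. The target is any
  structure with the same operations, as submodules and homogeneous parts are obtained by updating
  different record fields.\<close>

lemma module_on_closed_subset:
  assumes M: "module R M" and K: "K \<subseteq> carrier M" "\<zero>\<^bsub>M\<^esub> \<in> K"
    "\<And>v w. v \<in> K \<Longrightarrow> w \<in> K \<Longrightarrow> v \<oplus>\<^bsub>M\<^esub> w \<in> K" "\<And>r v. r \<in> carrier R \<Longrightarrow> v \<in> K \<Longrightarrow> r \<odot>\<^bsub>M\<^esub> v \<in> K"
    and M': "carrier M' = K" "add M' = add M" "zero M' = zero M" "smult M' = smult M"
  shows "module R M'"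
proof -
  interpret module R M
    by (rule M)
  have inv: "\<ominus>\<^bsub>M\<^esub> v \<in> K" if "v \<in> K" for v
  proof -
    have v: "v \<in> carrier M"
      using that K by auto
    have "(\<ominus>\<^bsub>R\<^esub> \<one>\<^bsub>R\<^esub>) \<odot>\<^bsub>M\<^esub> v = \<ominus>\<^bsub>M\<^esub> v"
      using v by (simp add: smult_l_minus)
    then show ?thesis
      using K(4)[of "\<ominus>\<^bsub>R\<^esub> \<one>\<^bsub>R\<^esub>" v] that by simp
  qed
  show ?thesis
  proof (rule moduleI)
    show "abelian_group M'"
    proof (rule abelian_groupI)
      fix v assume "v \<in> carrier M'"
      then show "\<exists>w\<in>carrier M'. w \<oplus>\<^bsub>M'\<^esub> v = \<zero>\<^bsub>M'\<^esub>"
        using K inv by (intro bexI[of _ "\<ominus>\<^bsub>M\<^esub> v"]) (auto simp: M' l_neg)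
    qed (use K in \<open>auto simp: M' a_assoc a_comm a_lcomm subset_iff\<close>)
  qed (use K in \<open>auto simp: M' is_cring smult_l_distr smult_r_distr smult_assoc1 subset_iff\<close>)
qed

context pi_category
begin

lemma pi_Ob' [simp]: "\<pi> \<in> Ob C"
  by (rule pi_Ob)

lemma xi_arr [simp]: "iso_arrow C \<xi>" "arr \<xi>" "src \<xi> = \<pi> \<otimes>\<^sub>o \<pi>" "tgt \<xi> = \<I>"
  using xi_iso xi_Hom by (simp_all add: hom_iff)

lemma pten_Ob [simp]: "x \<in> Ob C \<Longrightarrow> pten C p x \<in> Ob C"
  by (simp add: pten_def)

lemma pten_ar_arr [simp]:
  "arr f \<Longrightarrow> arr (pten_ar C p f)" "arr f \<Longrightarrow> src (pten_ar C p f) = pten C p (src f)"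
  "arr f \<Longrightarrow> tgt (pten_ar C p f) = pten C p (tgt f)"
  by (simp_all add: pten_def pten_ar_def)

lemma pten_0 [simp]: "pten C 0 x = x" "pten_ar C 0 f = f"
  by (simp_all add: pten_def pten_ar_def)

lemma super_carrier:
  "f \<in> carrier (super_hom C x y) \<longleftrightarrow> (\<forall>p. arr (f p) \<and> src (f p) = pten C p x \<and> tgt (f p) = y)"
  by (simp add: super_hom_def hom_iff)

lemma super_ops:
  "\<zero>\<^bsub>super_hom C x y\<^esub> = (\<lambda>p. zer (pten C p x) y)"
  "f \<oplus>\<^bsub>super_hom C x y\<^esub> g = (\<lambda>p. f p \<oplus>\<^bsub>\<H> (pten C p x) y\<^esub> g p)"
  "r \<odot>\<^bsub>super_hom C x y\<^esub> f = (\<lambda>p. r \<odot>\<^bsub>\<H> (pten C p x) y\<^esub> f p)"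
  by (simp_all add: super_hom_def)

lemma super_part:
  "f \<in> part (super_hom C x y) p \<longleftrightarrow> f \<in> carrier (super_hom C x y) \<and> (\<forall>q. q \<noteq> p \<longrightarrow> f q = zer (pten C q x) y)"
  by (auto simp: super_hom_def)

lemma hom_ops_eq:
  "src f = x \<Longrightarrow> tgt f = y \<Longrightarrow> f \<oplus>\<^bsub>\<H> x y\<^esub> g = f \<boxplus> g"
  "src f = x \<Longrightarrow> tgt f = y \<Longrightarrow> f \<ominus>\<^bsub>\<H> x y\<^esub> g = f \<boxminus> g"
  "src f = x \<Longrightarrow> tgt f = y \<Longrightarrow> r \<odot>\<^bsub>\<H> x y\<^esub> f = hsmult r f"
  by (simp_all add: hadd_def hsub_def hsmult_def)

lemma super_module:
  assumes [simp]: "x \<in> Ob C" "y \<in> Ob C"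
  shows "module R (super_hom C x y)"
proof -
  interpret H: module R "\<H> (pten C q x) y" for q
    by (rule hom_module) simp_all
  have c: "f \<in> carrier (super_hom C x y) \<longleftrightarrow> (\<forall>p. f p \<in> carrier (\<H> (pten C p x) y))" for f
    by (simp add: super_carrier hom_carrier)
  show ?thesis
  proof (rule moduleI)
    show "abelian_group (super_hom C x y)"
    proof (rule abelian_groupI)
      fix f assume "f \<in> carrier (super_hom C x y)"
      then show "\<exists>g\<in>carrier (super_hom C x y). g \<oplus>\<^bsub>super_hom C x y\<^esub> f = \<zero>\<^bsub>super_hom C x y\<^esub>"
        by (intro bexI[of _ "\<lambda>p. \<ominus>\<^bsub>\<H> (pten C p x) y\<^esub> f p"]) (simp_all add: c super_ops H.l_neg)
    qed (simp_all add: c super_ops H.a_assoc H.a_comm H.a_lcomm)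
  qed (simp_all add: c super_ops is_cring H.smult_l_distr H.smult_r_distr H.smult_assoc1)
qed

text \<open>Negation in a module is an inverse given by a description, so it is identified
  componentwise through its uniqueness.\<close>

lemma super_minus:
  assumes [simp]: "x \<in> Ob C" "y \<in> Ob C" and f: "f \<in> carrier (super_hom C x y)" and g: "g \<in> carrier (super_hom C x y)"
  shows "(f \<ominus>\<^bsub>super_hom C x y\<^esub> g) p = f p \<boxminus> g p"
proof -
  interpret H: module R "\<H> (pten C q x) y" for q
    by (rule hom_module) simp_all
  interpret M: module R "super_hom C x y"
    by (rule super_module) simp_all
  have c: "f \<in> carrier (super_hom C x y) \<longleftrightarrow> (\<forall>p. f p \<in> carrier (\<H> (pten C p x) y))" for f
    by (simp add: super_carrier hom_carrier)
  have "(\<lambda>p. \<ominus>\<^bsub>\<H> (pten C p x) y\<^esub> g p) = \<ominus>\<^bsub>super_hom C x y\<^esub> g"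
    using g by (intro M.minus_equality[symmetric]) (simp_all add: c super_ops H.l_neg)
  then have "(f \<ominus>\<^bsub>super_hom C x y\<^esub> g) p = f p \<ominus>\<^bsub>\<H> (pten C p x) y\<^esub> g p"
    unfolding a_minus_def by (simp add: super_ops fun_eq_iff)
  also have "f p \<ominus>\<^bsub>\<H> (pten C p x) y\<^esub> g p = f p \<boxminus> g p"
    using f by (intro hom_ops_eq) (simp_all add: super_carrier)
  finally show ?thesis .
qed

lemma comp_split_arr [simp]:
  assumes "x \<in> Ob C"
  shows "arr (comp_split C q p x)" "src (comp_split C q p x) = pten C (q + p) x"
    "tgt (comp_split C q p x) = pten C q (pten C p x)"
  using assms by (cases q; cases p; simp add: comp_split_def pten_def; fail)+

text \<open>With an even arrow on the right, the splitting through \<open>\<xi>\<close> occurs only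
  in a vanishing summand; in the surviving one it is an identity.\<close>

lemma super_comp_even_right:
  assumes f: "f \<in> carrier (super_hom C y z)" and h: "arr h" "src h = x" "tgt h = y" and z: "z \<in> Ob C"
  shows "super_comp C x z f (even_ar C x y h) r = f r \<cdot> pten_ar C r h"
proof -
  have [simp]: "x \<in> Ob C" "y \<in> Ob C"
    using h by auto
  have [simp]: "arr (f p)" "src (f p) = pten C p y" "tgt (f p) = z" for p
    using f by (simp_all add: super_carrier)
  note h [simp] z [simp]
  have z0: "hom_comp C x q (f q) p (zer (pten C p x) y) = zer (pten C (q + p) x) z" for q p
    by (cases q) (simp_all add: hom_comp_def pten_ar_def, simp_all add: pten_def)
  have id: "hom_comp C x r (f r) 0 h = f r \<cdot> pten_ar C r h"
    by (simp add: hom_comp_def comp_split_def)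
  show ?thesis
    by (cases r) (simp_all add: super_comp_def even_ar_def z0 id hom_ops_eq, simp_all add: hom_comp_def comp_split_def hom_ops_eq)
qed

lemma super_comp_even_left:
  assumes f: "f \<in> carrier (super_hom C x y)" and m: "arr m" "src m = y" "tgt m = z" and x: "x \<in> Ob C"
  shows "super_comp C x z (even_ar C y z m) f r = m \<cdot> f r"
proof -
  have [simp]: "z \<in> Ob C" "y \<in> Ob C"
    using m by auto
  have [simp]: "arr (f p)" "src (f p) = pten C p x" "tgt (f p) = y" for p
    using f by (simp_all add: super_carrier)
  note m [simp] x [simp]
  have z0: "hom_comp C x 1 (zer (pten C 1 y) z) p (f p) = zer (pten C (1 + p) x) z" for p
    by (simp add: hom_comp_def)
  have "r + 1 + 1 = r"
    by (cases r) simp_all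
  then show ?thesis
    using z0[of "r + 1"] by (simp add: super_comp_def even_ar_def hom_ops_eq hom_comp_def comp_split_def add.commute)
qed

lemma pass_left_arr [simp]:
  assumes "x \<in> Ob C" "y \<in> Ob C"
  shows "arr (pass_left C p x y)" "src (pass_left C p x y) = pten C p (x \<otimes>\<^sub>o y)" "tgt (pass_left C p x y) = x \<otimes>\<^sub>o pten C p y"
  using assms by (simp_all add: pass_left_def pten_def)

lemma tens_split_arr [simp]:
  assumes "x \<in> Ob C" "y \<in> Ob C"
  shows "arr (tens_split C p q x y)" "src (tens_split C p q x y) = pten C (p + q) (x \<otimes>\<^sub>o y)"
    "tgt (tens_split C p q x y) = pten C p x \<otimes>\<^sub>o pten C q y"
  using assms by (simp_all add: tens_split_def pten_assoc_def) (simp_all add: pten_def)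

lemma super_tens_id_left:
  assumes f: "f \<in> carrier (super_hom C x y)" and [simp]: "x \<in> Ob C" "y \<in> Ob C" "v \<in> Ob C"
  shows "super_tens C v v x y (even_ar C v v (\<i>\<d> v)) f r = (v \<triangleright> f r) \<cdot> pass_left C r v x"
proof -
  have [simp]: "arr (f p)" "src (f p) = pten C p x" "tgt (f p) = y" for p
    using f by (simp_all add: super_carrier)
  have z0: "hom_tens C v x 1 (zer (pten C 1 v) v) p (f p) = zer (pten C (1 + p) (v \<otimes>\<^sub>o x)) (v \<otimes>\<^sub>o y)" for p
    by (simp add: hom_tens_def)
  have "r + 1 + 1 = r"
    by (cases r) simp_all
  moreover have "tens_split C 0 r v x = pass_left C r v x"
    by (simp add: tens_split_def pten_assoc_def comp_split_def)
  ultimately show ?thesis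
    using z0[of "r + 1"] by (simp add: super_tens_def even_ar_def hom_ops_eq hom_tens_def add.commute)
qed

text \<open>An arrow of parity \<open>p\<close> becomes an operator with parameter in \<open>\<pi>\<^sup>p\<close> by composition with
  \<open>plug p\<close>.\<close>

definition pi_pow where
  "pi_pow p = (if p = (0 :: bit) then \<I> else \<pi>)"

definition plug where
  "plug p x = (if p = (0 :: bit) then \<l> x else \<i>\<d> (\<pi> \<otimes>\<^sub>o x))"

lemma pi_pow_Ob [simp]: "pi_pow p \<in> Ob C"
  by (simp add: pi_pow_def)

lemma plug_arr [simp]:
  assumes "x \<in> Ob C"
  shows "arr (plug p x)" "iso_arrow C (plug p x)" "src (plug p x) = pi_pow p \<otimes>\<^sub>o x" "tgt (plug p x) = pten C p x"
  using assms by (simp_all add: plug_def pi_pow_def pten_def)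

lemma pten_ar_plug:
  "arr f \<Longrightarrow> pten_ar C p f \<cdot> plug p (src f) = plug p (tgt f) \<cdot> ((pi_pow p) \<triangleright> f)"
  using lunitor_nat[of f "src f" "tgt f"] by (simp add: pten_ar_def plug_def pi_pow_def hom_iff)

text \<open>After plugging, moving \<pi> to the power p past x is the same structural arrow for both
  parities, so later arguments treat them uniformly.\<close>

lemma pass_left_plug:
  assumes [simp]: "x \<in> Ob C" "y \<in> Ob C"
  shows "pass_left C p x y \<cdot> plug p (x \<otimes>\<^sub>o y)
    = (x \<triangleright> plug p y) \<cdot> \<alpha> x (pi_pow p) y \<cdot> (\<sigma> (pi_pow p) x \<triangleleft> y) \<cdot> \<i>\<n>\<v> (\<alpha> (pi_pow p) x y)"
proof (cases p)
  case zero
  show ?thesis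
    unfolding zero by (rule generic_eqI[of _ "star \<boxtimes> var 0 x \<boxtimes> var 2 y"])
      (simp_all add: pass_left_def plug_def pi_pow_def)
next
  case one
  show ?thesis
    unfolding one by (rule generic_eqI[of _ "var 3 \<pi> \<boxtimes> var 0 x \<boxtimes> var 2 y"])
      (simp_all add: pass_left_def plug_def pi_pow_def)
qed

end

section \<open>Differential operators\<close>

locale pi_monoid = pi_category R C + monoid_in R C A
  for R :: "('r, 'k) ring_scheme" and C :: "('r, 'o, 'm, 'z) pi_category_scheme" (structure)
    and A :: "('o, 'm, 'y) monoid_object_scheme"
begin

abbreviation P where "P n \<equiv> tpow C a n"

lemma T_shift_arr [simp]: "arr (T_shift C A n)" "src (T_shift C A n) = P (Suc (Suc n))" "tgt (T_shift C A n) = P (Suc n)"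
  using tcat_arr[of a 1 n] by (simp_all add: T_shift_def Let_def tpow.simps(3))

lemma tcat_1_arr [simp]:
  "iso_arrow C (tcat C a (Suc 0) n)" "arr (tcat C a (Suc 0) n)" "src (tcat C a (Suc 0) n) = a \<otimes>\<^sub>o P n"
  "tgt (tcat C a (Suc 0) n) = P (Suc n)"
  using tcat_arr[of a 1 n] by simp_all

text \<open>Every composition and tensor product in \<open>T\<close> has an even factor, so
  \<open>T\<close> acts on each parity separately.\<close>

lemma T_eval:
  assumes f: "f \<in> carrier (super_hom C (P (Suc n)) a)"
  shows "T C A n f p = f p \<cdot> pten_ar C p (T_shift C A n)
    \<boxminus> \<mu> \<cdot> (a \<triangleright> f p) \<cdot> pass_left C p a (P (Suc n)) \<cdot> pten_ar C p (\<i>\<n>\<v> (tcat C a (Suc 0) (Suc n)))"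
    "T C A n f \<in> carrier (super_hom C (P (Suc (Suc n))) a)"
proof -
  have [simp]: "arr (f p)" "src (f p) = pten C p (P (Suc n))" "tgt (f p) = a" for p
    using f by (simp_all add: super_carrier)
  let ?c = "P (Suc (Suc n))" and ?b = "P (Suc n)"
  let ?S = "super_comp C ?c a f (even_ar C ?c ?b (T_shift C A n))"
  let ?t = "super_tens C a a ?b a (even_ar C a a (\<i>\<d> a)) f"
  let ?u = "super_comp C ?c (a \<otimes>\<^sub>o a) ?t (even_ar C ?c (a \<otimes>\<^sub>o ?b) (\<i>\<n>\<v> (tcat C a 1 (Suc n))))"
  let ?U = "super_comp C ?c a (even_ar C (a \<otimes>\<^sub>o a) a \<mu>) ?u"
  have S: "?S p = f p \<cdot> pten_ar C p (T_shift C A n)" for p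
    by (rule super_comp_even_right) (simp_all add: f)
  have t: "?t p = (a \<triangleright> f p) \<cdot> pass_left C p a ?b" for p
    by (rule super_tens_id_left) (simp_all add: f)
  have t_c: "?t \<in> carrier (super_hom C (a \<otimes>\<^sub>o ?b) (a \<otimes>\<^sub>o a))"
    unfolding super_carrier t by simp
  have u: "?u p = ?t p \<cdot> pten_ar C p (\<i>\<n>\<v> (tcat C a (Suc 0) (Suc n)))" for p
    unfolding One_nat_def by (rule super_comp_even_right[OF t_c]) (simp_all del: tcat.simps)
  have u_c: "?u \<in> carrier (super_hom C ?c (a \<otimes>\<^sub>o a))"
    unfolding super_carrier u t by (simp del: tcat.simps)
  have U: "?U p = \<mu> \<cdot> (a \<triangleright> f p) \<cdot> pass_left C p a (P (Suc n)) \<cdot> pten_ar C p (\<i>\<n>\<v> (tcat C a (Suc 0) (Suc n)))" for p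
  proof -
    have "?U p = \<mu> \<cdot> ?u p"
      by (rule super_comp_even_left[OF u_c]) simp_all
    then show ?thesis
      unfolding u t by (simp add: compA del: tcat.simps)
  qed
  have S_c: "?S \<in> carrier (super_hom C ?c a)" and U_c: "?U \<in> carrier (super_hom C ?c a)"
    unfolding super_carrier S U by (simp_all del: tcat.simps)
  have T: "T C A n f p = ?S p \<boxminus> ?U p" for p
    unfolding T_def Let_def by (rule super_minus[OF _ _ S_c U_c]) simp_all
  show "T C A n f p = f p \<cdot> pten_ar C p (T_shift C A n)
    \<boxminus> \<mu> \<cdot> (a \<triangleright> f p) \<cdot> pass_left C p a (P (Suc n)) \<cdot> pten_ar C p (\<i>\<n>\<v> (tcat C a (Suc 0) (Suc n)))"
    unfolding T S U ..
  show "T C A n f \<in> carrier (super_hom C ?c a)"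
    unfolding super_carrier T S U by (simp del: tcat.simps)
qed

lemma T_power_carrier:
  assumes "f \<in> carrier (super_hom C a a)"
  shows "T_power C A n f \<in> carrier (super_hom C (P (Suc n)) a)"
  by (induction n) (use assms T_eval(2) in simp_all)

text \<open>The parameter of the n-fold bracket: each bracket puts a further copy of
  \<open>a\<close> in front.\<close>

primrec W where
  "W p 0 = pi_pow p"
| "W p (Suc n) = a \<otimes>\<^sub>o W p n"

text \<open>Moves \<pi> to the power p to the front and keeps the order of the copies of
  \<open>a\<close>, so the newest commutator variable becomes the first factor of the tensor power,
  as in \<open>T\<close>.\<close>

primrec \<kappa> where
  "\<kappa> p 0 = \<i>\<n>\<v> (\<r> (pi_pow p))"
| "\<kappa> p (Suc n) = ((pi_pow p) \<triangleright> tcat C a (Suc 0) n) \<cdot> \<alpha> (pi_pow p) a (P n) \<cdot> (\<sigma> a (pi_pow p) \<triangleleft> (P n))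
     \<cdot> \<i>\<n>\<v> (\<alpha> a (pi_pow p) (P n)) \<cdot> (a \<triangleright> \<kappa> p n)"

lemma W_Ob [simp]: "W p n \<in> Ob C"
  by (induction n) simp_all

lemma \<kappa>_arr [simp]: "iso_arrow C (\<kappa> p n)" "arr (\<kappa> p n)" "src (\<kappa> p n) = W p n" "tgt (\<kappa> p n) = pi_pow p \<otimes>\<^sub>o P n"
proof -
  have "iso_arrow C (\<kappa> p n) \<and> arr (\<kappa> p n) \<and> src (\<kappa> p n) = W p n \<and> tgt (\<kappa> p n) = pi_pow p \<otimes>\<^sub>o P n"
    by (induction n) simp_all
  then show "iso_arrow C (\<kappa> p n)" "arr (\<kappa> p n)" "src (\<kappa> p n) = W p n" "tgt (\<kappa> p n) = pi_pow p \<otimes>\<^sub>o P n"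
    by simp_all
qed

text \<open>\<open>T\<^sup>n \<Delta>\<close> has domain \<open>\<pi>\<^sup>p \<otimes> a\<^bsup>n+1\<^esup>\<close>, which \<open>\<theta> p n\<close> identifies with the domain \<open>W p n \<otimes> a\<close> of the
  \<open>n\<close>-fold bracket of \<open>\<Delta>\<close>.\<close>

definition \<theta> where
  "\<theta> p n = ((pi_pow p) \<triangleright> snoc C a n) \<cdot> \<alpha> (pi_pow p) (P n) a \<cdot> (\<kappa> p n \<triangleleft> a)"

lemma \<theta>_arr [simp]: "iso_arrow C (\<theta> p n)" "arr (\<theta> p n)" "src (\<theta> p n) = W p n \<otimes>\<^sub>o a" "tgt (\<theta> p n) = pi_pow p \<otimes>\<^sub>o P (Suc n)"
  by (simp_all add: \<theta>_def)

text \<open>The two halves agree separately: \<open>T_shift\<close> multiplies the first factor onto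
  the last one, which is \<open>lft\<close>, and the subtracted term multiplies it onto the value,
  which is \<open>out\<close>.\<close>

lemma bracket_T:
  assumes f: "f \<in> carrier (super_hom C (P (Suc n)) a)"
  shows "bracket (W p n) (f p \<cdot> plug p (P (Suc n)) \<cdot> \<theta> p n) = T C A n f p \<cdot> plug p (P (Suc (Suc n))) \<cdot> \<theta> p (Suc n)"
proof -
  have [simp]: "arr (f p)" "src (f p) = pten C p (P (Suc n))" "tgt (f p) = a" for p
    using f by (simp_all add: super_carrier)
  let ?w = "pi_pow p" and ?b = "P (Suc n)" and ?c = "P (Suc (Suc n))" and ?i = "\<i>\<n>\<v> (tcat C a (Suc 0) (Suc n))"
  note [simp del] = tcat.simps
  define h where "h = f p \<cdot> plug p ?b"
  have h [simp]: "arr h" "src h = ?w \<otimes>\<^sub>o ?b" "tgt h = a"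
    by (simp_all add: h_def)
  let ?L = "h \<cdot> (?w \<triangleright> T_shift C A n)"
  let ?K = "\<mu> \<cdot> (a \<triangleright> h) \<cdot> \<alpha> a ?w ?b \<cdot> (\<sigma> ?w a \<triangleleft> ?b) \<cdot> \<i>\<n>\<v> (\<alpha> ?w a ?b) \<cdot> (?w \<triangleright> ?i)"
  have 1: "(f p \<cdot> pten_ar C p (T_shift C A n)) \<cdot> plug p ?c = ?L"
    using pten_ar_plug[of "T_shift C A n" p] by (simp add: compA h_def)
  have "(\<mu> \<cdot> (a \<triangleright> f p) \<cdot> pass_left C p a ?b \<cdot> pten_ar C p ?i) \<cdot> plug p ?c
      = \<mu> \<cdot> (a \<triangleright> f p) \<cdot> pass_left C p a ?b \<cdot> (pten_ar C p ?i \<cdot> plug p ?c)"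
    by (simp add: compA)
  also have "\<dots> = \<mu> \<cdot> (a \<triangleright> f p) \<cdot> (pass_left C p a ?b \<cdot> plug p (a \<otimes>\<^sub>o ?b)) \<cdot> (?w \<triangleright> ?i)"
    using pten_ar_plug[of ?i p] by (simp add: compA)
  also have "\<dots> = ?K"
    unfolding pass_left_plug[OF a_Ob tpow_Ob[OF a_Ob]] by (simp add: compA interchange' h_def)
  finally have 2: "(\<mu> \<cdot> (a \<triangleright> f p) \<cdot> pass_left C p a ?b \<cdot> pten_ar C p ?i) \<cdot> plug p ?c = ?K" .
  have "T C A n f p \<cdot> plug p ?c \<cdot> \<theta> p (Suc n) = (T C A n f p \<cdot> plug p ?c) \<cdot> \<theta> p (Suc n)"
    using T_eval(2)[OF f] by (simp add: compA super_carrier)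
  also have "T C A n f p \<cdot> plug p ?c = ?L \<boxminus> ?K"
    unfolding T_eval(1)[OF f] 1[symmetric] 2[symmetric] by (rule hsub_comp) simp_all
  also have "(?L \<boxminus> ?K) \<cdot> \<theta> p (Suc n) = ?L \<cdot> \<theta> p (Suc n) \<boxminus> ?K \<cdot> \<theta> p (Suc n)"
    by (rule hsub_comp) simp_all
  finally have 3: "T C A n f p \<cdot> plug p ?c \<cdot> \<theta> p (Suc n) = ?L \<cdot> \<theta> p (Suc n) \<boxminus> ?K \<cdot> \<theta> p (Suc n)" .
  \<comment> \<open>The iterated parameter is entered through the inverse of
    \<open>\<kappa> p n\<close>, so that \<open>\<theta>\<close> evaluates to an explicit term with
    a single variable for the tensor power.\<close>
  let ?v = "var 0 a" and ?p = "var 2 ?w" and ?B = "var 3 (P n)" and ?d = "var 4 a"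
  let ?t = "(?v \<boxtimes> app (\<i>\<n>\<v> (\<kappa> p n)) (?p \<boxtimes> ?B)) \<boxtimes> ?d"
  have th: "app (\<theta> p (Suc n)) ?t = ?p \<boxtimes> app (tcat C a (Suc 0) n) (?v \<boxtimes> ?B) \<boxtimes> ?d"
    by (simp add: \<theta>_def snoc_def tpow.simps(3))
  have i: "app ?i (app (tcat C a (Suc 0) n) (?v \<boxtimes> ?B) \<boxtimes> ?d) = ?v \<boxtimes> app (snoc C a n) (?B \<boxtimes> ?d)"
  proof (rule app_inv)
    show "app (tcat C a (Suc 0) (Suc n)) (?v \<boxtimes> app (snoc C a n) (?B \<boxtimes> ?d)) = app (tcat C a (Suc 0) n) (?v \<boxtimes> ?B) \<boxtimes> ?d"
      using app_tcat_Suc[of a ?v ?B ?d "Suc 0" n] by (simp add: snoc_def[of C a "Suc n"] tpow.simps(3))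
  qed simp_all
  have sh: "app (T_shift C A n) (app (tcat C a (Suc 0) n) (?v \<boxtimes> ?B) \<boxtimes> ?d) = app (snoc C a n) (?B \<boxtimes> app \<mu> (?v \<boxtimes> ?d))"
    by (simp add: T_shift_def Let_def)
  have ty_c: "P (Suc (Suc n)) = ?b \<otimes>\<^sub>o a"
    by (simp add: tpow.simps(3))
  have "lft (W p n) (h \<cdot> \<theta> p n) = ?L \<cdot> \<theta> p (Suc n)"
    by (rule generic_eqI[of _ ?t]) (simp_all add: opr_defs th sh ty_c, simp_all add: \<theta>_def)
  moreover have "out (W p n) (h \<cdot> \<theta> p n) = ?K \<cdot> \<theta> p (Suc n)"
    by (rule generic_eqI[of _ ?t]) (simp_all add: opr_defs th i ty_c, simp_all add: \<theta>_def)
  moreover have "f p \<cdot> plug p ?b \<cdot> \<theta> p n = h \<cdot> \<theta> p n"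
    by (simp add: h_def compA)
  ultimately show ?thesis
    unfolding 3 bracket_def by simp
qed

text \<open>\<open>U n\<close> is the n-fold bracket of the operator of parity p, and it differs
  from the nth iterate of \<open>T\<close> only by the isomorphisms \<open>plug\<close> and
  \<open>\<theta>\<close>.\<close>

lemma T_power_has_order:
  assumes f: "f \<in> carrier (super_hom C a a)"
  shows "T_power C A m f p = zer (pten C p (P (Suc m))) a \<longleftrightarrow> has_order m (pi_pow p) (f p \<cdot> plug p a)"
proof -
  define U where "U n = T_power C A n f p \<cdot> plug p (P (Suc n)) \<cdot> \<theta> p n" for n
  have T: "arr (T_power C A n f p)" "src (T_power C A n f p) = pten C p (P (Suc n))" "tgt (T_power C A n f p) = a" for n
    using T_power_carrier[OF f, of n] by (simp_all add: super_carrier)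
  have U_arr: "arr (U n)" "src (U n) = W p n \<otimes>\<^sub>o a" "tgt (U n) = a" for n
    by (simp_all add: U_def T)
  have U_Suc: "bracket (W p n) (U n) = U (Suc n)" for n
    unfolding U_def using bracket_T[OF T_power_carrier[OF f]] by simp
  have has_order_U: "has_order l (W p n) (U n) \<longleftrightarrow> U (n + l) = zer (W p (n + l) \<otimes>\<^sub>o a) a" for l n
    by (induction l arbitrary: n) (simp_all add: U_Suc flip: W.simps(2))
  have "\<theta> p 0 = \<i>\<d> (pi_pow p \<otimes>\<^sub>o a)"
    by (rule generic_eqI[of _ "var 0 (pi_pow p) \<boxtimes> var 2 a"]) (simp_all, simp add: \<theta>_def snoc_def)
  then have U_0: "U 0 = f p \<cdot> plug p a"
    using f by (simp add: U_def super_carrier)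
  have "U m = zer (W p m \<otimes>\<^sub>o a) a \<longleftrightarrow> T_power C A m f p = zer (pten C p (P (Suc m))) a"
  proof
    assume "U m = zer (W p m \<otimes>\<^sub>o a) a"
    then have "T_power C A m f p \<cdot> (plug p (P (Suc m)) \<cdot> \<theta> p m)
       = zer (pten C p (P (Suc m))) a \<cdot> (plug p (P (Suc m)) \<cdot> \<theta> p m)"
      by (simp add: U_def)
    then show "T_power C A m f p = zer (pten C p (P (Suc m))) a"
      by (rule iso_cancel_right) (simp_all add: T)
  qed (simp add: U_def)
  then show ?thesis
    using has_order_U[of m 0] by (simp add: U_0)
qed

end

section \<open>Supermodule structures\<close>

context pi_category
begin

text \<open>Serves both the full hom-supermodule and the differential operators. Closure of
  \<open>K\<close> under homogeneous components is what makes the decomposition stay inside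
  \<open>K\<close>.\<close>

lemma super_supermodule_on:
  assumes [simp]: "x \<in> Ob C" "y \<in> Ob C"
    and K: "K \<subseteq> carrier (super_hom C x y)" "(\<lambda>p. zer (pten C p x) y) \<in> K"
      "\<And>f g. f \<in> K \<Longrightarrow> g \<in> K \<Longrightarrow> (\<lambda>p. f p \<boxplus> g p) \<in> K"
      "\<And>r f. r \<in> carrier R \<Longrightarrow> f \<in> K \<Longrightarrow> (\<lambda>p. hsmult r (f p)) \<in> K"
      "\<And>f p. f \<in> K \<Longrightarrow> (\<lambda>q. if q = p then f q else zer (pten C q x) y) \<in> K"
    and M: "M = (super_hom C x y)\<lparr>carrier := K, part := (\<lambda>p. part (super_hom C x y) p \<inter> K)\<rparr>"
  shows "supermodule R M"
proof -
  let ?S = "super_hom C x y"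
  have K_arr: "arr (f p)" "src (f p) = pten C p x" "tgt (f p) = y" if "f \<in> K" for f p
    using that K(1) by (auto simp: super_carrier)
  have add: "f \<oplus>\<^bsub>?S\<^esub> g = (\<lambda>p. f p \<boxplus> g p)" if "f \<in> K" for f g
    using K_arr[OF that] by (simp add: super_ops hom_ops_eq)
  have smult: "r \<odot>\<^bsub>?S\<^esub> f = (\<lambda>p. hsmult r (f p))" if "f \<in> K" for f r
    using K_arr[OF that] by (simp add: super_ops hom_ops_eq)
  have zero: "\<zero>\<^bsub>?S\<^esub> = (\<lambda>p. zer (pten C p x) y)"
    by (simp add: super_ops)
  have M_ops: "add M = add ?S" "zero M = zero ?S" "smult M = smult ?S" "carrier M = K"
    "part M p = part ?S p \<inter> K" for p
    by (simp_all add: M)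
  have module_M: "module R M"
    by (rule module_on_closed_subset[OF super_module[OF assms(1,2)], where K = K]) (use K in \<open>simp_all add: M_ops add smult zero\<close>)
  interpret M: module R M
    by (rule module_M)
  show ?thesis
  proof (intro supermodule.intro supermodule_axioms.intro module_M)
    fix p
    let ?P = "part M p"
    have P: "f \<in> ?P \<longleftrightarrow> f \<in> K \<and> (\<forall>q. q \<noteq> p \<longrightarrow> f q = zer (pten C q x) y)" for f
      using K(1) by (auto simp: M_ops super_part)
    show "submodule ?P R M"
    proof (rule M.module_incl_imp_submodule)
      show "?P \<subseteq> carrier M"
        by (simp add: M_ops)
      show "module R (M\<lparr>carrier := ?P\<rparr>)"
      proof (rule module_on_closed_subset[OF super_module[OF assms(1,2)], where K = ?P])
        show "?P \<subseteq> carrier ?S"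
          using K(1) by (auto simp: M_ops)
        show "\<zero>\<^bsub>?S\<^esub> \<in> ?P"
          using K(2) by (simp add: P zero)
        show "f \<oplus>\<^bsub>?S\<^esub> g \<in> ?P" if "f \<in> ?P" "g \<in> ?P" for f g
          using that K(3) by (simp add: P add)
        show "r \<odot>\<^bsub>?S\<^esub> f \<in> ?P" if "r \<in> carrier R" "f \<in> ?P" for r f
          using that K(4) by (simp add: P smult)
      qed (simp_all add: M_ops)
    qed
  next
    fix v assume "v \<in> carrier M"
    then have v: "v \<in> K"
      by (simp add: M_ops)
    note v_arr [simp] = K_arr[OF v]
    define u where "u p = (\<lambda>q. if q = p then v q else zer (pten C q x) y)" for p :: bit
    have u: "u p \<in> part M p" for p
      using K(1) K(5)[OF v, of p] by (auto simp: M_ops super_part u_def)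
    have sum: "v = u 0 \<oplus>\<^bsub>M\<^esub> u 1"
    proof
      fix p
      show "v p = (u 0 \<oplus>\<^bsub>M\<^esub> u 1) p"
        by (cases p) (simp_all add: M_ops super_ops u_def hom_ops_eq)
    qed
    show "\<exists>!w. fst w \<in> part M 0 \<and> snd w \<in> part M 1 \<and> v = fst w \<oplus>\<^bsub>M\<^esub> snd w"
    proof (rule ex1I[of _ "(u 0, u 1)"])
      show "fst (u 0, u 1) \<in> part M 0 \<and> snd (u 0, u 1) \<in> part M 1 \<and> v = fst (u 0, u 1) \<oplus>\<^bsub>M\<^esub> snd (u 0, u 1)"
        using u sum by simp
      fix w assume w: "fst w \<in> part M 0 \<and> snd w \<in> part M 1 \<and> v = fst w \<oplus>\<^bsub>M\<^esub> snd w"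
      then have wK: "fst w \<in> K" "snd w \<in> K" and w0: "fst w 1 = zer (pten C 1 x) y" "snd w 0 = zer (pten C 0 x) y"
        by (auto simp: M_ops super_part)
      note w_arr [simp] = K_arr[OF wK(1)] K_arr[OF wK(2)]
      have v_eq: "v p = fst w p \<boxplus> snd w p" for p
        using w wK by (simp add: M_ops add)
      have "v 0 = fst w 0" "v 1 = snd w 1"
        unfolding v_eq w0 by (simp_all add: pten_0(1)[symmetric] del: pten_0(1))
      then have "fst w p = u 0 p" "snd w p = u 1 p" for p
        using w0 by (cases p; simp add: u_def)+
      then show "w = (u 0, u 1)"
        by (simp add: prod_eq_iff fun_eq_iff)
    qed
  qed
qed

lemma super_hom_supermodule:
  assumes [simp]: "x \<in> Ob C" "y \<in> Ob C"
  shows "supermodule R (super_hom C x y)"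
proof (rule super_supermodule_on[where K = "carrier (super_hom C x y)"])
  have "part (super_hom C x y) p \<inter> carrier (super_hom C x y) = part (super_hom C x y) p" for p
    by (auto simp: super_part)
  then show "super_hom C x y = (super_hom C x y)\<lparr>carrier := carrier (super_hom C x y),
      part := (\<lambda>p. part (super_hom C x y) p \<inter> carrier (super_hom C x y))\<rparr>"
    by simp
qed (simp_all add: super_carrier)

end

context pi_monoid
begin

text \<open>Order at most k becomes \<open>has_order (Suc k)\<close> for each parity; the operator
  \<open>T\<close> has done its work here.\<close>

lemma diff_ops_carrier:
  "\<Delta> \<in> carrier (diff_ops C k A) \<longleftrightarrow>
     \<Delta> \<in> carrier (super_hom C a a) \<and> (\<forall>p. has_order (Suc k) (pi_pow p) (\<Delta> p \<cdot> plug p a))"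
proof -
  have "T_power C A (Suc k) \<Delta> = \<zero>\<^bsub>super_hom C (P (k + 2)) a\<^esub> \<longleftrightarrow> (\<forall>p. has_order (Suc k) (pi_pow p) (\<Delta> p \<cdot> plug p a))"
    if \<Delta>: "\<Delta> \<in> carrier (super_hom C a a)"
    by (simp only: T_power_has_order[OF \<Delta>, symmetric] super_ops fun_eq_iff add_2_eq_Suc')
  then show ?thesis
    by (auto simp: diff_ops_def Let_def simp del: T_power.simps)
qed

lemma opr_plug:
  assumes "f \<in> carrier (super_hom C a a)"
  shows "opr (pi_pow p) (f p \<cdot> plug p a)"
  using assms by (simp add: opr_def super_carrier)

lemma diff_ops_supermodule: "supermodule R (diff_ops C k A)"
proof (rule super_supermodule_on[of a a "carrier (diff_ops C k A)"])
  have "part (super_hom C a a) p \<inter> (carrier (super_hom C a a) \<inter> K) = part (super_hom C a a) p \<inter> K" for p K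
    by (auto simp: super_part)
  then show "diff_ops C k A = (super_hom C a a)\<lparr>carrier := carrier (diff_ops C k A),
     part := (\<lambda>p. part (super_hom C a a) p \<inter> carrier (diff_ops C k A))\<rparr>"
    by (simp add: diff_ops_def Let_def del: T_power.simps)
  show "(\<lambda>p. zer (pten C p a) a) \<in> carrier (diff_ops C k A)"
    unfolding diff_ops_carrier by (simp add: super_carrier has_order_zer del: has_order.simps)
next
  fix f g assume fg: "f \<in> carrier (diff_ops C k A)" "g \<in> carrier (diff_ops C k A)"
  then have c: "f \<in> carrier (super_hom C a a)" "g \<in> carrier (super_hom C a a)"
    by (simp_all add: diff_ops_carrier)
  then have [simp]: "arr (f p)" "src (f p) = pten C p a" "tgt (f p) = a" "arr (g p)" "src (g p) = pten C p a" "tgt (g p) = a" for p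
    by (simp_all add: super_carrier)
  have "has_order (Suc k) (pi_pow p) ((f p \<boxplus> g p) \<cdot> plug p a)" for p
  proof -
    have "(f p \<boxplus> g p) \<cdot> plug p a = f p \<cdot> plug p a \<boxplus> g p \<cdot> plug p a"
      by (rule hadd_comp) simp_all
    then show ?thesis
      using fg has_order_hadd[OF opr_plug[OF c(1)] opr_plug[OF c(2)]] by (simp only: diff_ops_carrier)
  qed
  then show "(\<lambda>p. f p \<boxplus> g p) \<in> carrier (diff_ops C k A)"
    by (simp add: diff_ops_carrier super_carrier del: has_order.simps)
next
  fix r f assume r: "r \<in> carrier R" and f: "f \<in> carrier (diff_ops C k A)"
  then have c: "f \<in> carrier (super_hom C a a)"
    by (simp add: diff_ops_carrier)
  then have [simp]: "arr (f p)" "src (f p) = pten C p a" "tgt (f p) = a" for p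
    by (simp_all add: super_carrier)
  have "has_order (Suc k) (pi_pow p) (hsmult r (f p) \<cdot> plug p a)" for p
  proof -
    have "hsmult r (f p) \<cdot> plug p a = hsmult r (f p \<cdot> plug p a)"
      by (rule hsmult_comp) (use r in simp_all)
    then show ?thesis
      using f has_order_hsmult[OF r opr_plug[OF c]] by (simp only: diff_ops_carrier)
  qed
  then show "(\<lambda>p. hsmult r (f p)) \<in> carrier (diff_ops C k A)"
    using r by (simp add: diff_ops_carrier super_carrier del: has_order.simps)
next
  fix f p assume f: "f \<in> carrier (diff_ops C k A)"
  \<comment> \<open>The order condition concerns each parity separately and zero has every order, so
    a homogeneous component is again an operator of order at most k.\<close>
  then show "(\<lambda>q. if q = p then f q else zer (pten C q a) a) \<in> carrier (diff_ops C k A)"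
    by (simp add: diff_ops_carrier super_carrier has_order_zer del: has_order.simps)
qed (auto simp: diff_ops_carrier)

end

section \<open>Restriction to the truncated symmetric algebra\<close>

lemma (in pi_category) precomp_eval:
  assumes "\<Delta> \<in> carrier (super_hom C s a)" "arr h" "src h = b" "tgt h = s" "a \<in> Ob C"
  shows "precomp C b s a h \<Delta> p = \<Delta> p \<cdot> pten_ar C p h"
  unfolding precomp_def by (rule super_comp_even_right) (use assms in simp_all)

lemma (in pi_category) precomp_carrier:
  assumes "\<Delta> \<in> carrier (super_hom C s a)" "arr h" "src h = b" "tgt h = s" "a \<in> Ob C"
  shows "precomp C b s a h \<Delta> \<in> carrier (super_hom C b a)"
  unfolding super_carrier precomp_eval[OF assms] using assms by (simp add: super_carrier)

locale pi_symmetric_algebra = pi_category R C + symmetric_algebra_in R C small x S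
  for R :: "('r, 'k) ring_scheme" and C :: "('r, 'o, 'm, 'z) pi_category_scheme" (structure)
    and small :: "'s itself" and x and S :: "('o, 'm, 'y) symmetric_algebra_scheme" +
  fixes k :: nat and b j
  assumes truncation: "is_truncation C S k b j"
begin

abbreviation can where "can \<equiv> truncation_map C S k b j"

lemma trunc_coprod: "is_coproduct C {..k} (spow S) b j"
  using truncation by (simp add: is_truncation_def)

lemma b_Ob [simp]: "b \<in> Ob C"
  using trunc_coprod by (simp add: is_coproduct_def)

lemma und_Ob [simp]: "und S \<in> Ob C"
  using tgt_Ob[OF inc_arr(1)] by simp

lemma j_arr [simp]: "n \<le> k \<Longrightarrow> arr (j n)" "n \<le> k \<Longrightarrow> src (j n) = spow S n" "n \<le> k \<Longrightarrow> tgt (j n) = b"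
  using trunc_coprod by (simp_all add: is_coproduct_def hom_iff)

lemma can: "can \<in> Hom C b (und S) \<and> (\<forall>n\<in>{..k}. can \<cdot> j n = inc S n)"
proof -
  have "\<exists>!h. h \<in> Hom C b (und S) \<and> (\<forall>n\<in>{..k}. h \<cdot> j n = inc S n)"
    using trunc_coprod unfolding is_coproduct_def by (auto simp: hom_iff)
  then show ?thesis
    unfolding truncation_map_def cotuple_def by (rule theI')
qed

lemma can_arr [simp]: "arr can" "src can = b" "tgt can = und S"
  using can by (simp_all add: hom_iff)

lemma can_E: "n \<le> k \<Longrightarrow> can \<cdot> j n \<cdot> quo S n = E n"
  using can by (simp add: E_def compA[symmetric])

text \<open>Words of length at most k are jointly epi onto the truncation, also with a parameter:
  uniqueness for the tensored quotients is followed by uniqueness for the tensored finite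
  coproduct.\<close>

lemma trunc_epi:
  assumes w [simp]: "w \<in> Ob C" and f: "f \<in> Hom C (w \<otimes>\<^sub>o b) z" "f' \<in> Hom C (w \<otimes>\<^sub>o b) z"
    and eq: "\<And>n. n \<le> k \<Longrightarrow> f \<cdot> (w \<triangleright> (j n \<cdot> quo S n)) = f' \<cdot> (w \<triangleright> (j n \<cdot> quo S n))"
  shows "f = f'"
proof -
  have [simp]: "arr f" "src f = w \<otimes>\<^sub>o b" "tgt f = z" "arr f'" "src f' = w \<otimes>\<^sub>o b" "tgt f' = z"
    using f by (simp_all add: hom_iff)
  have *: "f \<cdot> (w \<triangleright> j n) = f' \<cdot> (w \<triangleright> j n)" if n: "n \<le> k" for n
  proof -
    let ?r = "f \<cdot> (w \<triangleright> (j n \<cdot> quo S n))"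
    have "?r \<cdot> (w \<triangleright> swp n i x) = ?r" if "Suc i < n" for i
      using n that by (simp add: compA interchange quo_swap)
    then have "\<exists>!h. h \<in> Hom C (w \<otimes>\<^sub>o spow S n) z \<and> h \<cdot> (w \<triangleright> quo S n) = ?r"
      by (intro tens_quo[OF quo_coeq]) (use n in \<open>simp_all add: hom_iff\<close>)
    moreover have "f \<cdot> (w \<triangleright> j n) \<in> Hom C (w \<otimes>\<^sub>o spow S n) z" "f' \<cdot> (w \<triangleright> j n) \<in> Hom C (w \<otimes>\<^sub>o spow S n) z"
      "(f \<cdot> (w \<triangleright> j n)) \<cdot> (w \<triangleright> quo S n) = ?r"
      using n by (simp_all add: hom_iff compA interchange)
    moreover have "(f' \<cdot> (w \<triangleright> j n)) \<cdot> (w \<triangleright> quo S n) = ?r"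
      unfolding eq[OF n] using n by (simp add: compA interchange)
    ultimately show ?thesis
      by blast
  qed
  have "is_coproduct C {..k} (\<lambda>n. w \<otimes>\<^sub>o spow S n) (w \<otimes>\<^sub>o b) (\<lambda>n. w \<triangleright> j n)"
    by (rule tens_coproduct[OF trunc_coprod w])
  then have "\<exists>!h. h \<in> Hom C (w \<otimes>\<^sub>o b) z \<and> (\<forall>n\<in>{..k}. h \<cdot> (w \<triangleright> j n) = f \<cdot> (w \<triangleright> j n))"
    unfolding is_coproduct_def
    by (elim conjE allE[of _ z] allE[of _ "\<lambda>n. f \<cdot> (w \<triangleright> j n)"]) (use Hom_Ob[OF f(1)] in \<open>auto simp: hom_iff\<close>)
  moreover have "\<forall>n\<in>{..k}. f' \<cdot> (w \<triangleright> j n) = f \<cdot> (w \<triangleright> j n)"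
    using * by simp
  ultimately show ?thesis
    using f by blast
qed

lemma precomp_inj:
  assumes A: "commutative_monoid C A" and g: "monoid_map C S A g" "epi_arrow C g"
  shows "inj_on (precomp C b (und A) (und A) (g \<cdot> can)) (carrier (diff_ops C k A))"
proof (rule inj_onI)
  interpret generated_monoid R C A x "\<lambda>n. g \<cdot> E n"
    by (rule generated[OF A g])
  interpret pi_monoid R C A
    by unfold_locales
  have [simp]: "arr g" "src g = und S" "tgt g = a"
    using g by (simp_all add: monoid_map_def hom_iff)
  fix f f' assume ff: "f \<in> carrier (diff_ops C k A)" "f' \<in> carrier (diff_ops C k A)"
    and eq: "precomp C b a a (g \<cdot> can) f = precomp C b a a (g \<cdot> can) f'"
  have c: "f \<in> carrier (super_hom C a a)" "f' \<in> carrier (super_hom C a a)"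
    using ff by (simp_all add: diff_ops_carrier)
  then have [simp]: "arr (f p)" "src (f p) = pten C p a" "tgt (f p) = a"
    "arr (f' p)" "src (f' p) = pten C p a" "tgt (f' p) = a" for p
    by (simp_all add: super_carrier)
  have eq': "f p \<cdot> pten_ar C p (g \<cdot> can) = f' p \<cdot> pten_ar C p (g \<cdot> can)" for p
    using fun_cong[OF eq, of p] precomp_eval[OF c(1)] precomp_eval[OF c(2)] by simp
  show "f = f'"
  proof
    fix p
    let ?h = "f p \<cdot> plug p a" and ?h' = "f' p \<cdot> plug p a"
    have op: "opr (pi_pow p) ?h" "opr (pi_pow p) ?h'"
      using opr_plug c by blast+
    have "?h \<boxminus> ?h' = zer (pi_pow p \<otimes>\<^sub>o a) a"
    proof (rule has_order_vanish[where m = "Suc k"])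
      show "opr (pi_pow p) (?h \<boxminus> ?h')"
        using op by (rule opr_hsub)
      show "has_order (Suc k) (pi_pow p) (?h \<boxminus> ?h')"
        using op ff by (intro has_order_hsub) (simp_all only: diff_ops_carrier)
      fix n assume "n < Suc k"
      then have n: "n \<le> k"
        by simp
      \<comment> \<open>Words of length at most k factor through the truncation, so restrictions
        along \<open>can\<close> determine the values on them.\<close>
      have e: "u \<cdot> plug p a \<cdot> ((pi_pow p) \<triangleright> (g \<cdot> E n))
          = (u \<cdot> pten_ar C p (g \<cdot> can)) \<cdot> plug p b \<cdot> ((pi_pow p) \<triangleright> (j n \<cdot> quo S n))"
        if [simp]: "arr u" "src u = pten C p a" for u
      proof -
        have "(u \<cdot> pten_ar C p (g \<cdot> can)) \<cdot> plug p b \<cdot> ((pi_pow p) \<triangleright> (j n \<cdot> quo S n))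
          = u \<cdot> (pten_ar C p (g \<cdot> can) \<cdot> plug p b) \<cdot> ((pi_pow p) \<triangleright> (j n \<cdot> quo S n))"
          using n by (simp add: compA)
        also have "pten_ar C p (g \<cdot> can) \<cdot> plug p b = plug p a \<cdot> ((pi_pow p) \<triangleright> (g \<cdot> can))"
          using pten_ar_plug[of "g \<cdot> can" p] by simp
        finally show ?thesis
          using n by (simp add: compA interchange flip: can_E)
      qed
      have "?h \<cdot> ((pi_pow p) \<triangleright> (g \<cdot> E n)) = ?h' \<cdot> ((pi_pow p) \<triangleright> (g \<cdot> E n))"
        using e[of "f p"] e[of "f' p"] eq'[of p] by (simp add: compA)
      moreover have "(?h \<boxminus> ?h') \<cdot> ((pi_pow p) \<triangleright> (g \<cdot> E n))
          = ?h \<cdot> ((pi_pow p) \<triangleright> (g \<cdot> E n)) \<boxminus> ?h' \<cdot> ((pi_pow p) \<triangleright> (g \<cdot> E n))"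
        by (rule hsub_comp) simp_all
      ultimately show "(?h \<boxminus> ?h') \<cdot> ((pi_pow p) \<triangleright> (g \<cdot> E n)) = zer (pi_pow p \<otimes>\<^sub>o X n) a"
        by simp
    qed
    then have "?h = ?h'"
      by (rule hsub_eq_zer) simp_all
    then show "f p = f' p"
      by (rule iso_cancel_right) simp_all
  qed
qed

text \<open>The prescribed arrow is read as values on words of length at most k, symmetric because
  the quotients are. Each parity is realised by its own operator with parameter.\<close>

lemma precomp_surj:
  assumes \<phi>: "\<phi> \<in> carrier (super_hom C b (und S))"
  shows "\<exists>\<Delta> \<in> carrier (diff_ops C k S). precomp C b (und S) (und S) can \<Delta> = \<phi>"
proof -
  interpret free_monoid R C S x E
    by (rule free)
  interpret pi_monoid R C S
    by unfold_locales
  have [simp]: "arr (\<phi> p)" "src (\<phi> p) = pten C p b" "tgt (\<phi> p) = a" for p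
    using \<phi> by (simp_all add: super_carrier)
  let ?r = "\<lambda>p n. \<phi> p \<cdot> plug p b \<cdot> ((pi_pow p) \<triangleright> (j n \<cdot> quo S n))"
  have "\<exists>f. opr (pi_pow p) f \<and> has_order (Suc k) (pi_pow p) f \<and> (\<forall>n<Suc k. f \<cdot> ((pi_pow p) \<triangleright> E n) = ?r p n)" for p
    by (rule has_order_exists) (simp_all add: hom_iff compA interchange quo_swap)
  then obtain f where f: "\<And>p. opr (pi_pow p) (f p)" "\<And>p. has_order (Suc k) (pi_pow p) (f p)"
    "\<And>p n. n < Suc k \<Longrightarrow> f p \<cdot> ((pi_pow p) \<triangleright> E n) = ?r p n"
    by metis
  have [simp]: "arr (f p)" "src (f p) = pi_pow p \<otimes>\<^sub>o a" "tgt (f p) = a" for p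
    using f(1)[of p] by (simp_all add: opr_def)
  define \<Delta> where "\<Delta> p = f p \<cdot> \<i>\<n>\<v> (plug p a)" for p
  have \<Delta>_arr [simp]: "arr (\<Delta> p)" "src (\<Delta> p) = pten C p a" "tgt (\<Delta> p) = a" for p
    by (simp_all add: \<Delta>_def)
  have \<Delta>_plug: "\<Delta> p \<cdot> plug p a = f p" for p
    by (simp add: \<Delta>_def compA)
  have c: "\<Delta> \<in> carrier (super_hom C a a)"
    by (simp add: super_carrier)
  have "precomp C b a a can \<Delta> p = \<phi> p" for p
  proof -
    have "f p \<cdot> ((pi_pow p) \<triangleright> can) = \<phi> p \<cdot> plug p b"
    \<comment> \<open>The values were prescribed on words only; joint epimorphy turns this into
      equality on the truncation.\<close>
    proof (rule trunc_epi[of "pi_pow p" _ a])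
      fix n assume n: "n \<le> k"
      have "(f p \<cdot> ((pi_pow p) \<triangleright> can)) \<cdot> ((pi_pow p) \<triangleright> (j n \<cdot> quo S n)) = f p \<cdot> ((pi_pow p) \<triangleright> E n)"
        using n by (simp add: compA interchange can_E)
      then show "(f p \<cdot> ((pi_pow p) \<triangleright> can)) \<cdot> ((pi_pow p) \<triangleright> (j n \<cdot> quo S n))
        = (\<phi> p \<cdot> plug p b) \<cdot> ((pi_pow p) \<triangleright> (j n \<cdot> quo S n))"
        using n f(3)[of n p] by (simp add: compA)
    qed (simp_all add: hom_iff)
    then have "\<Delta> p \<cdot> (plug p a \<cdot> ((pi_pow p) \<triangleright> can)) = \<phi> p \<cdot> plug p b"
      by (simp add: \<Delta>_plug compA[symmetric])
    then have "(\<Delta> p \<cdot> pten_ar C p can) \<cdot> plug p b = \<phi> p \<cdot> plug p b"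
      using pten_ar_plug[of can p] by (simp add: compA)
    then have "\<Delta> p \<cdot> pten_ar C p can = \<phi> p"
      by (rule iso_cancel_right) simp_all
    then show ?thesis
      using precomp_eval[OF c] by simp
  qed
  then have "precomp C b a a can \<Delta> = \<phi>"
    by (rule ext)
  moreover have "\<Delta> \<in> carrier (diff_ops C k S)"
    unfolding diff_ops_carrier \<Delta>_plug using c f(2) by blast
  ultimately show ?thesis
    by blast
qed

lemma precomp_iso:
  "supermodule_iso R (diff_ops C k S) (super_hom C b (und S)) (precomp C b (und S) (und S) can)"
proof -
  interpret free_monoid R C S x E
    by (rule free)
  interpret pi_monoid R C S
    by unfold_locales
  let ?h = "precomp C b a a can"
  have c: "\<Delta> \<in> carrier (super_hom C a a)" if "\<Delta> \<in> carrier (diff_ops C k S)" for \<Delta>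
    using that by (simp add: diff_ops_carrier)
  \<comment> \<open>Injectivity is the case of the first claim in which the monoid is
    \<open>S\<close> itself and the epimorphism is the identity.\<close>
  have "monoid_map C S S (\<i>\<d> a)" "epi_arrow C (\<i>\<d> a)"
    unfolding monoid_map_def epi_arrow_def by (auto simp: hom_iff)
  from precomp_inj[OF S_monoid this] have inj: "inj_on ?h (carrier (diff_ops C k S))"
    by simp
  have h_eval: "?h \<Delta> p = \<Delta> p \<cdot> pten_ar C p can" if "\<Delta> \<in> carrier (super_hom C a a)" for \<Delta> p
    using that by (rule precomp_eval) simp_all
  have h_carrier: "?h \<Delta> \<in> carrier (super_hom C b a)" if "\<Delta> \<in> carrier (super_hom C a a)" for \<Delta>
    using that by (rule precomp_carrier) simp_all
  have ops: "add (diff_ops C k S) = add (super_hom C a a)" "smult (diff_ops C k S) = smult (super_hom C a a)"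
    by (simp_all add: diff_ops_def Let_def)
  interpret M: module R "super_hom C a a"
    by (rule super_module) simp_all
  show ?thesis
    unfolding supermodule_iso_def
  proof (intro conjI ballI allI)
    show "supermodule R (diff_ops C k S)"
      by (rule diff_ops_supermodule)
    show "supermodule R (super_hom C b a)"
      by (rule super_hom_supermodule) simp_all
    show "bij_betw ?h (carrier (diff_ops C k S)) (carrier (super_hom C b a))"
      unfolding bij_betw_def using inj precomp_surj h_carrier c by (auto simp: image_iff)
  next
    fix v w assume "v \<in> carrier (diff_ops C k S)" "w \<in> carrier (diff_ops C k S)"
    note vw = this[THEN c]
    then have [simp]: "arr (v p)" "src (v p) = pten C p a" "tgt (v p) = a" "arr (w p)" "src (w p) = pten C p a" "tgt (w p) = a" for p
      by (simp_all add: super_carrier)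
    have "?h (v \<oplus>\<^bsub>super_hom C a a\<^esub> w) p = (?h v \<oplus>\<^bsub>super_hom C b a\<^esub> ?h w) p" for p
      using h_eval[OF M.a_closed[OF vw], of p] h_eval[OF vw(1), of p] h_eval[OF vw(2), of p]
      by (simp add: super_ops(2) hom_ops_eq hadd_comp)
    then show "?h (v \<oplus>\<^bsub>diff_ops C k S\<^esub> w) = ?h v \<oplus>\<^bsub>super_hom C b a\<^esub> ?h w"
      unfolding ops by (rule ext)
  next
    fix r v assume r: "r \<in> carrier R" and "v \<in> carrier (diff_ops C k S)"
    note v = this(2)[THEN c]
    then have [simp]: "arr (v p)" "src (v p) = pten C p a" "tgt (v p) = a" for p
      by (simp_all add: super_carrier)
    have "?h (r \<odot>\<^bsub>super_hom C a a\<^esub> v) p = (r \<odot>\<^bsub>super_hom C b a\<^esub> ?h v) p" for p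
      using r h_eval[OF M.smult_closed[OF r v], of p] h_eval[OF v, of p]
      by (simp add: super_ops(3) hom_ops_eq hsmult_comp)
    then show "?h (r \<odot>\<^bsub>diff_ops C k S\<^esub> v) = r \<odot>\<^bsub>super_hom C b a\<^esub> ?h v"
      unfolding ops by (rule ext)
  next
    fix p v assume "v \<in> part (diff_ops C k S) p"
    then have v: "v \<in> part (super_hom C a a) p"
      by (simp add: diff_ops_def Let_def)
    then have "v \<in> carrier (super_hom C a a)"
      by (simp add: super_part)
    then show "?h v \<in> part (super_hom C b a) p"
      using v h_carrier by (simp add: super_part h_eval)
  qed
qed

end

theorem theorem2p22:
  fixes R :: "('r, 'q) ring_scheme"
    and C :: "('r, 'o, 'm, 'z) pi_category_scheme" (structure)
    and k :: nat
  assumes "pi_category R C"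
    and "infinite (UNIV :: 's set)"
    and "tensor_cocomplete TYPE('s) C"
  shows
    "(\<forall>(A :: ('o, 'm) monoid_object) x f (S :: ('o, 'm) symmetric_algebra) b j g.
        commutative_monoid C A \<and> x \<in> Ob C \<and> f \<in> Hom C x (und A) \<and>
        is_symmetric_algebra C x S \<and> is_truncation C S k b j \<and>
        monoid_map C S A g \<and> g \<cdot> generator C S = f \<and> epi_arrow C g \<longrightarrow>
          precomp C b (und A) (und A) (g \<cdot> truncation_map C S k b j)
            \<in> carrier (diff_ops C k A) \<rightarrow> carrier (super_hom C b (und A)) \<and>
          inj_on (precomp C b (und A) (und A) (g \<cdot> truncation_map C S k b j))
            (carrier (diff_ops C k A)))
     \<and>
     (\<forall>x (S :: ('o, 'm) symmetric_algebra) b j.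
        x \<in> Ob C \<and> is_symmetric_algebra C x S \<and> is_truncation C S k b j \<longrightarrow>
          supermodule_iso R (diff_ops C k S) (super_hom C b (und S))
            (precomp C b (und S) (und S) (truncation_map C S k b j)))"
proof -
  interpret pi_category R C
    by (rule assms(1))
  have alg: "pi_symmetric_algebra R C TYPE('s) x S k b j"
    if "x \<in> Ob C" "is_symmetric_algebra C x S" "is_truncation C S k b j"
    for x and S :: "('o, 'm) symmetric_algebra" and b j
    by unfold_locales (use assms that in simp_all)
  show ?thesis
  proof (intro conjI allI impI; elim conjE)
    fix A :: "('o, 'm) monoid_object" and x f and S :: "('o, 'm) symmetric_algebra" and b j g
    assume *: "commutative_monoid C A" "x \<in> Ob C" "is_symmetric_algebra C x S" "is_truncation C S k b j"
      "monoid_map C S A g" "epi_arrow C g"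
    interpret S: pi_symmetric_algebra R C "TYPE('s)" x S k b j
      by (rule alg) (use * in simp_all)
    interpret A: pi_monoid R C A
      by unfold_locales (use * in simp)
    have "arr g" "src g = und S" "tgt g = und A"
      using * by (simp_all add: monoid_map_def hom_iff)
    then show "precomp C b (und A) (und A) (g \<cdot> truncation_map C S k b j)
        \<in> carrier (diff_ops C k A) \<rightarrow> carrier (super_hom C b (und A))"
      by (auto simp: A.diff_ops_carrier simp del: A.has_order.simps intro!: precomp_carrier)
    show "inj_on (precomp C b (und A) (und A) (g \<cdot> truncation_map C S k b j)) (carrier (diff_ops C k A))"
      using * by (intro S.precomp_inj)
  next
    fix x and S :: "('o, 'm) symmetric_algebra" and b j
    assume "x \<in> Ob C" "is_symmetric_algebra C x S" "is_truncation C S k b j"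
    then interpret S: pi_symmetric_algebra R C "TYPE('s)" x S k b j
      by (rule alg)
    show "supermodule_iso R (diff_ops C k S) (super_hom C b (und S))
        (precomp C b (und S) (und S) (truncation_map C S k b j))"
      by (rule S.precomp_iso)
  qed
qed

end
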